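(* A minimal distal metric dynamical system $(X,\Gamma)$ is injective if and only if it is equicontinuous.
   Context: A dynamical system $(X,\Gamma)$: compact Hausdorff $X$ with a continuous action of a topological group $\Gamma$; metric means $X$ metrizable. $E(X,\Gamma)$ denotes the enveloping semigroup, the pointwise closure in $X^X$ of $\{x\mapsto \gamma x:\gamma\in\Gamma\}$. Let $M(X)$ be the space of Borel probability measures on $X$ with the weak$^*$ topology and the induced action $(\gamma\nu)(f)=\nu(f\circ\gamma)$. Identifying $X$ with the Dirac measures $\{\delta_x\}\subset M(X)$, each element of $E(M(X),\Gamma)$ restricts to an element of $E(X,\Gamma)$, giving a natural surjective homomorphism $E(M(X),\Gamma)\to E(X,\Gamma)$. The system is called injective if this natural map is an isomorphism. Minimal: every orbit is dense. Distal: $x\neq y$ implies $\inf$ over $\gamma$ of $d(\gamma x,\gamma y)>0$ (no nontrivial proximal pairs). *)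

theory Defs
  imports "HOL-Probability.Probability"
begin

definition dyn_system :: "'a::metric_space set \<Rightarrow> ('g::topological_group_add \<Rightarrow> 'a \<Rightarrow> 'a) \<Rightarrow> bool" where
  "dyn_system X act \<longleftrightarrow> compact X
     \<and> (\<forall>g. \<forall>x\<in>X. act g x \<in> X)
     \<and> (\<forall>x\<in>X. act 0 x = x)
     \<and> (\<forall>g h. \<forall>x\<in>X. act (g + h) x = act g (act h x))
     \<and> continuous_on (UNIV \<times> X) (\<lambda>(g, x). act g x)"

definition borelX :: "'a::metric_space set \<Rightarrow> 'a measure" where
  "borelX X = restrict_space borel X"

definition PM :: "'a::metric_space set \<Rightarrow> 'a measure set" where
  "PM X = {N. prob_space N \<and> sets N = sets (borelX X)}"

definition weak_star :: "'a::metric_space set \<Rightarrow> 'a measure topology" where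
  "weak_star X = topology_generated_by
     {{N \<in> PM X. integral\<^sup>L N f \<in> U} | (f :: 'a \<Rightarrow> real) U. continuous_on X f \<and> open U}"

definition induced :: "'a::metric_space set \<Rightarrow> ('g \<Rightarrow> 'a \<Rightarrow> 'a) \<Rightarrow> 'g \<Rightarrow> 'a measure \<Rightarrow> 'a measure" where
  "induced X act g N = distr N (borelX X) (act g)"

definition enveloping :: "'b topology \<Rightarrow> 'b set \<Rightarrow> ('g \<Rightarrow> 'b \<Rightarrow> 'b) \<Rightarrow> ('b \<Rightarrow> 'b) set" where
  "enveloping T D F = (product_topology (\<lambda>_. T) D) closure_of ((\<lambda>g. restrict (F g) D) ` UNIV)"

definition E_X :: "'a::metric_space set \<Rightarrow> ('g \<Rightarrow> 'a \<Rightarrow> 'a) \<Rightarrow> ('a \<Rightarrow> 'a) set" where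
  "E_X X act = enveloping (top_of_set X) X act"

definition E_M :: "'a::metric_space set \<Rightarrow> ('g \<Rightarrow> 'a \<Rightarrow> 'a) \<Rightarrow> ('a measure \<Rightarrow> 'a measure) set" where
  "E_M X act = enveloping (weak_star X) (PM X) (induced X act)"

definition dirac :: "'a::metric_space set \<Rightarrow> 'a \<Rightarrow> 'a measure" where
  "dirac X x = return (borelX X) x"

text \<open>The natural map E(M(X)) \<rightarrow> E(X): restriction to the Dirac measures (identified with X).\<close>
definition natural_map :: "'a::metric_space set \<Rightarrow> ('a measure \<Rightarrow> 'a measure) \<Rightarrow> ('a \<Rightarrow> 'a)" where
  "natural_map X p = (\<lambda>x\<in>X. THE y. y \<in> X \<and> p (dirac X x) = dirac X y)"

text \<open>Injective system: the natural (surjective homomorphism) map is an isomorphism.\<close>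
definition injective_system :: "'a::metric_space set \<Rightarrow> ('g \<Rightarrow> 'a \<Rightarrow> 'a) \<Rightarrow> bool" where
  "injective_system X act \<longleftrightarrow> bij_betw (natural_map X) (E_M X act) (E_X X act)"

definition minimal_system :: "'a::metric_space set \<Rightarrow> ('g \<Rightarrow> 'a \<Rightarrow> 'a) \<Rightarrow> bool" where
  "minimal_system X act \<longleftrightarrow> (\<forall>x\<in>X. closure (range (\<lambda>g. act g x)) = X)"

definition distal_system :: "'a::metric_space set \<Rightarrow> ('g \<Rightarrow> 'a \<Rightarrow> 'a) \<Rightarrow> bool" where
  "distal_system X act \<longleftrightarrow>
     (\<forall>x\<in>X. \<forall>y\<in>X. x \<noteq> y \<longrightarrow> (INF g. dist (act g x) (act g y)) > 0)"

definition equicontinuous_system :: "'a::metric_space set \<Rightarrow> ('g \<Rightarrow> 'a \<Rightarrow> 'a) \<Rightarrow> bool" where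
  "equicontinuous_system X act \<longleftrightarrow>
     (\<forall>x\<in>X. \<forall>e>0. \<exists>d>0. \<forall>y\<in>X. dist x y < d \<longrightarrow> (\<forall>g. dist (act g x) (act g y) < e))"

end

theory Submission
  imports Defs
begin

text \<open>
  If the system is equicontinuous, every \<open>P \<in> E(M(X))\<close> is the push-forward along its restriction
  \<open>p \<in> E(X)\<close>, because a net converging to \<open>p\<close> pointwise converges uniformly; so \<open>p\<close> determines \<open>P\<close>.

  Conversely, distality makes \<open>E(X)\<close> a group (Ellis), and injectivity transports this to \<open>E(M(X))\<close>.
  Invertibility of \<open>P\<close> upgrades the weak convergence \<open>\<integral> f \<circ> g d\<mu> \<rightarrow> \<integral> f dP\<mu>\<close>, as \<open>g\<close> tends to \<open>P\<close>,
  to Cauchy convergence of \<open>f \<circ> g\<close> in \<open>L\<^sup>2(\<mu>)\<close>. Since \<open>E(M(X))\<close> is compact, \<open>\<Gamma>\<close> is therefore totally bounded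
  in the pseudometric \<open>\<integral> d(gx, hx) d\<mu>(x)\<close> for every \<open>\<mu>\<close>. If for some open \<open>V\<close> no finite family of
  open subsets \<open>U\<close> of \<open>V\<close> had the property that each \<open>g\<close> is \<open>\<epsilon>\<close>-small on one of them, a Cantor scheme
  would produce a measure \<open>\<mu>\<close> and a uniformly separated sequence in \<open>\<Gamma>\<close>. From such finite families
  and the Baire category theorem one gets a point \<open>z\<close> such that any \<open>y\<close> obtained as a limit of
  \<open>k z'\<close>, with \<open>z' \<rightarrow> z\<close> and \<open>k \<rightarrow> id\<close> pointwise, is proximal to \<open>z\<close>. By distality \<open>y = z\<close>, which means
  that \<open>z\<close> is an equicontinuity point; minimality spreads this over \<open>X\<close>.
\<close>

section \<open>Measures on a compact metric space and the Riesz representation theorem\<close>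

text \<open>E(M(X)) lives in a product indexed by all measures, so it need not be metrizable, and a
  sequence in \<Gamma> need not have a convergent subsequence. Limits are therefore replaced by
  cluster points: elements that any finite list of tests sees approximated arbitrarily late in the
  sequence. For measures their existence rests on the Riesz theorem, because a limit of integrals is
  at first only a functional.

  The L^2 statement is an instance of the principle that weak convergence together with convergence
  of norms is convergence in norm. Passing to a weak limit of f \<circ> g can lose norm; the inverse
  of P is what excludes the loss.

  Integrals control averages, whereas equicontinuity concerns individual points. The Cantor scheme
  bridges the gap: it arranges the failures of smallness so evenly that one measure sees all of
  them.

  Elements of E(X) are pointwise limits and are not known to be continuous in this direction. Each
  of them is therefore replaced by a group element, at finitely many points, before any continuity
  is used; this dictates the order in which constants are chosen.\<close>

lemma space_PM: "N \<in> PM X \<Longrightarrow> space N = X"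
  by (auto simp: PM_def borelX_def space_restrict_space dest: sets_eq_imp_space_eq)

lemma prob_space_PM: "N \<in> PM X \<Longrightarrow> prob_space N"
  by (simp add: PM_def)

lemma measurable_PM:
  assumes "N \<in> PM X" "continuous_on X f"
  shows "f \<in> borel_measurable N"
proof -
  have "sets N = sets (restrict_space borel X)" using assms by (simp add: PM_def borelX_def)
  with borel_measurable_continuous_on_restrict[OF assms(2)] show ?thesis
    using measurable_cong_sets by blast
qed

lemma bounded_on_compact:
  fixes f :: "'a::metric_space \<Rightarrow> real"
  assumes "compact X" "continuous_on X f"
  obtains B where "B > 0" "\<And>x. x \<in> X \<Longrightarrow> \<bar>f x\<bar> \<le> B"
proof -
  have "bounded (f ` X)" using assms compact_continuous_image compact_imp_bounded by blast
  then show ?thesis unfolding bounded_pos using that by auto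
qed

lemma integrable_PM:
  fixes f :: "'a::metric_space \<Rightarrow> real"
  assumes "compact X" "N \<in> PM X" "continuous_on X f"
  shows "integrable N f"
proof -
  interpret prob_space N using assms by (simp add: PM_def)
  obtain B where "\<And>x. x \<in> X \<Longrightarrow> \<bar>f x\<bar> \<le> B" using bounded_on_compact assms by metis
  then show ?thesis
    by (intro integrable_const_bound[where B=B] AE_I2) (auto simp: space_PM[OF assms(2)] intro: measurable_PM[OF assms(2,3)])
qed

lemma sets_borelX: "sets (borelX X) = sigma_sets X {X \<inter> C |C. closed C}"
proof -
  have "sets (borelX X) = (\<inter>) X ` sigma_sets UNIV {C. closed C}"
    unfolding borelX_def sets_restrict_space borel_eq_closed by (simp add: image_def)
  also have "\<dots> = sigma_sets X ((\<inter>) X ` {C. closed C})"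
    using sigma_sets_vimage_commute[of "\<lambda>x. x" X UNIV "{C. closed C}"]
    by (simp add: image_def Int_commute Collect_conj_eq Bex_def conj_commute)
  finally show ?thesis by (simp add: image_def setcompr_eq_image)
qed

text \<open>Closed traces form an intersection-stable generator of the Borel sets, so it suffices to
  compare the measures there. The indicator of such a set is a decreasing pointwise limit of
  continuous functions, and dominated convergence carries the equality over.\<close>

lemma PM_eqI:
  assumes X: "compact X" and M: "M \<in> PM X" and N: "N \<in> PM X"
    and eq: "\<And>f :: 'a::metric_space \<Rightarrow> real. continuous_on X f \<Longrightarrow> integral\<^sup>L M f = integral\<^sup>L N f"
  shows "M = N"
proof (rule measure_eqI_generator_eq[where \<Omega>=X and E="{X \<inter> C |C. closed C}" and A="\<lambda>_. X"])
  show "Int_stable {X \<inter> C |C. closed C}"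
  proof (rule Int_stableI)
    fix a b assume "a \<in> {X \<inter> C |C. closed C}" "b \<in> {X \<inter> C |C. closed C}"
    then obtain C D where "a = X \<inter> C" "b = X \<inter> D" "closed C" "closed D" by auto
    then show "a \<inter> b \<in> {X \<inter> C |C. closed C}" by (intro CollectI exI[of _ "C \<inter> D"]) auto
  qed
  show "sets M = sigma_sets X {X \<inter> C |C. closed C}" "sets N = sigma_sets X {X \<inter> C |C. closed C}"
    using M N by (auto simp: PM_def sets_borelX)
  show "range (\<lambda>_. X) \<subseteq> {X \<inter> C |C. closed C}" by (auto intro!: exI[of _ UNIV])
  show "\<And>i. emeasure M X \<noteq> \<infinity>"
    using prob_space.emeasure_space_1[OF prob_space_PM[OF M]] space_PM[OF M] by simp
next
  fix A assume "A \<in> {X \<inter> C |C. closed C}"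
  then obtain C where C: "closed C" "A = X \<inter> C" by auto
  show "emeasure M A = emeasure N A"
  \<comment> \<open>\<open>infdist\<close> to the empty set is 0 by convention, so the functions
    below would be constantly 1 in that case.\<close>
  proof (cases "C = {}")
    case False
    define f where "f n x = max 0 (1 - real n * infdist x C)" for n x
    have cf: "continuous_on X (f n)" for n
      unfolding f_def by (intro continuous_intros)
    have lim: "(\<lambda>n. f n x) \<longlonglongrightarrow> indicator A x" if "x \<in> X" for x
    proof (cases "x \<in> C")
      case True
      then show ?thesis using that by (simp add: C f_def)
    next
      case False
      then have "infdist x C > 0"
        using C \<open>C \<noteq> {}\<close> in_closed_iff_infdist_zero infdist_nonneg[of x C] by fastforce
      then obtain m where m: "1 < real m * infdist x C" using reals_Archimedean3 by blast
      have "f n x = 0" if "n \<ge> m" for n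
      proof -
        have "real m * infdist x C \<le> real n * infdist x C" using that infdist_nonneg mult_right_mono of_nat_mono by blast
        with m show ?thesis by (simp add: f_def)
      qed
      then have "eventually (\<lambda>n. f n x = 0) sequentially" unfolding eventually_sequentially by blast
      then show ?thesis using False by (simp add: C tendsto_eventually)
    qed
    have L: "(\<lambda>n. integral\<^sup>L K (f n)) \<longlonglongrightarrow> measure K A" if K: "K \<in> PM X" for K
    proof -
      interpret prob_space K using K by (simp add: PM_def)
      have A: "A \<in> sets K" using K C by (auto simp: PM_def sets_borelX intro!: sigma_sets.Basic)
      have "(\<lambda>n. integral\<^sup>L K (f n)) \<longlonglongrightarrow> integral\<^sup>L K (indicator A :: _ \<Rightarrow> real)"
        by (rule integral_dominated_convergence[where w="\<lambda>_. 1"])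
           (use A K cf lim in \<open>auto simp: measurable_PM space_PM f_def infdist_nonneg intro!: AE_I2\<close>)
      then show ?thesis using A by simp
    qed
    have "measure M A = measure N A"
      using L[OF M] L[OF N] eq[OF cf] LIMSEQ_unique by auto
    then show ?thesis
      using prob_space_PM[OF M] prob_space_PM[OF N]
      by (simp add: finite_measure.emeasure_eq_measure prob_space.finite_measure)
  qed (simp add: C)
qed auto

text \<open>The distance to the complement serves as \<phi>. An empty complement needs its own
  function, since \<open>infdist\<close> to the empty set is 0.\<close>

lemma openin_cozero:
  fixes X :: "'a::metric_space set"
  assumes "openin (top_of_set X) U"
  obtains \<phi> :: "'a \<Rightarrow> real" where "continuous_on X \<phi>" "\<And>x. 0 \<le> \<phi> x"
    "\<And>x. x \<in> X \<Longrightarrow> \<phi> x > 0 \<longleftrightarrow> x \<in> U"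
proof -
  obtain T where T: "open T" "U = X \<inter> T" using assms openin_open by blast
  show ?thesis
  proof (cases "T = UNIV")
    case True
    show ?thesis by (rule that[of "\<lambda>_. 1"]) (auto simp: T True)
  next
    case False
    have "infdist x (- T) > 0 \<longleftrightarrow> x \<in> T" for x
      using in_closed_iff_infdist_zero[of "-T" x] False T(1) infdist_nonneg[of x "-T"]
      by (auto simp: closed_def less_le)
    then show ?thesis
      by (intro that[of "\<lambda>x. infdist x (-T)"]) (auto simp: T infdist_nonneg intro!: continuous_intros)
  qed
qed

section \<open>The Riesz representation theorem, by the outer measure of a positive
  functional\<close>

locale positive_functional =
  fixes X :: "'a::metric_space set" and L :: "('a \<Rightarrow> real) \<Rightarrow> real"
  assumes compact_X: "compact X"
    and add: "\<And>f g. continuous_on X f \<Longrightarrow> continuous_on X g \<Longrightarrow> L (\<lambda>x. f x + g x) = L f + L g"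
    and scale: "\<And>c f. continuous_on X f \<Longrightarrow> L (\<lambda>x. c * f x) = c * L f"
    and pos: "\<And>f. continuous_on X f \<Longrightarrow> (\<And>x. x \<in> X \<Longrightarrow> 0 \<le> f x) \<Longrightarrow> 0 \<le> L f"
    and one: "L (\<lambda>_. 1) = 1"
begin

lemma diff: "continuous_on X f \<Longrightarrow> continuous_on X g \<Longrightarrow> L (\<lambda>x. f x - g x) = L f - L g"
  using add[of f "\<lambda>x. -1 * g x"] scale[of g "-1"] by (simp add: continuous_on_minus)

lemma mono:
  assumes "continuous_on X f" "continuous_on X g" "\<And>x. x \<in> X \<Longrightarrow> f x \<le> g x"
  shows "L f \<le> L g"
  using pos[of "\<lambda>x. g x - f x"] diff[OF assms(2,1)] assms
  by (simp add: continuous_on_diff)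

lemma const: "L (\<lambda>_. c) = c"
  using scale[of "\<lambda>_. 1" c] one by simp

lemma sum: "finite I \<Longrightarrow> (\<And>i. i \<in> I \<Longrightarrow> continuous_on X (f i)) \<Longrightarrow> L (\<lambda>x. \<Sum>i\<in>I. f i x) = (\<Sum>i\<in>I. L (f i))"
  by (induction I rule: finite_induct) (auto simp: const add continuous_on_sum)

text \<open>Functions only have to vanish off U; no compact support inside U is demanded. This keeps
  membership easy to check, and \<open>test_shrink\<close> recovers a margin where compactness is
  used.\<close>

definition test :: "'a set \<Rightarrow> ('a \<Rightarrow> real) set" where
  "test U = {f. continuous_on X f \<and> (\<forall>x\<in>X. 0 \<le> f x \<and> f x \<le> 1) \<and> (\<forall>x\<in>X - U. f x = 0)}"

definition vol :: "'a set \<Rightarrow> ennreal" where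
  "vol U = (SUP f\<in>test U. ennreal (L f))"

definition outer :: "'a set \<Rightarrow> ennreal" where
  "outer A = (INF U\<in>{U. openin (top_of_set X) U \<and> A \<subseteq> U}. vol U)"

lemma vol_upper: "f \<in> test U \<Longrightarrow> ennreal (L f) \<le> vol U"
  unfolding vol_def by (rule SUP_upper)

lemma vol_mono: "U \<subseteq> V \<Longrightarrow> vol U \<le> vol V"
  unfolding vol_def by (rule SUP_subset_mono) (auto simp: test_def)

lemma outer_openin: "openin (top_of_set X) U \<Longrightarrow> outer U = vol U"
  unfolding outer_def by (rule antisym) (auto intro!: INF_lower INF_greatest vol_mono)

lemma outer_mono: "A \<subseteq> B \<Longrightarrow> outer A \<le> outer B"
  unfolding outer_def by (rule INF_superset_mono) auto

lemma vol_empty: "vol {} = 0"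
proof -
  have "L f \<le> 0" if "f \<in> test {}" for f
    using mono[of f "\<lambda>_. 0"] const[of 0] that by (auto simp: test_def)
  then show ?thesis unfolding vol_def by (auto simp: SUP_eq_iff bot_ennreal ennreal_neg intro!: antisym SUP_least)
qed

text \<open>Cutting at height e confines the support to the compact set where f \<ge> e, which lies
  inside U; since L is 1 on the constant 1, the loss is at most e.\<close>

lemma test_shrink:
  assumes "f \<in> test U" "e > 0" "e \<le> 1"
  shows "(\<lambda>x. max 0 (f x - e)) \<in> test U" "L f \<le> L (\<lambda>x. max 0 (f x - e)) + e"
proof -
  have c: "continuous_on X f" using assms by (simp add: test_def)
  show "(\<lambda>x. max 0 (f x - e)) \<in> test U"
    using assms by (auto simp: test_def intro!: continuous_intros)
  have "L f \<le> L (\<lambda>x. max 0 (f x - e) + e)"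
    by (rule mono) (auto intro!: continuous_intros c)
  also have "\<dots> = L (\<lambda>x. max 0 (f x - e)) + e"
    by (subst add) (auto intro!: continuous_intros c simp: const)
  finally show "L f \<le> L (\<lambda>x. max 0 (f x - e)) + e" .
qed

text \<open>After cutting, a test function for the union is dominated by a multiple of finitely many
  cozero functions. Capped partial sums then slice it into pieces, the j-th of which is a test
  function for \<open>U j\<close>.\<close>

lemma vol_subadditive:
  assumes U: "\<And>n. openin (top_of_set X) (U n)"
  shows "vol (\<Union>n. U n) \<le> (\<Sum>n. vol (U n))"
  unfolding vol_def[of "\<Union>n. U n"]
proof (rule SUP_least, rule ennreal_le_epsilon)
  fix f and e :: real assume f: "f \<in> test (\<Union>n. U n)" and "e > 0"
  define d where "d = min e 1"
  have d: "0 < d" "d \<le> 1" "d \<le> e" using \<open>e > 0\<close> by (auto simp: d_def)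
  define f' where "f' x = max 0 (f x - d)" for x
  have cf: "continuous_on X f" using f by (simp add: test_def)
  have cf': "continuous_on X f'" unfolding f'_def by (intro continuous_intros cf)
  have f': "f' \<in> test (\<Union>n. U n)" "L f \<le> L f' + d"
    using test_shrink[OF f d(1,2)] unfolding f'_def by auto
  have "\<exists>\<phi> :: 'a \<Rightarrow> real. continuous_on X \<phi> \<and> (\<forall>x. 0 \<le> \<phi> x) \<and> (\<forall>x\<in>X. \<phi> x > 0 \<longleftrightarrow> x \<in> U n)" for n
    using openin_cozero[OF U] by metis
  then obtain \<phi> :: "nat \<Rightarrow> 'a \<Rightarrow> real" where \<phi>: "\<And>n. continuous_on X (\<phi> n)" "\<And>n x. 0 \<le> \<phi> n x"
    "\<And>n x. x \<in> X \<Longrightarrow> \<phi> n x > 0 \<longleftrightarrow> x \<in> U n" by metis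
  \<comment> \<open>The same m is multiplier and number of summands, so failure produces a single
    sequence of points. At a limit point x of it, f x \<ge> d puts x into some \<open>U n\<close>,
    while the bound 1/k along the subsequence forces \<open>\<phi> n x\<close> to be 0.\<close>
  have "\<exists>m. \<forall>x\<in>X. f' x \<le> real m * (\<Sum>n<m. \<phi> n x)"
  proof (rule ccontr)
    assume "\<not> ?thesis"
    then obtain y where y: "\<And>m. y m \<in> X" "\<And>m. f' (y m) > real m * (\<Sum>n<m. \<phi> n (y m))"
      by (metis not_le)
    obtain x r where x: "x \<in> X" and r: "strict_mono r" "(y \<circ> r) \<longlonglongrightarrow> x"
      using compact_X y(1) unfolding compact_def by meson
    have lim: "(\<lambda>k. h (y (r k))) \<longlonglongrightarrow> h x" if "continuous_on X h" for h :: "'a \<Rightarrow> real"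
      using continuous_on_tendsto_compose[OF that r(2) x] y(1) by (simp add: o_def)
    have pos: "f' (y m) > 0" for m
      using y(2)[of m] by (smt (verit, best) \<phi>(2) mult_nonneg_nonneg of_nat_0_le_iff sum_nonneg)
    have "f (y m) \<ge> d" for m using pos[of m] by (simp add: f'_def max_def split: if_splits)
    then have "f x \<ge> d" using LIMSEQ_le_const[OF lim[OF cf]] by blast
    then have "f x \<noteq> 0" using d by linarith
    then have "x \<in> (\<Union>n. U n)" using f x unfolding test_def by blast
    then obtain n where n: "x \<in> U n" by auto
    then have "\<phi> n x > 0" using \<phi>(3) x by blast
    have le: "\<phi> n (y (r k)) \<le> 1 / real k" if "k > n" for k
    proof -
      have rk: "r k \<ge> k" using r(1) by (simp add: seq_suble)
      have "real k * \<phi> n (y (r k)) \<le> real (r k) * (\<Sum>n<r k. \<phi> n (y (r k)))"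
        using rk that \<phi>(2) by (intro mult_mono member_le_sum sum_nonneg) auto
      also have "\<dots> < f' (y (r k))" using y(2) by blast
      also have "\<dots> \<le> 1" using f'(1) y(1) by (simp add: test_def)
      finally show ?thesis using that by (simp add: field_simps)
    qed
    have "\<phi> n x \<le> 0"
    proof (rule LIMSEQ_le[OF lim[OF \<phi>(1)] lim_1_over_n])
      show "\<exists>N. \<forall>k\<ge>N. \<phi> n (y (r k)) \<le> 1 / real k" using le by (intro exI[of _ "Suc n"]) auto
    qed
    with \<open>\<phi> n x > 0\<close> show False by simp
  qed
  then obtain m where m: "\<And>x. x \<in> X \<Longrightarrow> f' x \<le> real m * (\<Sum>n<m. \<phi> n x)" by blast
  \<comment> \<open>Partial sums capped by f': the increment from j to j + 1 vanishes off
    \<open>U j\<close> because \<open>\<phi> j\<close> does, and the increments telescope to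
    f'.\<close>
  define s where "s j x = min (f' x) (real m * (\<Sum>n<j. \<phi> n x))" for j x
  have cs: "continuous_on X (s j)" for j unfolding s_def by (intro continuous_intros cf' \<phi>)
  have t: "(\<lambda>x. s (Suc j) x - s j x) \<in> test (U j)" for j
  proof -
    have 1: "0 \<le> s j x" "s j x \<le> s (Suc j) x" "s (Suc j) x \<le> 1" if "x \<in> X" for x j
    proof -
      show "0 \<le> s j x" using f' that \<phi>(2) by (auto simp: s_def test_def sum_nonneg)
      have "real m * (\<Sum>n<j. \<phi> n x) \<le> real m * (\<Sum>n<Suc j. \<phi> n x)"
        using \<phi>(2) by (intro mult_left_mono) auto
      then show "s j x \<le> s (Suc j) x" unfolding s_def by linarith
      show "s (Suc j) x \<le> 1" using f' that by (auto simp: s_def test_def min_le_iff_disj)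
    qed
    have 2: "s (Suc j) x - s j x = 0" if "x \<in> X - U j" for x
    proof -
      have "\<phi> j x = 0" using that \<phi>(3)[of x j] \<phi>(2)[of j x] by (auto simp: less_le)
      then show ?thesis by (simp add: s_def)
    qed
    show ?thesis unfolding test_def
      using 1 2 by (auto intro!: continuous_intros cs) (smt (verit))
  qed
  have "L f' = L (\<lambda>x. \<Sum>j<m. s (Suc j) x - s j x)"
  proof (intro antisym mono cf' continuous_intros cs)
    fix x assume "x \<in> X"
    have "(\<Sum>j<m. s (Suc j) x - s j x) = s m x - s 0 x" by (rule sum_lessThan_telescope)
    also have "\<dots> = f' x" using m[OF \<open>x \<in> X\<close>] f'(1) \<open>x \<in> X\<close> by (auto simp: s_def test_def min_def)
    finally show "f' x \<le> (\<Sum>j<m. s (Suc j) x - s j x)" "(\<Sum>j<m. s (Suc j) x - s j x) \<le> f' x" by auto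
  qed
  also have "\<dots> = (\<Sum>j<m. L (\<lambda>x. s (Suc j) x - s j x))"
    by (rule sum) (auto intro!: continuous_intros cs)
  finally have "ennreal (L f') = (\<Sum>j<m. ennreal (L (\<lambda>x. s (Suc j) x - s j x)))"
    using t by (subst sum_ennreal) (auto intro!: pos continuous_intros cs simp: test_def)
  also have "\<dots> \<le> (\<Sum>j<m. vol (U j))" using t by (intro sum_mono vol_upper)
  also have "\<dots> \<le> (\<Sum>n. vol (U n))" by (rule sum_le_suminf) auto
  finally have *: "ennreal (L f') \<le> (\<Sum>n. vol (U n))" .
  have "ennreal (L f) \<le> ennreal (L f' + e)" using f'(2) d(3) by (intro ennreal_leI) auto
  also have "\<dots> = ennreal (L f') + ennreal e"
    using \<open>e > 0\<close> f'(1) by (intro ennreal_plus pos cf') (auto simp: test_def)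
  finally show "ennreal (L f) \<le> (\<Sum>n. vol (U n)) + ennreal e"
    using * by (meson add_right_mono order_trans)
qed

lemma outer_subadditive: "outer (\<Union>n::nat. A n) \<le> (\<Sum>n. outer (A n))"
proof (cases "(\<Sum>n. outer (A n)) = \<top>")
  case False
  show ?thesis
  proof (rule ennreal_le_epsilon)
    fix e :: real assume "e > 0"
    have fin: "outer (A n) \<noteq> \<top>" for n
      using False ennreal_suminf_lessD[of "\<lambda>n. outer (A n)" \<top> n] by (simp add: less_top)
    have "\<exists>U. openin (top_of_set X) U \<and> A n \<subseteq> U \<and> vol U < outer (A n) + ennreal (e * (1/2)^Suc n)" for n
    proof -
      have "outer (A n) < outer (A n) + ennreal (e * (1/2)^Suc n)"
        using fin[of n] \<open>e > 0\<close> ennreal_add_left_cancel_less[of "outer (A n)" 0 "ennreal (e * (1/2)^Suc n)"]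
        by (simp del: power_Suc)
      then show ?thesis by (subst (asm) (1) outer_def) (auto simp: INF_less_iff)
    qed
    then obtain U where U: "\<And>n. openin (top_of_set X) (U n)" "\<And>n. A n \<subseteq> U n"
      "\<And>n. vol (U n) < outer (A n) + ennreal (e * (1/2)^Suc n)" by metis
    have "outer (\<Union>n. A n) \<le> outer (\<Union>n. U n)" using U(2) by (intro outer_mono) blast
    also have "\<dots> = vol (\<Union>n. U n)" using U(1) by (intro outer_openin openin_Union) auto
    also have "\<dots> \<le> (\<Sum>n. vol (U n))" by (rule vol_subadditive[OF U(1)])
    also have "\<dots> \<le> (\<Sum>n. outer (A n) + ennreal (e * (1/2)^Suc n))"
      using U(3) by (intro suminf_le) (auto intro: less_imp_le)
    also have "\<dots> = (\<Sum>n. outer (A n)) + (\<Sum>n. ennreal (e * (1/2)^Suc n))"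
      by (intro suminf_add[symmetric]) auto
    also have "(\<Sum>n. ennreal (e * (1/2)^Suc n)) = ennreal e"
      using \<open>e > 0\<close> sums_mult[OF power_half_series, of e] by (intro suminf_ennreal_eq) auto
    finally show "outer (\<Union>n. A n) \<le> (\<Sum>n. outer (A n)) + ennreal e" .
  qed
qed simp

text \<open>The nontrivial half of Caratheodory's criterion, for open W. The cut function f'
  vanishes where f < d, and V is that part of W; so adding to f' a test function for V gives a test
  function for W, while V still covers W - U.\<close>

lemma vol_split:
  assumes U: "openin (top_of_set X) U" and W: "openin (top_of_set X) W"
  shows "vol (W \<inter> U) + outer (W - U) \<le> vol W"
proof -
  have "ennreal (L f) + outer (W - U) \<le> vol W" if f: "f \<in> test (W \<inter> U)" for f
  proof (rule ennreal_le_epsilon)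
    fix e :: real assume "e > 0"
    define d where "d = min e 1"
    have d: "0 < d" "d \<le> 1" "d \<le> e" using \<open>e > 0\<close> by (auto simp: d_def)
    define f' where "f' x = max 0 (f x - d)" for x
    have cf: "continuous_on X f" using f by (simp add: test_def)
    have cf': "continuous_on X f'" unfolding f'_def by (intro continuous_intros cf)
    have f': "f' \<in> test (W \<inter> U)" "L f \<le> L f' + d"
      using test_shrink[OF f d(1,2)] unfolding f'_def by auto
    define V where "V = W \<inter> {x \<in> X. f x < d}"
    have "openin (top_of_set X) {x \<in> X. f x < d}"
      using continuous_openin_preimage_gen[OF cf, of "{..<d}"] by (simp add: vimage_def Int_def)
    then have V: "openin (top_of_set X) V" unfolding V_def using W by blast
    have "W - U \<subseteq> V" using f d openin_imp_subset[OF W] by (auto simp: V_def test_def)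
    then have "outer (W - U) \<le> vol V" using outer_openin[OF V] outer_mono by metis
    moreover have *: "ennreal (L f') + ennreal (L g) \<le> vol W" if g: "g \<in> test V" for g
    proof -
      have cg: "continuous_on X g" using g by (simp add: test_def)
      have "(\<lambda>x. f' x + g x) \<in> test W"
      proof -
        have "0 \<le> f' x + g x \<and> f' x + g x \<le> 1 \<and> (x \<notin> W \<longrightarrow> f' x + g x = 0)" if x: "x \<in> X" for x
        proof (cases "f x < d")
          case True
          then have "f' x = 0" by (simp add: f'_def)
          then show ?thesis using g x by (auto simp: test_def V_def)
        next
          case False
          then have "g x = 0" using g x by (auto simp: test_def V_def)
          then show ?thesis using f'(1) x by (auto simp: test_def)
        qed
        then show ?thesis by (auto simp: test_def intro!: continuous_intros cf' cg)
      qed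
      then have "ennreal (L (\<lambda>x. f' x + g x)) \<le> vol W" by (rule vol_upper)
      moreover have "0 \<le> L f'" "0 \<le> L g" using f'(1) g cf' cg by (auto simp: test_def intro!: pos)
      ultimately show ?thesis by (simp add: add cf' cg)
    qed
    moreover have "ennreal (L f') + vol V \<le> vol W"
    proof -
      have "(\<lambda>_. 0) \<in> test V" by (simp add: test_def)
      then have "ennreal (L f') + vol V = (SUP g\<in>test V. ennreal (L f') + ennreal (L g))"
        unfolding vol_def by (subst ennreal_SUP_add_right) auto
      with * show ?thesis by (simp add: SUP_least)
    qed
    moreover have "ennreal (L f) \<le> ennreal (L f') + ennreal e"
    proof -
      have "0 \<le> L f'" using f'(1) cf' by (auto simp: test_def intro!: pos)
      then show ?thesis using f'(2) d \<open>e > 0\<close> by (simp add: ennreal_plus[symmetric] ennreal_leI del: ennreal_plus)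
    qed
    ultimately show "ennreal (L f) + outer (W - U) \<le> vol W + ennreal e"
      by (smt (verit) add.commute add.left_commute add_mono order_trans order_refl)
  qed
  moreover have "test (W \<inter> U) \<noteq> {}" by (auto simp: test_def intro: exI[of _ "\<lambda>_. 0"])
  ultimately show ?thesis unfolding vol_def[of "W \<inter> U"]
    by (subst ennreal_SUP_add_left[symmetric]) (auto intro!: SUP_least)
qed

text \<open>Enclosing A in open sets W reduces one inequality to \<open>vol_split\<close>; the other
  is subadditivity for two sets, padded with empty ones.\<close>

lemma openin_lambda_system:
  assumes U: "openin (top_of_set X) U"
  shows "U \<in> lambda_system X (Pow X) outer"
proof -
  interpret sigma_algebra X "Pow X" by (rule sigma_algebra_Pow)
  have "outer (A \<inter> U) + outer (A - U) = outer A" if A: "A \<subseteq> X" for A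
  proof (rule antisym)
    have "outer (A \<inter> U) + outer (A - U) \<le> vol W" if W: "openin (top_of_set X) W" "A \<subseteq> W" for W
    proof -
      have "outer (A \<inter> U) + outer (A - U) \<le> outer (W \<inter> U) + outer (W - U)"
        using W by (intro add_mono outer_mono) auto
      also have "\<dots> = vol (W \<inter> U) + outer (W - U)" using U W by (subst outer_openin) auto
      finally show ?thesis using vol_split[OF U W(1)] by (rule order_trans)
    qed
    then show "outer (A \<inter> U) + outer (A - U) \<le> outer A"
      unfolding outer_def[of A] by (auto intro!: INF_greatest)
    let ?B = "\<lambda>n::nat. if n = 0 then A \<inter> U else if n = 1 then A - U else {}"
    have "outer A \<le> outer (\<Union>n. ?B n)"
    proof (rule outer_mono, rule subsetI)
      fix x assume "x \<in> A"
      then have "x \<in> ?B 0 \<or> x \<in> ?B 1" by auto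
      then show "x \<in> (\<Union>n. ?B n)" by blast
    qed
    also have "\<dots> \<le> (\<Sum>n. outer (?B n))" by (rule outer_subadditive)
    also have "\<dots> = (\<Sum>n\<in>{0,1}. outer (?B n))"
      by (rule suminf_finite) (auto simp: outer_openin vol_empty)
    finally show "outer A \<le> outer (A \<inter> U) + outer (A - U)" by simp
  qed
  then show ?thesis using openin_imp_subset[OF U] by (auto simp: lambda_system_eq)
qed

definition rep :: "'a measure" where
  "rep = measure_of X (sets (borelX X)) outer"

lemma rep_measure_space: "measure_space X (sets (borelX X)) outer"
proof -
  interpret sigma_algebra X "Pow X" by (rule sigma_algebra_Pow)
  have "outer_measure_space (Pow X) outer"
    using outer_subadditive outer_mono
    by (auto simp: outer_measure_space_def positive_def increasing_def countably_subadditive_def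
        outer_openin vol_empty)
  note ms = caratheodory_lemma[OF this]
  then have sa: "sigma_algebra X (lambda_system X (Pow X) outer)" by (simp add: measure_space_def)
  have "X \<inter> C \<in> lambda_system X (Pow X) outer" if "closed C" for C
  proof -
    have "X - C \<in> lambda_system X (Pow X) outer"
      using that by (intro openin_lambda_system) (auto simp: Diff_eq openin_open)
    then have "X - (X - C) \<in> lambda_system X (Pow X) outer"
      using sa algebra.compl_sets sigma_algebra_def by blast
    then show ?thesis by (simp add: Diff_Diff_Int)
  qed
  then have 1: "sets (borelX X) \<subseteq> lambda_system X (Pow X) outer"
    unfolding sets_borelX by (intro sigma_algebra.sigma_sets_subset[OF sa]) auto
  have "sigma_algebra X (sets (borelX X))"
    using sets.sigma_algebra_axioms[of "borelX X"] by (simp add: borelX_def space_restrict_space)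
  then show "measure_space X (sets (borelX X)) outer" using measure_down[OF ms _ 1] by blast
qed

lemma sets_rep: "sets rep = sets (borelX X)" and space_rep: "space rep = X"
  and emeasure_rep: "A \<in> sets (borelX X) \<Longrightarrow> emeasure rep A = outer A"
proof -
  have sa: "sigma_algebra X (sets (borelX X))"
    using sets.sigma_algebra_axioms[of "borelX X"] by (simp add: borelX_def space_restrict_space)
  have "sets (borelX X) \<subseteq> Pow X" using sa by (simp add: sigma_algebra_iff2)
  then show "sets rep = sets (borelX X)" "space rep = X"
    using sa by (simp_all add: rep_def sigma_algebra.sigma_sets_eq space_measure_of)
  show "A \<in> sets (borelX X) \<Longrightarrow> emeasure rep A = outer A"
    unfolding rep_def using rep_measure_space by (intro emeasure_measure_of_sigma) (auto simp: measure_space_def)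
qed

lemma openin_sets_borelX: "openin (top_of_set X) U \<Longrightarrow> U \<in> sets (borelX X)"
  by (auto simp: openin_open borelX_def sets_restrict_space)

lemma rep_PM: "rep \<in> PM X"
proof -
  have "vol X = 1"
  proof (rule antisym)
    have "L f \<le> 1" if "f \<in> test X" for f
      using mono[of f "\<lambda>_. 1"] one that by (auto simp: test_def)
    then show "vol X \<le> 1" unfolding vol_def by (intro SUP_least) simp
    have "(\<lambda>_. 1) \<in> test X" by (auto simp: test_def)
    from vol_upper[OF this] show "1 \<le> vol X" by (simp add: one)
  qed
  then have "emeasure rep (space rep) = 1"
    by (simp add: space_rep emeasure_rep openin_sets_borelX outer_openin)
  then show ?thesis by (simp add: PM_def sets_rep prob_spaceI)
qed

text \<open>Cut f into n layers of height 1/n. The layer \<open>h j\<close>, rescaled to [0,1], lies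
  between the indicators of \<open>U (Suc j)\<close> and \<open>U j\<close>. Its value under L is
  bounded by the measure of the larger set, its integral from below by that of the smaller one; the
  index shift costs one term, which is at most 1, hence 1/n in the end.\<close>

lemma functional_le_integral:
  assumes cf: "continuous_on X f" and f01: "\<And>x. x \<in> X \<Longrightarrow> 0 \<le> f x \<and> f x \<le> 1"
  shows "L f \<le> integral\<^sup>L rep f"
proof (rule field_le_epsilon)
  fix e :: real assume "e > 0"
  then obtain n where n: "n > 0" "1 / real n < e" using ex_inverse_of_nat_less
    by (auto simp: inverse_eq_divide)
  interpret prob_space rep using rep_PM by (simp add: PM_def)
  define U where "U j = {x\<in>X. real j / real n < f x}" for j
  have U: "openin (top_of_set X) (U j)" for j
    using continuous_openin_preimage_gen[OF cf, of "{real j / real n<..}"] by (simp add: vimage_def Int_def U_def)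
  define h where "h j x = min 1 (max 0 (real n * f x - real j))" for j x
  have ch: "continuous_on X (h j)" for j unfolding h_def by (intro continuous_intros cf)
  have th: "h j \<in> test (U j)" for j
    using ch n by (auto simp: test_def h_def U_def field_simps)
  have tel: "(\<Sum>j<m. h j x) = min (real m) (real n * f x)" if "x \<in> X" for x m
    using f01[OF that] n by (induction m) (auto simp: h_def)
  then have fh: "real n * f x = (\<Sum>j<n. h j x)" if "x \<in> X" for x
    using f01[OF that] n that mult_left_mono[of "f x" 1 "real n"] by (simp add: min_def)
  have L1: "L (h j) \<le> measure rep (U j)" for j
  proof -
    have "ennreal (L (h j)) \<le> emeasure rep (U j)"
      using vol_upper[OF th] U by (simp add: emeasure_rep openin_sets_borelX outer_openin)
    then show ?thesis by (simp add: emeasure_eq_measure)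
  qed
  have L2: "measure rep (U (Suc j)) \<le> integral\<^sup>L rep (h j)" for j
  proof -
    have 1: "U (Suc j) \<in> sets rep" using U openin_sets_borelX sets_rep by blast
    have "integral\<^sup>L rep (indicator (U (Suc j)) :: _ \<Rightarrow> real) \<le> integral\<^sup>L rep (h j)"
    proof (rule integral_mono)
      show "integrable rep (indicator (U (Suc j)) :: _ \<Rightarrow> real)"
        using 1 by (auto simp: integrable_indicator_iff emeasure_eq_measure)
      show "integrable rep (h j)" by (rule integrable_PM[OF compact_X rep_PM ch])
      show "indicator (U (Suc j)) x \<le> h j x" for x
        using n by (auto simp: indicator_def U_def h_def field_simps)
    qed
    then show ?thesis using 1 by simp
  qed
  have "real n * L f = L (\<lambda>x. real n * f x)" by (simp add: scale cf)
  also have "\<dots> = L (\<lambda>x. \<Sum>j<n. h j x)"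
    by (intro antisym mono continuous_intros cf ch) (auto simp: fh)
  also have "\<dots> = (\<Sum>j<n. L (h j))" by (intro sum ch) auto
  also have "\<dots> \<le> (\<Sum>j<n. measure rep (U j))" by (intro sum_mono L1)
  also have "\<dots> \<le> (\<Sum>j<Suc n. measure rep (U j))" by simp
  also have "\<dots> = measure rep (U 0) + (\<Sum>j<n. measure rep (U (Suc j)))"
    by (rule sum.lessThan_Suc_shift)
  also have "\<dots> \<le> 1 + (\<Sum>j<n. integral\<^sup>L rep (h j))" by (intro add_mono sum_mono L2) auto
  also have "(\<Sum>j<n. integral\<^sup>L rep (h j)) = integral\<^sup>L rep (\<lambda>x. \<Sum>j<n. h j x)"
    by (rule Bochner_Integration.integral_sum[symmetric]) (rule integrable_PM[OF compact_X rep_PM ch])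
  also have "\<dots> = integral\<^sup>L rep (\<lambda>x. real n * f x)"
    by (rule Bochner_Integration.integral_cong) (auto simp: fh space_rep)
  finally have "L f \<le> 1 / real n + integral\<^sup>L rep f" using n by (simp add: field_simps)
  then show "L f \<le> integral\<^sup>L rep f + e" using n by simp
qed

text \<open>An affine change of values moves f into [0,1]; the resulting inequality applied to -f is
  the reverse one.\<close>

theorem functional_eq_integral:
  assumes cf: "continuous_on X f"
  shows "L f = integral\<^sup>L rep f"
proof -
  interpret prob_space rep using rep_PM by (simp add: PM_def)
  have le: "L f \<le> integral\<^sup>L rep f" if cf: "continuous_on X f" for f
  proof -
    obtain B where B: "B > 0" "\<And>x. x \<in> X \<Longrightarrow> \<bar>f x\<bar> \<le> B"
      using bounded_on_compact[OF compact_X cf] by blast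
    have c: "continuous_on X (\<lambda>x. 1/2 + (1 / (2*B)) * f x)" by (intro continuous_intros cf)
    have "L (\<lambda>x. 1/2 + (1 / (2*B)) * f x) \<le> integral\<^sup>L rep (\<lambda>x. 1/2 + (1 / (2*B)) * f x)"
    proof (rule functional_le_integral[OF c])
      fix x assume "x \<in> X"
      from B(2)[OF this] B(1) show "0 \<le> 1/2 + (1 / (2*B)) * f x \<and> 1/2 + (1 / (2*B)) * f x \<le> 1"
        by (auto simp: field_simps abs_le_iff)
    qed
    moreover have "L (\<lambda>x. 1/2 + (1 / (2*B)) * f x) = 1/2 + (1 / (2*B)) * L f"
      using scale[OF cf, of "1 / (2*B)"] B(1) by (subst add) (auto intro!: continuous_intros cf simp: const)
    moreover have "integral\<^sup>L rep (\<lambda>x. 1/2 + (1 / (2*B)) * f x) = 1/2 + (1 / (2*B)) * integral\<^sup>L rep f"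
      using integrable_PM[OF compact_X rep_PM cf] prob_space by simp
    ultimately show ?thesis using B(1) by (simp add: field_simps)
  qed
  have "L (\<lambda>x. - f x) \<le> integral\<^sup>L rep (\<lambda>x. - f x)" by (intro le continuous_intros cf)
  then have "integral\<^sup>L rep f \<le> L f" using scale[OF cf, of "-1"] by simp
  with le[OF cf] show ?thesis by simp
qed

end

section \<open>Enveloping semigroups\<close>

text \<open>The index set may be uncountable, so Tychonoff's theorem yields no convergent
  subsequence, only a point b in the closures of all tails. The n that works depends on the finite
  set K.\<close>

lemma cluster_point:
  fixes a :: "nat \<Rightarrow> 'i \<Rightarrow> 'm::metric_space"
  assumes C: "\<And>i. i \<in> I \<Longrightarrow> compact (C i)" and a: "\<And>n i. i \<in> I \<Longrightarrow> a n i \<in> C i"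
  obtains b where "\<And>i. i \<in> I \<Longrightarrow> b i \<in> C i"
    "\<And>K e n0. finite K \<Longrightarrow> K \<subseteq> I \<Longrightarrow> e > 0 \<Longrightarrow> \<exists>n\<ge>n0. \<forall>i\<in>K. dist (a n i) (b i) < e"
proof -
  define T where "T = product_topology (\<lambda>i. top_of_set (C i)) I"
  have "compact_space T"
    unfolding T_def using C by (simp add: compact_space_product_topology compact_space_subtopology)
  define F where "F n = T closure_of {restrict (a m) I |m. m \<ge> n}" for n
  have sub: "{restrict (a m) I |m. m \<ge> n} \<subseteq> topspace T" for n
    using a by (auto simp: T_def)
  have "(\<Inter>n. F n) \<noteq> {}"
  proof (rule compact_space_imp_nest[OF \<open>compact_space T\<close>])
    show "closedin T (F n)" for n by (simp add: F_def)
    show "F n \<noteq> {}" for n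
      using closure_of_subset[OF sub[of n]] unfolding F_def by blast
    show "decseq F" unfolding decseq_def F_def
      by (intro allI impI closure_of_mono) (auto intro: order_trans)
  qed
  then obtain b where b: "\<And>n. b \<in> F n" by blast
  then have bT: "b \<in> topspace T" using closure_of_subset_topspace[of T] unfolding F_def by (meson subsetD)
  show ?thesis
  proof (rule that)
    show "b i \<in> C i" if "i \<in> I" for i using bT that by (auto simp: T_def)
    fix K and e :: real and n0 assume K: "finite K" "K \<subseteq> I" "e > 0"
    define W where "W = Pi\<^sub>E I (\<lambda>i. if i \<in> K then C i \<inter> ball (b i) e else C i)"
    have "finite {i \<in> I. (if i \<in> K then C i \<inter> ball (b i) e else C i) \<noteq> C i}"
      by (rule finite_subset[OF _ K(1)]) (auto split: if_splits)
    then have "openin T W" unfolding T_def W_def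
      by (auto simp: openin_PiE_gen openin_open_Int)
    moreover have "b \<in> W" using bT K(3) by (auto simp: T_def W_def)
    ultimately obtain m where "m \<ge> n0" "restrict (a m) I \<in> W"
      using b[of n0] unfolding F_def in_closure_of by auto
    then have "dist (a m i) (b i) < e" if "i \<in> K" for i
      using that K(2) PiE_mem[of "restrict (a m) I" I "\<lambda>i. if i \<in> K then C i \<inter> ball (b i) e else C i" i]
      by (simp add: W_def subset_iff dist_commute)
    with \<open>m \<ge> n0\<close> show "\<exists>n\<ge>n0. \<forall>i\<in>K. dist (a n i) (b i) < e" by blast
  qed
qed

lemma enveloping_iff:
  assumes F: "\<And>g s. s \<in> D \<Longrightarrow> F g s \<in> topspace T"
  shows "p \<in> enveloping T D F \<longleftrightarrow> p \<in> D \<rightarrow>\<^sub>E topspace T \<and>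
    (\<forall>S U. finite S \<longrightarrow> S \<subseteq> D \<longrightarrow> (\<forall>s\<in>S. openin T (U s) \<and> p s \<in> U s) \<longrightarrow> (\<exists>g. \<forall>s\<in>S. F g s \<in> U s))"
    (is "?l \<longleftrightarrow> ?r")
proof
  let ?P = "product_topology (\<lambda>_. T) D"
  assume ?l
  then have p: "p \<in> ?P closure_of ((\<lambda>g. restrict (F g) D) ` UNIV)" by (simp add: enveloping_def)
  have pD: "p \<in> D \<rightarrow>\<^sub>E topspace T" using p closure_of_subset_topspace by fastforce
  moreover have "\<exists>g. \<forall>s\<in>S. F g s \<in> U s"
    if S: "finite S" "S \<subseteq> D" "\<forall>s\<in>S. openin T (U s) \<and> p s \<in> U s" for S U
  proof -
    define W where "W = Pi\<^sub>E D (\<lambda>i. if i \<in> S then U i else topspace T)"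
    have "finite {i \<in> D. (if i \<in> S then U i else topspace T) \<noteq> topspace T}"
      by (rule finite_subset[OF _ S(1)]) (auto split: if_splits)
    then have "openin ?P W" using S unfolding W_def by (auto simp: openin_PiE_gen)
    moreover have "p \<in> W" using pD S by (auto simp: W_def)
    ultimately obtain g where "restrict (F g) D \<in> W" using p unfolding in_closure_of by blast
    then have "F g s \<in> U s" if "s \<in> S" for s
      using that S(2) PiE_mem[of "restrict (F g) D" D "\<lambda>i. if i \<in> S then U i else topspace T" s]
      by (simp add: W_def subset_iff)
    then show ?thesis by blast
  qed
  ultimately show ?r by blast
next
  let ?P = "product_topology (\<lambda>_. T) D"
  assume r: ?r
  have "\<exists>y. y \<in> range (\<lambda>g. restrict (F g) D) \<and> y \<in> W" if W: "openin ?P W" "p \<in> W" for W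
  proof -
    from bspec[OF W(1)[unfolded openin_product_topology_alt] W(2)] show ?thesis
    proof (elim exE conjE)
      fix U assume U: "finite {i \<in> D. U i \<noteq> topspace T}" "\<forall>i\<in>D. openin T (U i)" "p \<in> Pi\<^sub>E D U" "Pi\<^sub>E D U \<subseteq> W"
      have "\<forall>s\<in>{i \<in> D. U i \<noteq> topspace T}. openin T (U s) \<and> p s \<in> U s"
        using U by (auto simp: PiE_iff)
      then obtain g where g: "\<forall>s\<in>{i \<in> D. U i \<noteq> topspace T}. F g s \<in> U s"
        using r[THEN conjunct2, THEN spec, THEN spec[of _ U], THEN mp, OF U(1)] by auto
      have "F g s \<in> U s" if "s \<in> D" for s
        using g F[OF that] that by (cases "U s = topspace T") auto
      then have "restrict (F g) D \<in> Pi\<^sub>E D U" by auto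
      with U(4) show ?thesis by blast
    qed
  qed
  moreover have "p \<in> topspace ?P" using r by simp
  ultimately show ?l unfolding enveloping_def in_closure_of by blast
qed

section \<open>The weak-star topology in terms of finitely many integrals\<close>

lemma topspace_weak_star: "topspace (weak_star X) = PM X"
proof -
  have "PM X = {N \<in> PM X. integral\<^sup>L N (\<lambda>_. 0::real) \<in> UNIV}" by simp
  then have "PM X \<in> {{N \<in> PM X. integral\<^sup>L N f \<in> U} | (f :: 'a \<Rightarrow> real) U. continuous_on X f \<and> open U}"
    using continuous_on_const open_UNIV by blast
  then show ?thesis unfolding weak_star_def topology_generated_by_topspace by blast
qed

lemma openin_weak_star_basic:
  fixes f :: "'a::metric_space \<Rightarrow> real"
  assumes "continuous_on X f"
  shows "openin (weak_star X) {M \<in> PM X. \<bar>integral\<^sup>L M f - c\<bar> < e}"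
proof -
  have eq: "{M \<in> PM X. \<bar>integral\<^sup>L M f - c\<bar> < e} = {M \<in> PM X. integral\<^sup>L M f \<in> ball c e}"
    by (auto simp: dist_real_def abs_minus_commute)
  show ?thesis unfolding eq weak_star_def openin_topology_generated_by_iff
    using assms by (intro generate_topology_on.Basis) blast
qed

text \<open>The topology is given by a subbase, so neighbourhoods are extracted by induction over
  its generation; the local property \<open>Q\<close> survives finite intersections and arbitrary
  unions.\<close>

lemma weak_star_nbhd:
  assumes "openin (weak_star X) U" "N \<in> U"
  obtains F :: "('a::metric_space \<Rightarrow> real) set" and e where "finite F" "\<And>f. f \<in> F \<Longrightarrow> continuous_on X f" "e > 0"
    "\<And>M. M \<in> PM X \<Longrightarrow> (\<And>f. f \<in> F \<Longrightarrow> \<bar>integral\<^sup>L M f - integral\<^sup>L N f\<bar> < e) \<Longrightarrow> M \<in> U"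
proof -
  define Q where "Q U \<longleftrightarrow> (\<forall>N\<in>U. \<exists>(F :: ('a \<Rightarrow> real) set) e. finite F \<and> (\<forall>f\<in>F. continuous_on X f) \<and> e > 0 \<and>
    (\<forall>M\<in>PM X. (\<forall>f\<in>F. \<bar>integral\<^sup>L M f - integral\<^sup>L N f\<bar> < e) \<longrightarrow> M \<in> U))" for U
  have "generate_topology_on {{N \<in> PM X. integral\<^sup>L N f \<in> U} | (f :: 'a \<Rightarrow> real) U. continuous_on X f \<and> open U} U"
    using assms(1) by (simp add: weak_star_def openin_topology_generated_by_iff)
  then have "Q U"
  proof induction
    case Empty
    then show ?case by (simp add: Q_def)
  next
    case (Int a b)
    show ?case unfolding Q_def
    proof
      fix N assume N: "N \<in> a \<inter> b"
      obtain F :: "('a \<Rightarrow> real) set" and e where F: "finite F" "\<forall>f\<in>F. continuous_on X f" "e > 0"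
        "\<forall>M\<in>PM X. (\<forall>f\<in>F. \<bar>integral\<^sup>L M f - integral\<^sup>L N f\<bar> < e) \<longrightarrow> M \<in> a"
        using bspec[OF Int.IH(1)[unfolded Q_def] IntD1[OF N]] by blast
      obtain G :: "('a \<Rightarrow> real) set" and d where G: "finite G" "\<forall>f\<in>G. continuous_on X f" "d > 0"
        "\<forall>M\<in>PM X. (\<forall>f\<in>G. \<bar>integral\<^sup>L M f - integral\<^sup>L N f\<bar> < d) \<longrightarrow> M \<in> b"
        using bspec[OF Int.IH(2)[unfolded Q_def] IntD2[OF N]] by blast
      show "\<exists>(F :: ('a \<Rightarrow> real) set) e. finite F \<and> (\<forall>f\<in>F. continuous_on X f) \<and> e > 0 \<and>
        (\<forall>M\<in>PM X. (\<forall>f\<in>F. \<bar>integral\<^sup>L M f - integral\<^sup>L N f\<bar> < e) \<longrightarrow> M \<in> a \<inter> b)"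
        using F G by (intro exI[of _ "F \<union> G"] exI[of _ "min e d"]) auto
    qed
  next
    case (UN K)
    show ?case unfolding Q_def
    proof
      fix N assume "N \<in> \<Union>K"
      then obtain k where k: "k \<in> K" "N \<in> k" by blast
      from bspec[OF UN.IH[OF k(1), unfolded Q_def] k(2)]
      show "\<exists>(F :: ('a \<Rightarrow> real) set) e. finite F \<and> (\<forall>f\<in>F. continuous_on X f) \<and> e > 0 \<and>
        (\<forall>M\<in>PM X. (\<forall>f\<in>F. \<bar>integral\<^sup>L M f - integral\<^sup>L N f\<bar> < e) \<longrightarrow> M \<in> \<Union>K)"
        using k(1) by (elim exE) (intro exI, auto)
    qed
  next
    case (Basis s)
    then obtain f U where f: "s = {N \<in> PM X. integral\<^sup>L N f \<in> U}" "continuous_on X f" "open (U :: real set)" by blast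
    show ?case unfolding Q_def
    proof
      fix N assume "N \<in> s"
      then obtain e where "e > 0" "ball (integral\<^sup>L N f) e \<subseteq> U" using f open_contains_ball by blast
      then show "\<exists>(F :: ('a \<Rightarrow> real) set) e. finite F \<and> (\<forall>f\<in>F. continuous_on X f) \<and> e > 0 \<and>
        (\<forall>M\<in>PM X. (\<forall>f\<in>F. \<bar>integral\<^sup>L M f - integral\<^sup>L N f\<bar> < e) \<longrightarrow> M \<in> s)"
        using f by (intro exI[of _ "{f}"] exI[of _ e]) (auto simp: subset_iff dist_real_def abs_minus_commute)
    qed
  qed
  from bspec[OF this[unfolded Q_def] assms(2)] show ?thesis
    by (elim exE conjE) (rule that, auto)
qed

lemma measurable_continuous_PM:
  assumes "continuous_on X q" "q \<in> X \<rightarrow> X" "N \<in> PM X"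
  shows "q \<in> measurable N (borelX X)"
proof -
  have "q \<in> measurable (borelX X) (borelX X)"
    unfolding borelX_def using assms(1,2)
    by (intro measurable_restrict_space2 borel_measurable_continuous_on_restrict)
       (auto simp: space_restrict_space)
  moreover have "sets N = sets (borelX X)" using assms by (simp add: PM_def)
  ultimately show ?thesis using measurable_cong_sets by blast
qed

lemma distr_PM:
  assumes "continuous_on X q" "q \<in> X \<rightarrow> X" "N \<in> PM X"
  shows "distr N (borelX X) q \<in> PM X"
    and "continuous_on X f \<Longrightarrow> integral\<^sup>L (distr N (borelX X) q) f = integral\<^sup>L N (\<lambda>x. f (q x) :: real)"
proof -
  note m = measurable_continuous_PM[OF assms]
  show "distr N (borelX X) q \<in> PM X"
    using prob_space.prob_space_distr[OF prob_space_PM[OF assms(3)] m] by (simp add: PM_def)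
  show "integral\<^sup>L (distr N (borelX X) q) f = integral\<^sup>L N (\<lambda>x. f (q x))" if "continuous_on X f"
    using that by (intro integral_distr m) (simp add: borelX_def borel_measurable_continuous_on_restrict)
qed

lemma dirac_PM:
  assumes "x \<in> X"
  shows "dirac X x \<in> PM X" and "continuous_on X f \<Longrightarrow> integral\<^sup>L (dirac X x) f = (f x :: real)"
proof -
  have x: "x \<in> space (borelX X)" using assms by (simp add: borelX_def space_restrict_space)
  then show "dirac X x \<in> PM X" by (simp add: PM_def dirac_def prob_space_return)
  show "integral\<^sup>L (dirac X x) f = f x" if "continuous_on X f"
    using that x unfolding dirac_def
    by (intro integral_return) (simp_all add: borelX_def borel_measurable_continuous_on_restrict)
qed

lemma dirac_inject:
  fixes X :: "'a::metric_space set"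
  assumes "x \<in> X" "y \<in> X" "dirac X x = dirac X y"
  shows "x = y"
  using dirac_PM(2)[of x X "\<lambda>z. dist z y"] dirac_PM(2)[of y X "\<lambda>z. dist z y"] assms
  by (simp add: continuous_on_dist continuous_on_id)

section \<open>Compact systems and composition in both enveloping semigroups\<close>

locale compact_system =
  fixes X :: "'a::metric_space set" and act :: "'g::topological_group_add \<Rightarrow> 'a \<Rightarrow> 'a"
  assumes dyn: "dyn_system X act"
begin

lemma compact_X: "compact X"
  and act_in: "x \<in> X \<Longrightarrow> act g x \<in> X"
  and act_0: "x \<in> X \<Longrightarrow> act 0 x = x"
  and act_add: "x \<in> X \<Longrightarrow> act (g + h) x = act g (act h x)"
  using dyn by (auto simp: dyn_system_def)

lemma continuous_act: "continuous_on X (act g)"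
proof -
  have "continuous_on (UNIV \<times> X) (\<lambda>(g, x). act g x)" using dyn by (simp add: dyn_system_def)
  from continuous_on_compose2[OF this, of X "\<lambda>x. (g, x)"] show ?thesis
    by (auto simp: continuous_on_Pair continuous_on_const continuous_on_id)
qed

lemma continuous_comp_act:
  "continuous_on X f \<Longrightarrow> continuous_on X (\<lambda>x. f (act g x))"
  by (rule continuous_on_compose2[OF _ continuous_act]) (auto simp: act_in)

lemma induced_PM: "N \<in> PM X \<Longrightarrow> induced X act g N \<in> PM X"
  and integral_induced: "N \<in> PM X \<Longrightarrow> continuous_on X f \<Longrightarrow>
    integral\<^sup>L (induced X act g N) f = integral\<^sup>L N (\<lambda>x. f (act g x) :: real)"
  using distr_PM[OF continuous_act] act_in by (auto simp: induced_def)

lemma E_X_iff: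
  "p \<in> E_X X act \<longleftrightarrow> p \<in> X \<rightarrow>\<^sub>E X \<and>
    (\<forall>S e. finite S \<longrightarrow> S \<subseteq> X \<longrightarrow> e > 0 \<longrightarrow> (\<exists>g. \<forall>s\<in>S. dist (act g s) (p s) < e))"
    (is "_ \<longleftrightarrow> _ \<and> ?r")
proof -
  have "(\<forall>S U. finite S \<longrightarrow> S \<subseteq> X \<longrightarrow> (\<forall>s\<in>S. openin (top_of_set X) (U s) \<and> p s \<in> U s) \<longrightarrow> (\<exists>g. \<forall>s\<in>S. act g s \<in> U s)) \<longleftrightarrow> ?r"
    (is "?l \<longleftrightarrow> _") if p: "p \<in> X \<rightarrow>\<^sub>E X"
  proof
    assume l: ?l
    show ?r
    proof (intro allI impI)
      fix S and e :: real assume S: "finite S" "S \<subseteq> X" "e > 0"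
      have "\<forall>s\<in>S. openin (top_of_set X) (X \<inter> ball (p s) e) \<and> p s \<in> X \<inter> ball (p s) e"
        using S p by (auto simp: openin_open_Int)
      from l[rule_format, OF S(1,2) this[rule_format]] show "\<exists>g. \<forall>s\<in>S. dist (act g s) (p s) < e"
        by (auto simp: dist_commute)
    qed
  next
    assume r: ?r
    show ?l
    proof (intro allI impI)
      fix S U assume S: "finite S" "S \<subseteq> X" "\<forall>s\<in>S. openin (top_of_set X) (U s) \<and> p s \<in> U s"
      have "\<forall>s\<in>S. \<exists>e>0. \<forall>y\<in>X. dist y (p s) < e \<longrightarrow> y \<in> U s"
        using S(3) unfolding openin_euclidean_subtopology_iff by blast
      then obtain e where e: "\<And>s. s \<in> S \<Longrightarrow> e s > 0" "\<And>s y. s \<in> S \<Longrightarrow> y \<in> X \<Longrightarrow> dist y (p s) < e s \<Longrightarrow> y \<in> U s"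
        by metis
      define d where "d = Min (insert 1 (e ` S))"
      have d: "d > 0" "\<And>s. s \<in> S \<Longrightarrow> d \<le> e s" using S e by (auto simp: d_def)
      obtain g where "\<forall>s\<in>S. dist (act g s) (p s) < d" using r[rule_format, OF S(1,2) d(1)] by blast
      then have "act g s \<in> U s" if "s \<in> S" for s
        using e(2)[OF that act_in] d(2)[OF that] S(2) that by fastforce
      then show "\<exists>g. \<forall>s\<in>S. act g s \<in> U s" by blast
    qed
  qed
  then show ?thesis unfolding E_X_def by (subst enveloping_iff) (auto simp: act_in)
qed

text \<open>Removes both the topology and the push-forwards: a basic neighbourhood in the product
  over all measures is a finite set of pairs (measure, test function) with a tolerance.\<close>

lemma E_M_iff:
  "P \<in> E_M X act \<longleftrightarrow> P \<in> PM X \<rightarrow>\<^sub>E PM X \<and>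
    (\<forall>K e. finite K \<longrightarrow> (\<forall>(N, f)\<in>K. N \<in> PM X \<and> continuous_on X f) \<longrightarrow> e > 0 \<longrightarrow>
      (\<exists>g. \<forall>(N, f)\<in>K. \<bar>integral\<^sup>L N (\<lambda>x. f (act g x)) - integral\<^sup>L (P N) f\<bar> < (e::real)))"
    (is "_ \<longleftrightarrow> _ \<and> ?r")
proof -
  have "(\<forall>S U. finite S \<longrightarrow> S \<subseteq> PM X \<longrightarrow> (\<forall>s\<in>S. openin (weak_star X) (U s) \<and> P s \<in> U s) \<longrightarrow> (\<exists>g. \<forall>s\<in>S. induced X act g s \<in> U s)) \<longleftrightarrow> ?r"
    (is "?l \<longleftrightarrow> _") if P: "P \<in> PM X \<rightarrow>\<^sub>E PM X"
  proof
    assume l: ?l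
    show ?r
    proof (intro allI impI)
      fix K :: "('a measure \<times> ('a \<Rightarrow> real)) set" and e :: real
      assume K: "finite K" "\<forall>(N, f)\<in>K. N \<in> PM X \<and> continuous_on X f" "e > 0"
      define U where "U N = (\<Inter>f\<in>{f. (N, f) \<in> K}. {M \<in> PM X. \<bar>integral\<^sup>L M f - integral\<^sup>L (P N) f\<bar> < e})" for N
      have "openin (weak_star X) (U N) \<and> P N \<in> U N" if "N \<in> fst ` K" for N
      proof
        have "{f. (N, f) \<in> K} = snd ` (K \<inter> {N} \<times> UNIV)" by force
        then have "finite {f. (N, f) \<in> K}" using K(1) by simp
        moreover have "{f. (N, f) \<in> K} \<noteq> {}" using that by force
        ultimately show "openin (weak_star X) (U N)" unfolding U_def
          using K(2) by (intro openin_INT2 openin_weak_star_basic) auto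
        show "P N \<in> U N" using K that P by (auto simp: U_def)
      qed
      moreover have "fst ` K \<subseteq> PM X" using K(2) by auto
      ultimately obtain g where g: "\<forall>N\<in>fst ` K. induced X act g N \<in> U N" using l K(1) by blast
      show "\<exists>g. \<forall>(N, f)\<in>K. \<bar>integral\<^sup>L N (\<lambda>x. f (act g x)) - integral\<^sup>L (P N) f\<bar> < e"
      proof (rule exI[of _ g], clarify)
        fix N f assume Nf: "(N, f) \<in> K"
        then have "induced X act g N \<in> U N" using g by force
        then have "\<bar>integral\<^sup>L (induced X act g N) f - integral\<^sup>L (P N) f\<bar> < e"
          using Nf by (auto simp: U_def)
        then show "\<bar>integral\<^sup>L N (\<lambda>x. f (act g x)) - integral\<^sup>L (P N) f\<bar> < e"
          using integral_induced K(2) Nf by fastforce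
      qed
    qed
  next
    assume r: ?r
    show ?l
    proof (intro allI impI)
      fix S U assume S: "finite S" "S \<subseteq> PM X" "\<forall>s\<in>S. openin (weak_star X) (U s) \<and> P s \<in> U s"
      have "\<forall>s\<in>S. \<exists>(F :: ('a \<Rightarrow> real) set) e. finite F \<and> (\<forall>f\<in>F. continuous_on X f) \<and> e > 0 \<and>
        (\<forall>M\<in>PM X. (\<forall>f\<in>F. \<bar>integral\<^sup>L M f - integral\<^sup>L (P s) f\<bar> < e) \<longrightarrow> M \<in> U s)"
      proof
        fix s assume "s \<in> S"
        then have "openin (weak_star X) (U s)" "P s \<in> U s" using S by auto
        then obtain F :: "('a \<Rightarrow> real) set" and e where "finite F" "\<And>f. f \<in> F \<Longrightarrow> continuous_on X f" "e > 0"
          "\<And>M. M \<in> PM X \<Longrightarrow> (\<And>f. f \<in> F \<Longrightarrow> \<bar>integral\<^sup>L M f - integral\<^sup>L (P s) f\<bar> < e) \<Longrightarrow> M \<in> U s"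
          using weak_star_nbhd[of X "U s" "P s"] by metis
        then show "\<exists>(F :: ('a \<Rightarrow> real) set) e. finite F \<and> (\<forall>f\<in>F. continuous_on X f) \<and> e > 0 \<and>
          (\<forall>M\<in>PM X. (\<forall>f\<in>F. \<bar>integral\<^sup>L M f - integral\<^sup>L (P s) f\<bar> < e) \<longrightarrow> M \<in> U s)"
          by (intro exI[of _ F] exI[of _ e]) auto
      qed
      then obtain F e where F: "\<And>s. s \<in> S \<Longrightarrow> finite (F s)" "\<And>s f. s \<in> S \<Longrightarrow> f \<in> F s \<Longrightarrow> continuous_on X (f :: 'a \<Rightarrow> real)"
        "\<And>s. s \<in> S \<Longrightarrow> e s > 0"
        "\<And>s M. s \<in> S \<Longrightarrow> M \<in> PM X \<Longrightarrow> (\<forall>f\<in>F s. \<bar>integral\<^sup>L M f - integral\<^sup>L (P s) f\<bar> < e s) \<Longrightarrow> M \<in> U s"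
        by metis
      define d where "d = Min (insert 1 (e ` S))"
      have d: "d > 0" "\<And>s. s \<in> S \<Longrightarrow> d \<le> e s" using S F by (auto simp: d_def)
      obtain g where g: "\<forall>(N, f)\<in>Sigma S F. \<bar>integral\<^sup>L N (\<lambda>x. f (act g x)) - integral\<^sup>L (P N) f\<bar> < d"
      proof -
        have "\<forall>(N, f)\<in>Sigma S F. N \<in> PM X \<and> continuous_on X f" using S F(2) by auto
        moreover have "finite (Sigma S F)" using S F(1) by auto
        ultimately show ?thesis using r d(1) that by meson
      qed
      have "induced X act g s \<in> U s" if s: "s \<in> S" for s
      proof (rule F(4)[OF s induced_PM], safe)
        show "s \<in> PM X" using S s by auto
        fix f assume f: "f \<in> F s"
        have "\<bar>integral\<^sup>L s (\<lambda>x. f (act g x)) - integral\<^sup>L (P s) f\<bar> < d" using g f s by auto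
        moreover have "integral\<^sup>L (induced X act g s) f = integral\<^sup>L s (\<lambda>x. f (act g x))"
          using F(2)[OF s f] S s by (intro integral_induced) auto
        ultimately show "\<bar>integral\<^sup>L (induced X act g s) f - integral\<^sup>L (P s) f\<bar> < e s"
          using d(2)[OF s] by simp
      qed
      then show "\<exists>g. \<forall>s\<in>S. induced X act g s \<in> U s" by blast
    qed
  qed
  then show ?thesis unfolding E_M_def by (subst enveloping_iff) (auto simp: induced_PM topspace_weak_star)
qed

lemma E_M_approx:
  assumes "P \<in> E_M X act" "finite K" "\<And>N f. (N, f) \<in> K \<Longrightarrow> N \<in> PM X \<and> continuous_on X f" "e > 0"
  obtains g where "\<And>N f. (N, f) \<in> K \<Longrightarrow> \<bar>integral\<^sup>L N (\<lambda>x. f (act g x)) - integral\<^sup>L (P N) f\<bar> < (e::real)"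
proof -
  have "\<forall>(N, f)\<in>K. N \<in> PM X \<and> continuous_on X f" using assms(3) by auto
  then have "\<exists>g. \<forall>(N, f)\<in>K. \<bar>integral\<^sup>L N (\<lambda>x. f (act g x)) - integral\<^sup>L (P N) f\<bar> < (e::real)"
    using assms unfolding E_M_iff by blast
  then show ?thesis using that by blast
qed

lemma E_M_PM: "P \<in> E_M X act \<Longrightarrow> N \<in> PM X \<Longrightarrow> P N \<in> PM X"
  unfolding E_M_iff by auto

lemma E_X_in: "p \<in> E_X X act \<Longrightarrow> x \<in> X \<Longrightarrow> p x \<in> X"
  unfolding E_X_iff by auto

lemma E_X_approx:
  assumes "p \<in> E_X X act" "finite S" "S \<subseteq> X" "e > 0"
  obtains g where "\<And>s. s \<in> S \<Longrightarrow> dist (act g s) (p s) < e"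
  using assms unfolding E_X_iff by metis

lemma E_X_comp:
  assumes p: "p \<in> E_X X act" and q: "q \<in> E_X X act"
  shows "restrict (p \<circ> q) X \<in> E_X X act"
  unfolding E_X_iff
proof (intro conjI allI impI)
  show "restrict (p \<circ> q) X \<in> X \<rightarrow>\<^sub>E X" using p q E_X_in by auto
  fix S and e :: real assume S: "finite S" "S \<subseteq> X" "e > 0"
  have "finite (q ` S)" "q ` S \<subseteq> X" "e/2 > 0" using S q E_X_in by auto
  then obtain h where h: "\<And>s. s \<in> q ` S \<Longrightarrow> dist (act h s) (p s) < e/2" using E_X_approx[OF p] by metis
  have "\<forall>s\<in>S. \<exists>d>0. \<forall>y\<in>X. dist y (q s) < d \<longrightarrow> dist (act h y) (act h (q s)) < e/2"
    using continuous_act[of h] S E_X_in[OF q] unfolding continuous_on_iff by (meson half_gt_zero subset_iff)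
  then obtain d where d: "\<And>s. s \<in> S \<Longrightarrow> d s > 0"
    "\<And>s y. s \<in> S \<Longrightarrow> y \<in> X \<Longrightarrow> dist y (q s) < d s \<Longrightarrow> dist (act h y) (act h (q s)) < e/2" by metis
  have "Min (insert 1 (d ` S)) > 0" using S d by auto
  then obtain g where g: "\<And>s. s \<in> S \<Longrightarrow> dist (act g s) (q s) < Min (insert 1 (d ` S))"
    using E_X_approx[OF q S(1,2)] by metis
  show "\<exists>g. \<forall>s\<in>S. dist (act g s) (restrict (p \<circ> q) X s) < e"
  proof (rule exI[of _ "h + g"], rule ballI)
    fix s assume s: "s \<in> S"
    then have "dist (act g s) (q s) < d s" using g[OF s] S by simp
    then have "dist (act h (act g s)) (act h (q s)) < e/2" using d s S act_in by blast
    moreover have "dist (act h (q s)) (p (q s)) < e/2" using h s by blast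
    ultimately have "dist (act h (act g s)) (p (q s)) < e"
      using dist_triangle[of "act h (act g s)" "p (q s)" "act h (q s)"] by linarith
    then show "dist (act (h + g) s) (restrict (p \<circ> q) X s) < e"
      using s S act_add by auto
  qed
qed

lemma E_M_comp:
  assumes P: "P \<in> E_M X act" and Q: "Q \<in> E_M X act"
  shows "restrict (P \<circ> Q) (PM X) \<in> E_M X act"
  unfolding E_M_iff
proof (intro conjI allI impI)
  show "restrict (P \<circ> Q) (PM X) \<in> PM X \<rightarrow>\<^sub>E PM X" using P Q E_M_PM by auto
  fix K :: "('a measure \<times> ('a \<Rightarrow> real)) set" and e :: real
  assume K: "finite K" "\<forall>(N, f)\<in>K. N \<in> PM X \<and> continuous_on X f" "e > 0"
  have Kc: "N \<in> PM X \<and> continuous_on X f" if "(N, f) \<in> K" for N f using K(2) that by auto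
  obtain h where h: "\<And>N f. (N, f) \<in> (\<lambda>(N, f). (Q N, f)) ` K \<Longrightarrow> \<bar>integral\<^sup>L N (\<lambda>x. f (act h x)) - integral\<^sup>L (P N) f\<bar> < e/2"
    by (rule E_M_approx[OF P, of "(\<lambda>(N, f). (Q N, f)) ` K" "e/2"]) (use K(1,3) Kc E_M_PM[OF Q] in auto)
  obtain g where g: "\<And>N f. (N, f) \<in> (\<lambda>(N, f). (N, \<lambda>x. f (act h x))) ` K \<Longrightarrow> \<bar>integral\<^sup>L N (\<lambda>x. f (act g x)) - integral\<^sup>L (Q N) f\<bar> < e/2"
    by (rule E_M_approx[OF Q, of "(\<lambda>(N, f). (N, \<lambda>x. f (act h x))) ` K" "e/2"]) (use K(1,3) in \<open>auto dest: Kc intro!: continuous_comp_act\<close>)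
  show "\<exists>g. \<forall>(N, f)\<in>K. \<bar>integral\<^sup>L N (\<lambda>x. f (act g x)) - integral\<^sup>L (restrict (P \<circ> Q) (PM X) N) f\<bar> < e"
  proof (rule exI[of _ "h + g"], clarify)
    fix N f assume Nf: "(N, f) \<in> K"
    then have N: "N \<in> PM X" using K by auto
    have 1: "\<bar>integral\<^sup>L (Q N) (\<lambda>x. f (act h x)) - integral\<^sup>L (P (Q N)) f\<bar> < e/2" using h Nf by force
    have 2: "\<bar>integral\<^sup>L N (\<lambda>x. f (act h (act g x))) - integral\<^sup>L (Q N) (\<lambda>x. f (act h x))\<bar> < e/2"
      using g[of N "\<lambda>x. f (act h x)"] Nf by force
    have "integral\<^sup>L N (\<lambda>x. f (act (h + g) x)) = integral\<^sup>L N (\<lambda>x. f (act h (act g x)))"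
      by (rule Bochner_Integration.integral_cong) (auto simp: space_PM[OF N] act_add)
    with 1 2 have "\<bar>integral\<^sup>L N (\<lambda>x. f (act (h + g) x)) - integral\<^sup>L (P (Q N)) f\<bar> < e"
      by linarith
    with N show "\<bar>integral\<^sup>L N (\<lambda>x. f (act (h + g) x)) - integral\<^sup>L (restrict (P \<circ> Q) (PM X) N) f\<bar> < e"
      by simp
  qed
qed

lemma E_M_id: "restrict (\<lambda>N. N) (PM X) \<in> E_M X act"
  unfolding E_M_iff
proof (intro conjI allI impI)
  fix K :: "('a measure \<times> ('a \<Rightarrow> real)) set" and e :: real
  assume K: "finite K" "\<forall>(N, f)\<in>K. N \<in> PM X \<and> continuous_on X f" "e > 0"
  show "\<exists>g. \<forall>(N, f)\<in>K. \<bar>integral\<^sup>L N (\<lambda>x. f (act g x)) - integral\<^sup>L (restrict (\<lambda>N. N) (PM X) N) f\<bar> < e"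
  proof (rule exI[of _ 0], clarify)
    fix N f assume Nf: "(N, f) \<in> K"
    then have N: "N \<in> PM X" using K by auto
    have "integral\<^sup>L N (\<lambda>x. f (act 0 x)) = integral\<^sup>L N f"
      by (rule Bochner_Integration.integral_cong) (auto simp: space_PM[OF N] act_0)
    then show "\<bar>integral\<^sup>L N (\<lambda>x. f (act 0 x)) - integral\<^sup>L (restrict (\<lambda>N. N) (PM X) N) f\<bar> < e"
      using N K by simp
  qed
qed auto

end

section \<open>Ellis' theorem and the natural map\<close>

context compact_system
begin

definition Top :: "('a \<Rightarrow> 'a) topology" where
  "Top = product_topology (\<lambda>_. top_of_set X) X"

lemma compact_Top: "compact_space Top"
  unfolding Top_def using compact_X by (simp add: compact_space_product_topology compact_space_subtopology)

lemma Hausdorff_Top: "Hausdorff_space Top"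
  unfolding Top_def by (simp add: Hausdorff_space_product_topology Hausdorff_space_subtopology)

lemma topspace_Top: "topspace Top = X \<rightarrow>\<^sub>E X"
  by (simp add: Top_def)

lemma closedin_E_X: "closedin Top (E_X X act)"
  by (simp add: E_X_def enveloping_def Top_def)

text \<open>Evaluating p \<circ> u at x is evaluating p at u x, which is a coordinate projection.
  Hence this side of the multiplication is continuous whatever u is.\<close>

lemma continuous_map_comp_right:
  assumes "u \<in> X \<rightarrow>\<^sub>E X"
  shows "continuous_map Top Top (\<lambda>p. restrict (p \<circ> u) X)"
proof -
  have "continuous_map Top (top_of_set X) (\<lambda>p. p (u x))" if "x \<in> X" for x
    unfolding Top_def using that assms by (intro continuous_map_product_projection) auto
  moreover have "continuous_map Top (top_of_set X) (\<lambda>p. restrict (p \<circ> u) X x) \<longleftrightarrow>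
      continuous_map Top (top_of_set X) (\<lambda>p. p (u x))" if "x \<in> X" for x
    using that by simp
  ultimately show ?thesis
    unfolding Top_def continuous_map_componentwise using assms by (auto simp: Top_def)
qed

text \<open>The Ellis-Numakura lemma. In a minimal closed subsemigroup B containing u, both B u and
  the set of p in B with p u = u are closed subsemigroups. Minimality makes them equal to B, the
  first to show that the second is nonempty, and then u u = u.\<close>

lemma ellis_idempotent:
  assumes A: "closedin Top A" "A \<noteq> {}" and mult: "\<And>p q. p \<in> A \<Longrightarrow> q \<in> A \<Longrightarrow> restrict (p \<circ> q) X \<in> A"
  obtains u where "u \<in> A" "restrict (u \<circ> u) X = u"
proof -
  define SG where "SG B \<longleftrightarrow> closedin Top B \<and> B \<noteq> {} \<and> B \<subseteq> A \<and> (\<forall>p\<in>B. \<forall>q\<in>B. restrict (p \<circ> q) X \<in> B)" for B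
  \<comment> \<open>Minimal subsemigroups are maximal complements, so Zorn's lemma for inclusion
    applies after \<open>uminus\<close>; compactness bounds the chains.\<close>
  have "\<exists>M\<in>uminus ` {B. SG B}. \<forall>B\<in>uminus ` {B. SG B}. M \<subseteq> B \<longrightarrow> B = M"
  proof (rule subset_Zorn_nonempty)
    show "uminus ` {B. SG B} \<noteq> {}" using A mult by (auto simp: SG_def)
    fix \<C> assume ne: "\<C> \<noteq> {}" and ch: "subset.chain (uminus ` {B. SG B}) \<C>"
    define \<D> where "\<D> = uminus ` \<C>"
    have \<D>: "SG B" if "B \<in> \<D>" for B using ch that by (auto simp: \<D>_def subset.chain_def)
    have lin: "B \<subseteq> B' \<or> B' \<subseteq> B" if "B \<in> \<D>" "B' \<in> \<D>" for B B'
      using ch that by (auto simp: \<D>_def subset.chain_def) blast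
    have fin: "\<exists>B\<in>\<D>. B \<subseteq> \<Inter>\<F>" if "finite \<F>" "\<F> \<subseteq> \<D>" for \<F>
      using that
    proof (induction rule: finite_induct)
      case empty
      then show ?case using ne by (auto simp: \<D>_def)
    next
      case (insert B \<F>)
      then obtain B' where "B' \<in> \<D>" "B' \<subseteq> \<Inter>\<F>" by auto
      with lin[of B B'] insert.prems show ?case
        by (metis Inter_insert inf.bounded_iff insert_subset order_refl order_trans)
    qed
    have "SG (\<Inter>\<D>)"
      unfolding SG_def
    proof (intro conjI ballI)
      have ne': "\<D> \<noteq> {}" using ne by (simp add: \<D>_def)
      show "closedin Top (\<Inter>\<D>)" using ne' \<D> by (auto simp: SG_def)
      show "\<Inter>\<D> \<subseteq> A" using ne' \<D> by (auto simp: SG_def)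
      show "\<Inter>\<D> \<noteq> {}"
      proof -
        have "\<Inter>\<F> \<noteq> {}" if "finite \<F>" "\<F> \<subseteq> \<D>" for \<F>
          using fin[OF that] \<D> by (auto simp: SG_def)
        moreover have "\<forall>C\<in>\<D>. closedin Top C" using \<D> by (simp add: SG_def)
        ultimately show ?thesis using compact_Top[unfolded compact_space_fip, THEN spec, of \<D>] by simp
      qed
      show "restrict (p \<circ> q) X \<in> \<Inter>\<D>" if "p \<in> \<Inter>\<D>" "q \<in> \<Inter>\<D>" for p q
        using that \<D> by (auto simp: SG_def)
    qed
    moreover have "\<Union>\<C> = - \<Inter>\<D>" by (auto simp: \<D>_def)
    ultimately show "\<Union>\<C> \<in> uminus ` {B. SG B}" by blast
  qed
  then obtain B where B: "SG B" and min: "\<And>B'. SG B' \<Longrightarrow> B' \<subseteq> B \<Longrightarrow> B' = B"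
    by (auto simp: image_iff)
  have cB: "closedin Top B" using B by (simp add: SG_def)
  then have BX: "B \<subseteq> X \<rightarrow>\<^sub>E X" using closedin_subset topspace_Top by metis
  have multB: "restrict (p \<circ> q) X \<in> B" if "p \<in> B" "q \<in> B" for p q using B that by (simp add: SG_def)
  obtain u where u: "u \<in> B" using B by (auto simp: SG_def)
  have uX: "u \<in> X \<rightarrow>\<^sub>E X" using u BX by blast
  have assoc: "restrict (restrict (p \<circ> q) X \<circ> r) X = restrict (p \<circ> restrict (q \<circ> r) X) X"
    if "r \<in> B" for p q r using that BX by (force simp: fun_eq_iff PiE_iff)
  have "B = (\<lambda>p. restrict (p \<circ> u) X) ` B"
  proof (rule min[symmetric])
    show sub: "(\<lambda>p. restrict (p \<circ> u) X) ` B \<subseteq> B" using multB u by blast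
    have "compactin Top ((\<lambda>p. restrict (p \<circ> u) X) ` B)"
      using image_compactin[OF closedin_compact_space[OF compact_Top cB] continuous_map_comp_right[OF uX]] .
    then have "closedin Top ((\<lambda>p. restrict (p \<circ> u) X) ` B)"
      using compactin_imp_closedin Hausdorff_Top by blast
    moreover have "restrict (a \<circ> b) X \<in> (\<lambda>p. restrict (p \<circ> u) X) ` B"
      if ab: "a \<in> (\<lambda>p. restrict (p \<circ> u) X) ` B" "b \<in> (\<lambda>p. restrict (p \<circ> u) X) ` B" for a b
    proof -
      obtain q where q: "q \<in> B" "b = restrict (q \<circ> u) X" using ab by blast
      have "a \<in> B" using ab sub by blast
      then have "restrict (a \<circ> q) X \<in> B" using q multB by blast
      moreover have "restrict (a \<circ> b) X = restrict (restrict (a \<circ> q) X \<circ> u) X"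
        unfolding q(2) by (rule assoc[OF u, symmetric])
      ultimately show ?thesis by blast
    qed
    ultimately show "SG ((\<lambda>p. restrict (p \<circ> u) X) ` B)" using B sub u by (auto simp: SG_def)
  qed
  with u have "u \<in> (\<lambda>p. restrict (p \<circ> u) X) ` B" by (rule back_subst[where P = "\<lambda>S. u \<in> S"])
  then obtain v where "u = restrict (v \<circ> u) X" and vB: "v \<in> B" by (rule imageE)
  note v = vB this(1)[symmetric]
  define W where "W = {p \<in> B. restrict (p \<circ> u) X = u}"
  have "W = B"
  proof (rule min)
    show "W \<subseteq> B" by (auto simp: W_def)
    have "closedin Top {u}" using Hausdorff_Top uX topspace_Top by (simp add: closedin_Hausdorff_sing_eq)
    then have "closedin Top {p \<in> topspace Top. restrict (p \<circ> u) X \<in> {u}}"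
      by (rule closedin_continuous_map_preimage[OF continuous_map_comp_right[OF uX]])
    moreover have "W = B \<inter> {p \<in> topspace Top. restrict (p \<circ> u) X \<in> {u}}"
      using BX by (auto simp: W_def topspace_Top)
    ultimately have "closedin Top W" using cB by (simp add: closedin_Int)
    moreover have "restrict (p \<circ> q) X \<in> W" if "p \<in> W" "q \<in> W" for p q
    proof -
      have "p \<in> B" "q \<in> B" "restrict (p \<circ> u) X = u" "restrict (q \<circ> u) X = u" using that by (auto simp: W_def)
      then have "restrict (restrict (p \<circ> q) X \<circ> u) X = u" unfolding assoc[OF u] by simp
      then show ?thesis using \<open>p \<in> B\<close> \<open>q \<in> B\<close> multB unfolding W_def by blast
    qed
    ultimately show "SG W" using v B by (auto simp: SG_def W_def)
  qed
  then have "restrict (u \<circ> u) X = u" using u by (auto simp: W_def)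
  with that u B show ?thesis by (auto simp: SG_def)
qed

lemma distal_no_proximal:
  assumes "distal_system X act" "x \<in> X" "y \<in> X" "\<And>e. e > 0 \<Longrightarrow> \<exists>g. dist (act g x) (act g y) < e"
  shows "x = y"
proof (rule ccontr)
  assume "x \<noteq> y"
  then have pos: "(INF g. dist (act g x) (act g y)) > 0" using assms by (auto simp: distal_system_def)
  then obtain g where g: "dist (act g x) (act g y) < (INF g. dist (act g x) (act g y))" using assms(4) by blast
  have "(INF g. dist (act g x) (act g y)) \<le> dist (act g x) (act g y)"
    by (rule cINF_lower) (auto intro!: bdd_belowI[of _ 0])
  with g show False by simp
qed

text \<open>The closed subsemigroup of all q p contains an idempotent u. Since u takes the same
  value at x and at u x, these points are proximal, so u is the identity on X and p has a left
  inverse. If every element has a left inverse, left inverses are two-sided.\<close>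

lemma E_X_inverse:
  assumes d: "distal_system X act" and p: "p \<in> E_X X act"
  obtains q where "q \<in> E_X X act" "\<And>x. x \<in> X \<Longrightarrow> q (p x) = x" "\<And>x. x \<in> X \<Longrightarrow> p (q x) = x"
proof -
  have left: "\<exists>q\<in>E_X X act. \<forall>x\<in>X. q (p x) = x" if p: "p \<in> E_X X act" for p
  proof -
    define A where "A = (\<lambda>q. restrict (q \<circ> p) X) ` E_X X act"
    have pX: "p \<in> X \<rightarrow>\<^sub>E X" using p by (simp add: E_X_iff)
    have "compactin Top A" unfolding A_def
      using image_compactin[OF closedin_compact_space[OF compact_Top closedin_E_X] continuous_map_comp_right[OF pX]] .
    then have cA: "closedin Top A" using compactin_imp_closedin Hausdorff_Top by blast
    have AE: "A \<subseteq> E_X X act" using p E_X_comp by (auto simp: A_def)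
    have "restrict (a \<circ> b) X \<in> A" if a: "a \<in> A" and b: "b \<in> A" for a b
    proof -
      obtain q where q: "q \<in> E_X X act" "b = restrict (q \<circ> p) X" using b by (auto simp: A_def)
      have "restrict (a \<circ> b) X = restrict (restrict (a \<circ> q) X \<circ> p) X"
        using q pX by (auto simp: fun_eq_iff)
      moreover have "restrict (a \<circ> q) X \<in> E_X X act" using a AE q E_X_comp by blast
      ultimately show ?thesis unfolding A_def by blast
    qed
    moreover have "A \<noteq> {}" using p by (auto simp: A_def)
    ultimately obtain u where u: "u \<in> A" "restrict (u \<circ> u) X = u" using ellis_idempotent[OF cA] by metis
    have uE: "u \<in> E_X X act" using u AE by blast
    have "u x = x" if x: "x \<in> X" for x
    proof (rule distal_no_proximal[OF d])
      show "u x \<in> X" "x \<in> X" using uE x E_X_in by auto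
      fix e :: real assume "e > 0"
      then obtain g where g: "\<And>s. s \<in> {x, u x} \<Longrightarrow> dist (act g s) (u s) < e/2"
        using E_X_approx[OF uE, of "{x, u x}" "e/2"] x E_X_in[OF uE x] by auto
      have "u (u x) = u x" using u(2) x by (metis comp_apply restrict_apply')
      then have "dist (act g (u x)) (u x) < e/2" "dist (act g x) (u x) < e/2" using g[of "u x"] g[of x] by auto
      then have "dist (act g (u x)) (act g x) < e" by (rule dist_triangle_half_l)
      then show "\<exists>g. dist (act g (u x)) (act g x) < e" by blast
    qed
    moreover obtain q where "q \<in> E_X X act" "u = restrict (q \<circ> p) X" using u by (auto simp: A_def)
    ultimately show ?thesis by (metis comp_apply restrict_apply')
  qed
  obtain q where q: "q \<in> E_X X act" "\<forall>x\<in>X. q (p x) = x" using left[OF p] by blast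
  obtain r where r: "r \<in> E_X X act" "\<forall>x\<in>X. r (q x) = x" using left[OF q(1)] by blast
  have "p (q x) = x" if "x \<in> X" for x
    using that q r E_X_in[OF p] E_X_in[OF q(1)] by metis
  with q that show ?thesis by blast
qed

section \<open>Dirac measures and the natural map as a homomorphism\<close>

lemma E_M_dirac:
  assumes P: "P \<in> E_M X act" and x: "x \<in> X"
  obtains y where "y \<in> X" "P (dirac X x) = dirac X y"
proof -
  define N where "N = P (dirac X x)"
  have N: "N \<in> PM X" using E_M_PM[OF P] dirac_PM x by (auto simp: N_def)
  interpret prob_space N using N by (simp add: PM_def)
  have cd: "continuous_on X (\<lambda>z. dist z y)" for y :: 'a by (intro continuous_intros)
  have int: "integrable N (\<lambda>z. dist z y)" for y by (rule integrable_PM[OF compact_X N cd])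
  \<comment> \<open>The mean distance to y vanishes only if N is concentrated at y; the required
    point is found as a minimiser of this continuous function.\<close>
  define \<phi> where "\<phi> y = integral\<^sup>L N (\<lambda>z. dist z y)" for y
  have lip: "\<phi> y \<le> \<phi> y' + dist y y'" for y y'
  proof -
    have "\<phi> y \<le> integral\<^sup>L N (\<lambda>z. dist z y' + dist y y')" unfolding \<phi>_def
      using int by (intro integral_mono) (auto intro: dist_triangle2)
    then show ?thesis using int by (simp add: \<phi>_def prob_space)
  qed
  have "continuous_on X \<phi>"
    unfolding continuous_on_iff
  proof (intro ballI allI impI)
    fix y and e :: real assume "e > 0"
    have "dist (\<phi> y') (\<phi> y) \<le> dist y' y" for y'
      using lip[of y y'] lip[of y' y] by (auto simp: dist_real_def dist_commute abs_le_iff)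
    with \<open>e > 0\<close> show "\<exists>d>0. \<forall>y'\<in>X. dist y' y < d \<longrightarrow> dist (\<phi> y') (\<phi> y) < e"
      by (intro exI[of _ e]) (auto intro: le_less_trans)
  qed
  then obtain y where y: "y \<in> X" "\<And>z. z \<in> X \<Longrightarrow> \<phi> y \<le> \<phi> z"
    using continuous_attains_inf[OF compact_X] x by blast
  have "\<phi> y \<le> 0"
  proof (rule field_le_epsilon)
    fix e :: real assume "e > 0"
    \<comment> \<open>The tests must be fixed before g is known, so a whole finite net is tested and
      the centre near \<open>act g x\<close> is selected afterwards.\<close>
    obtain Z where Z: "finite Z" "Z \<subseteq> X" "X \<subseteq> (\<Union>z\<in>Z. ball z (e/2))"
      using compactE_image[OF compact_X, of X "\<lambda>z. ball z (e/2)"] \<open>e > 0\<close> by force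
    obtain g where g: "\<And>M f. (M, f) \<in> (\<lambda>z. (dirac X x, \<lambda>w. dist w z)) ` Z \<Longrightarrow>
        \<bar>integral\<^sup>L M (\<lambda>x. f (act g x)) - integral\<^sup>L (P M) f\<bar> < e/2"
      by (rule E_M_approx[OF P, of "(\<lambda>z. (dirac X x, \<lambda>w. dist w z)) ` Z" "e/2"])
         (use Z \<open>e > 0\<close> dirac_PM x cd in auto)
    obtain z where z: "z \<in> Z" "dist z (act g x) < e/2" using Z(3) act_in[OF x, of g] by auto
    have "\<bar>integral\<^sup>L (dirac X x) (\<lambda>w. dist (act g w) z) - \<phi> z\<bar> < e/2"
      using g[of "dirac X x" "\<lambda>w. dist w z"] z by (auto simp: \<phi>_def N_def)
    moreover have "integral\<^sup>L (dirac X x) (\<lambda>w. dist (act g w) z) = dist (act g x) z"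
      by (rule dirac_PM(2)[OF x]) (rule continuous_comp_act[OF cd])
    ultimately have "\<phi> z < e" using z(2) dist_commute[of z "act g x"] by linarith
    then show "\<phi> y \<le> 0 + e" using y(2)[of z] z(1) Z(2) by auto
  qed
  moreover have "\<phi> y \<ge> 0" unfolding \<phi>_def by (rule Bochner_Integration.integral_nonneg) auto
  ultimately have "integral\<^sup>L N (\<lambda>z. dist z y) = 0" unfolding \<phi>_def by linarith
  then have ae: "AE z in N. dist z y = 0"
    using integral_nonneg_eq_0_iff_AE[OF int, of y] by auto
  have "N = dirac X y"
  proof (rule PM_eqI[OF compact_X N dirac_PM(1)[OF y(1)]])
    fix f :: "'a \<Rightarrow> real" assume f: "continuous_on X f"
    have "integral\<^sup>L N f = integral\<^sup>L N (\<lambda>_. f y)"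
      using ae f N by (intro integral_cong_AE) (auto simp: measurable_PM)
    then show "integral\<^sup>L N f = integral\<^sup>L (dirac X y) f"
      using dirac_PM(2)[OF y(1) f] by (simp add: prob_space)
  qed
  with y(1) that show ?thesis by (simp add: N_def)
qed

lemma natural_map:
  assumes P: "P \<in> E_M X act" and x: "x \<in> X"
  shows "natural_map X P x \<in> X" "P (dirac X x) = dirac X (natural_map X P x)"
proof -
  have "\<exists>!y. y \<in> X \<and> P (dirac X x) = dirac X y"
    using E_M_dirac[OF P x] dirac_inject by metis
  from theI'[OF this] x show "natural_map X P x \<in> X" "P (dirac X x) = dirac X (natural_map X P x)"
    by (auto simp: natural_map_def)
qed

lemma natural_map_eqI:
  assumes "P \<in> E_M X act" "x \<in> X" "y \<in> X" "P (dirac X x) = dirac X y"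
  shows "natural_map X P x = y"
  using natural_map[OF assms(1,2)] assms(3,4) dirac_inject by metis

lemma natural_map_E_X:
  assumes P: "P \<in> E_M X act"
  shows "natural_map X P \<in> E_X X act"
  unfolding E_X_iff
proof (intro conjI allI impI)
  show "natural_map X P \<in> X \<rightarrow>\<^sub>E X" using natural_map(1)[OF P] by (auto simp: natural_map_def)
  fix S and e :: real assume S: "finite S" "S \<subseteq> X" "e > 0"
  let ?p = "natural_map X P"
  have cd: "continuous_on X (\<lambda>z. dist z y)" for y :: 'a by (intro continuous_intros)
  obtain g where g: "\<And>M f. (M, f) \<in> (\<lambda>s. (dirac X s, \<lambda>w. dist w (?p s))) ` S \<Longrightarrow>
      \<bar>integral\<^sup>L M (\<lambda>x. f (act g x)) - integral\<^sup>L (P M) f\<bar> < e"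
    by (rule E_M_approx[OF P, of "(\<lambda>s. (dirac X s, \<lambda>w. dist w (?p s))) ` S" e])
       (use S dirac_PM cd in auto)
  have "dist (act g s) (?p s) < e" if s: "s \<in> S" for s
  proof -
    have sX: "s \<in> X" using s S by auto
    have "\<bar>integral\<^sup>L (dirac X s) (\<lambda>w. dist (act g w) (?p s)) - integral\<^sup>L (P (dirac X s)) (\<lambda>w. dist w (?p s))\<bar> < e"
      using g[of "dirac X s" "\<lambda>w. dist w (?p s)"] s by auto
    moreover have "integral\<^sup>L (dirac X s) (\<lambda>w. dist (act g w) (?p s)) = dist (act g s) (?p s)"
      by (rule dirac_PM(2)[OF sX]) (rule continuous_comp_act[OF cd])
    moreover have "integral\<^sup>L (P (dirac X s)) (\<lambda>w. dist w (?p s)) = 0"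
      using natural_map[OF P sX] dirac_PM(2)[OF natural_map(1)[OF P sX] cd] by simp
    ultimately show ?thesis by simp
  qed
  then show "\<exists>g. \<forall>s\<in>S. dist (act g s) (?p s) < e" by blast
qed

lemma natural_map_comp:
  assumes P: "P \<in> E_M X act" and Q: "Q \<in> E_M X act"
  shows "natural_map X (restrict (P \<circ> Q) (PM X)) = restrict (natural_map X P \<circ> natural_map X Q) X"
proof
  fix x show "natural_map X (restrict (P \<circ> Q) (PM X)) x = restrict (natural_map X P \<circ> natural_map X Q) X x"
  proof (cases "x \<in> X")
    case True
    have "natural_map X (restrict (P \<circ> Q) (PM X)) x = natural_map X P (natural_map X Q x)"
      using True natural_map[OF Q True] natural_map[OF P natural_map(1)[OF Q True]]
      by (intro natural_map_eqI E_M_comp P Q) (auto simp: dirac_PM)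
    then show ?thesis using True by simp
  qed (simp add: natural_map_def)
qed

lemma natural_map_id: "natural_map X (restrict (\<lambda>N. N) (PM X)) = restrict (\<lambda>x. x) X"
proof
  fix x show "natural_map X (restrict (\<lambda>N. N) (PM X)) x = restrict (\<lambda>x. x) X x"
  proof (cases "x \<in> X")
    case True
    then have "natural_map X (restrict (\<lambda>N. N) (PM X)) x = x"
      by (intro natural_map_eqI E_M_id) (auto simp: dirac_PM)
    then show ?thesis using True by simp
  qed (simp add: natural_map_def)
qed

text \<open>The natural map respects composition and the identity. Surjectivity supplies a Q above
  the inverse of \<open>natural_map X P\<close>; injectivity says that only the identity lies above
  the identity, so P and Q are inverse to each other.\<close>

lemma E_M_inverse:
  assumes d: "distal_system X act" and i: "injective_system X act" and P: "P \<in> E_M X act"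
  obtains Q where "Q \<in> E_M X act" "\<And>N. N \<in> PM X \<Longrightarrow> Q (P N) = N" "\<And>N. N \<in> PM X \<Longrightarrow> P (Q N) = N"
proof -
  have bij: "bij_betw (natural_map X) (E_M X act) (E_X X act)" using i by (simp add: injective_system_def)
  obtain q where q: "q \<in> E_X X act" "\<And>x. x \<in> X \<Longrightarrow> q (natural_map X P x) = x"
      "\<And>x. x \<in> X \<Longrightarrow> natural_map X P (q x) = x"
    using E_X_inverse[OF d natural_map_E_X[OF P]] by blast
  obtain Q where Q: "Q \<in> E_M X act" "natural_map X Q = q"
    using bij q(1) by (metis bij_betw_def imageE)
  have id: "R = restrict (\<lambda>N. N) (PM X)" if "R \<in> E_M X act" "natural_map X R = restrict (\<lambda>x. x) X" for R
    using bij that E_M_id natural_map_id unfolding bij_betw_def inj_on_def by metis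
  have "restrict (Q \<circ> P) (PM X) = restrict (\<lambda>N. N) (PM X)"
    using q Q by (intro id E_M_comp P) (auto simp: natural_map_comp P)
  moreover have "restrict (P \<circ> Q) (PM X) = restrict (\<lambda>N. N) (PM X)"
    using q Q by (intro id E_M_comp P) (auto simp: natural_map_comp P)
  ultimately have "Q (P N) = N" "P (Q N) = N" if "N \<in> PM X" for N
    using that by (metis comp_apply restrict_apply')+
  with that Q show ?thesis by blast
qed

end

section \<open>Total boundedness\<close>

text \<open>All integrals together form a point in a product of bounded intervals. A cluster point
  inherits linearity and positivity, since each instance involves finitely many coordinates, and
  Riesz turns it into measures. The family over J is treated at once so that one n serves several
  measures.\<close>

lemma cluster_measures:
  fixes X :: "'a::metric_space set" and Ns :: "nat \<Rightarrow> 'i \<Rightarrow> 'a measure"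
  assumes X: "compact X" and Ns: "\<And>n i. i \<in> J \<Longrightarrow> Ns n i \<in> PM X"
  obtains P where "\<And>i. i \<in> J \<Longrightarrow> P i \<in> PM X"
    "\<And>K e n0. finite K \<Longrightarrow> (\<And>i f. (i, f) \<in> K \<Longrightarrow> i \<in> J \<and> continuous_on X f) \<Longrightarrow> e > 0 \<Longrightarrow>
      \<exists>n\<ge>n0. \<forall>(i, f)\<in>K. \<bar>integral\<^sup>L (Ns n i) f - integral\<^sup>L (P i) f\<bar> < (e::real)"
proof -
  define I where "I = J \<times> {f :: 'a \<Rightarrow> real. continuous_on X f}"
  define a where "a n = (\<lambda>(i, f :: 'a \<Rightarrow> real). integral\<^sup>L (Ns n i) f)" for n
  have "\<exists>B>0. \<forall>x\<in>X. \<bar>f x\<bar> \<le> B" if "continuous_on X f" for f :: "'a \<Rightarrow> real"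
    using bounded_on_compact[OF X that] by metis
  then obtain B where B: "\<And>f :: 'a \<Rightarrow> real. continuous_on X f \<Longrightarrow> B f > 0 \<and> (\<forall>x\<in>X. \<bar>f x\<bar> \<le> B f)" by metis
  have aI: "a n i \<in> {- B (snd i)..B (snd i)}" if i: "i \<in> I" for n i
  proof -
    obtain j f where jf: "i = (j, f)" "j \<in> J" "continuous_on X f" using i by (auto simp: I_def)
    interpret prob_space "Ns n j" using Ns jf by (simp add: PM_def)
    have int: "integrable (Ns n j) f" using integrable_PM X Ns jf by blast
    have "\<bar>integral\<^sup>L (Ns n j) f\<bar> \<le> integral\<^sup>L (Ns n j) (\<lambda>x. \<bar>f x\<bar>)" by (rule integral_abs_bound)
    also have "\<dots> \<le> integral\<^sup>L (Ns n j) (\<lambda>x. B f)"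
      using int B[OF jf(3)] space_PM[OF Ns[OF jf(2)]] by (intro integral_mono) auto
    finally show ?thesis by (simp add: jf a_def prob_space abs_le_iff)
  qed
  obtain b where b: "\<And>K e n0. finite K \<Longrightarrow> K \<subseteq> I \<Longrightarrow> e > 0 \<Longrightarrow> \<exists>n\<ge>n0. \<forall>i\<in>K. dist (a n i) (b i) < e"
    using cluster_point[of I "\<lambda>i. {- B (snd i)..B (snd i)}" a] aI by (metis compact_Icc)
  have L: "positive_functional X (\<lambda>f. b (i, f))" if i: "i \<in> J" for i
  proof
    show "compact X" by fact
    have int: "integrable (Ns n i) f" if "continuous_on X f" for n and f :: "'a \<Rightarrow> real"
      using integrable_PM X Ns i that by blast
    have ap: "\<exists>n. \<forall>f\<in>F. \<bar>integral\<^sup>L (Ns n i) f - b (i, f)\<bar> < e"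
      if "finite F" "\<forall>f\<in>F. continuous_on X f" "e > 0" for F and e :: real
      using b[of "Pair i ` F" e 0] that i by (auto simp: I_def a_def dist_real_def)
    fix f g :: "'a \<Rightarrow> real" and c :: real
    assume f: "continuous_on X f"
    show "b (i, \<lambda>x. c * f x) = c * b (i, f)"
    proof -
      have "\<bar>b (i, \<lambda>x. c * f x) - c * b (i, f)\<bar> \<le> 0 + e" if "e > 0" for e
      proof -
        have "continuous_on X (\<lambda>x. c * f x)" "e / (1 + \<bar>c\<bar>) > 0"
          using f that by (auto intro!: continuous_intros divide_pos_pos)
        then obtain n where n: "\<forall>h\<in>{f, \<lambda>x. c * f x}. \<bar>integral\<^sup>L (Ns n i) h - b (i, h)\<bar> < e / (1 + \<bar>c\<bar>)"
          using ap[of "{f, \<lambda>x. c * f x}" "e / (1 + \<bar>c\<bar>)"] f by blast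
        have "\<bar>c * integral\<^sup>L (Ns n i) f - c * b (i, f)\<bar> \<le> \<bar>c\<bar> * (e / (1 + \<bar>c\<bar>))"
          unfolding right_diff_distrib[symmetric] abs_mult using n by (intro mult_left_mono) auto
        moreover have "\<bar>c * integral\<^sup>L (Ns n i) f - b (i, \<lambda>x. c * f x)\<bar> < e / (1 + \<bar>c\<bar>)"
          using n by simp
        moreover have "(1 + \<bar>c\<bar>) * (e / (1 + \<bar>c\<bar>)) = e" by simp
        then have "e / (1 + \<bar>c\<bar>) + \<bar>c\<bar> * (e / (1 + \<bar>c\<bar>)) = e" by (simp only: distrib_right mult_1_left)
        ultimately show ?thesis by linarith
      qed
      then have "\<bar>b (i, \<lambda>x. c * f x) - c * b (i, f)\<bar> \<le> 0" by (rule field_le_epsilon)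
      then show ?thesis by simp
    qed
    show "b (i, \<lambda>x. f x + g x) = b (i, f) + b (i, g)" if g: "continuous_on X g"
    proof -
      have "\<bar>b (i, \<lambda>x. f x + g x) - (b (i, f) + b (i, g))\<bar> \<le> 0 + e" if e0: "e > 0" for e
      proof -
        obtain n where n: "\<forall>h\<in>{f, g, \<lambda>x. f x + g x}. \<bar>integral\<^sup>L (Ns n i) h - b (i, h)\<bar> < e / 3"
          using ap[of "{f, g, \<lambda>x. f x + g x}" "e / 3"] f g e0 continuous_on_add[OF f g] by auto
        have "integral\<^sup>L (Ns n i) (\<lambda>x. f x + g x) = integral\<^sup>L (Ns n i) f + integral\<^sup>L (Ns n i) g"
          using int f g by simp
        moreover have "\<bar>integral\<^sup>L (Ns n i) f - b (i, f)\<bar> < e / 3" "\<bar>integral\<^sup>L (Ns n i) g - b (i, g)\<bar> < e / 3"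
          "\<bar>integral\<^sup>L (Ns n i) (\<lambda>x. f x + g x) - b (i, \<lambda>x. f x + g x)\<bar> < e / 3" using n by auto
        ultimately show ?thesis by linarith
      qed
      then have "\<bar>b (i, \<lambda>x. f x + g x) - (b (i, f) + b (i, g))\<bar> \<le> 0" by (rule field_le_epsilon)
      then show ?thesis by simp
    qed
    show "0 \<le> b (i, f)" if pos: "\<And>x. x \<in> X \<Longrightarrow> 0 \<le> f x"
    proof (rule field_le_epsilon)
      fix e :: real assume "e > 0"
      then obtain n where n: "\<bar>integral\<^sup>L (Ns n i) f - b (i, f)\<bar> < e" using ap[of "{f}" e] f by auto
      have "0 \<le> integral\<^sup>L (Ns n i) f"
        using pos space_PM[OF Ns[OF i]] by (intro Bochner_Integration.integral_nonneg_AE AE_I2) auto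
      with n show "0 \<le> b (i, f) + e" by linarith
    qed
  next
    have "\<bar>1 - b (i, \<lambda>_. 1)\<bar> \<le> 0 + e" if e0: "e > 0" for e
    proof -
      obtain n where n: "\<bar>integral\<^sup>L (Ns n i) (\<lambda>_. 1) - b (i, \<lambda>_. 1)\<bar> < e"
        using b[of "{(i, \<lambda>_. 1)}" e 0] e0 i by (auto simp: I_def a_def dist_real_def)
      then show ?thesis using prob_space.prob_space[OF prob_space_PM[OF Ns[OF i, of n]]] by simp
    qed
    then have "\<bar>1 - b (i, \<lambda>_. 1)\<bar> \<le> 0" by (rule field_le_epsilon)
    then show "b (i, \<lambda>_. 1) = 1" by simp
  qed
  define P where "P i = positive_functional.rep X (\<lambda>f. b (i, f))" for i
  show ?thesis
  proof (rule that)
    show "P i \<in> PM X" if "i \<in> J" for i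
      unfolding P_def by (rule positive_functional.rep_PM[OF L[OF that]])
    fix K and e :: real and n0
    assume K: "finite K" "\<And>i f. (i, f) \<in> K \<Longrightarrow> i \<in> J \<and> continuous_on X (f :: 'a \<Rightarrow> real)" "e > 0"
    then have "K \<subseteq> I" by (auto simp: I_def)
    then obtain n where n: "n \<ge> n0" "\<forall>i\<in>K. dist (a n i) (b i) < e" using b K by blast
    have "\<bar>integral\<^sup>L (Ns n i) f - integral\<^sup>L (P i) f\<bar> < e" if if': "(i, f) \<in> K" for i f
    proof -
      have "i \<in> J" "continuous_on X f" using K if' by auto
      then have "b (i, f) = integral\<^sup>L (P i) f"
        unfolding P_def by (intro positive_functional.functional_eq_integral L)
      with n(2) if' show ?thesis by (auto simp: a_def dist_real_def)
    qed
    with n(1) show "\<exists>n\<ge>n0. \<forall>(i, f)\<in>K. \<bar>integral\<^sup>L (Ns n i) f - integral\<^sup>L (P i) f\<bar> < e" by blast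
  qed
qed

lemma density_PM:
  fixes f :: "'a::metric_space \<Rightarrow> real"
  assumes X: "compact X" and N: "N \<in> PM X" and f: "continuous_on X f" "\<And>x. x \<in> X \<Longrightarrow> 0 \<le> f x" "integral\<^sup>L N f = 1"
  shows "density N (\<lambda>x. ennreal (f x)) \<in> PM X"
    and "continuous_on X k \<Longrightarrow> integral\<^sup>L (density N (\<lambda>x. ennreal (f x))) k = integral\<^sup>L N (\<lambda>x. f x * k x :: real)"
proof -
  have m: "f \<in> borel_measurable N" using measurable_PM N f by blast
  have ae: "AE x in N. 0 \<le> f x" using f(2) space_PM[OF N] by (intro AE_I2) auto
  have "emeasure (density N (\<lambda>x. ennreal (f x))) (space N) = (\<integral>\<^sup>+x. ennreal (f x) \<partial>N)"
    using m by (subst emeasure_density) (auto intro!: nn_integral_cong)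
  also have "\<dots> = 1"
    using nn_integral_eq_integral[OF integrable_PM[OF X N f(1)] ae] f(3) by simp
  finally have "prob_space (density N (\<lambda>x. ennreal (f x)))" by (intro prob_spaceI) simp
  then show "density N (\<lambda>x. ennreal (f x)) \<in> PM X" using N by (simp add: PM_def)
  show "integral\<^sup>L (density N (\<lambda>x. ennreal (f x))) k = integral\<^sup>L N (\<lambda>x. f x * k x)" if "continuous_on X k"
    using integral_density[OF measurable_PM[OF N that] m ae] by simp
qed

context compact_system
begin

definition tests :: "('a measure \<times> ('a \<Rightarrow> real)) set set" where
  "tests = {K. finite K \<and> K \<subseteq> PM X \<times> {f. continuous_on X f}}"

definition near :: "('a measure \<Rightarrow> 'a measure) \<Rightarrow> ('a measure \<times> ('a \<Rightarrow> real)) set \<Rightarrow> real \<Rightarrow> 'g \<Rightarrow> bool" where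
  "near P K e g \<longleftrightarrow> (\<forall>(N, f)\<in>K. \<bar>integral\<^sup>L N (\<lambda>x. f (act g x)) - integral\<^sup>L (P N) f\<bar> < e)"

text \<open>Compactness of E(M(X)), in the form used for sequences: the indexing family consists of
  all of \<open>PM X\<close>, so the cluster point is a map on measures.\<close>

lemma E_M_cluster:
  fixes g :: "nat \<Rightarrow> 'g"
  obtains P where "P \<in> E_M X act"
    "\<And>K e n0. K \<in> tests \<Longrightarrow> e > 0 \<Longrightarrow> \<exists>n\<ge>n0. near P K e (g n)"
proof -
  show ?thesis
  proof (rule cluster_measures[OF compact_X, of "PM X" "\<lambda>n. induced X act (g n)"])
    show "induced X act (g n) N \<in> PM X" if "N \<in> PM X" for n N using induced_PM that .
    fix P0 assume P0: "\<And>N. N \<in> PM X \<Longrightarrow> P0 N \<in> PM X"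
      "\<And>K e n0. finite K \<Longrightarrow> (\<And>N f. (N, f) \<in> K \<Longrightarrow> N \<in> PM X \<and> continuous_on X f) \<Longrightarrow> e > 0 \<Longrightarrow>
        \<exists>n\<ge>n0. \<forall>(N, f)\<in>K. \<bar>integral\<^sup>L (induced X act (g n) N) f - integral\<^sup>L (P0 N) f\<bar> < (e::real)"
    define P where "P = restrict P0 (PM X)"
    have cl: "\<exists>n\<ge>n0. \<forall>(N, f)\<in>K. \<bar>integral\<^sup>L N (\<lambda>x. f (act (g n) x)) - integral\<^sup>L (P N) f\<bar> < e"
      if K: "finite K" "\<And>N f. (N, f) \<in> K \<Longrightarrow> N \<in> PM X \<and> continuous_on X f" "e > 0"
      for K and e :: real and n0
    proof -
      obtain n where n: "n \<ge> n0" "\<forall>(N, f)\<in>K. \<bar>integral\<^sup>L (induced X act (g n) N) f - integral\<^sup>L (P0 N) f\<bar> < e"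
        using P0(2)[OF K] by blast
      have "\<bar>integral\<^sup>L N (\<lambda>x. f (act (g n) x)) - integral\<^sup>L (P N) f\<bar> < e" if "(N, f) \<in> K" for N f
        using bspec[OF n(2) that] K(2)[OF that] integral_induced[of N f "g n"] by (simp add: P_def)
      with n(1) show ?thesis by blast
    qed
    have "P \<in> E_M X act" unfolding E_M_iff
    proof (intro conjI allI impI)
      show "P \<in> PM X \<rightarrow>\<^sub>E PM X" using P0(1) by (auto simp: P_def)
      fix K :: "('a measure \<times> ('a \<Rightarrow> real)) set" and e :: real
      assume K: "finite K" "\<forall>(N, f)\<in>K. N \<in> PM X \<and> continuous_on X f" "e > 0"
      have "N \<in> PM X \<and> continuous_on X f" if "(N, f) \<in> K" for N f using K(2) that by auto
      from cl[OF K(1) this K(3), of 0]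
      show "\<exists>g. \<forall>(N, f)\<in>K. \<bar>integral\<^sup>L N (\<lambda>x. f (act g x)) - integral\<^sup>L (P N) f\<bar> < e" by blast
    qed
    then show ?thesis
      by (rule that, unfold near_def, intro cl) (auto simp: tests_def)
  qed
qed

text \<open>
  The function \<open>\<Phi>\<close> below is \<open>k \<mapsto> 2 \<langle>k, G\<rangle> - \<parallel>k\<parallel>\<^sup>2\<close> in \<open>L\<^sup>2(N)\<close>, where \<open>G\<close> is the density of
  \<open>Q(f \<cdot> P N)\<close> with respect to \<open>N\<close>; a near-maximiser \<open>k\<close> approximates \<open>G\<close>, which is the \<open>L\<^sup>2\<close> limit
  of \<open>f \<circ> g\<close>. Working with near-maximisers avoids the Radon--Nikodym theorem and density of continuous functions.
\<close>
lemma L2_approx: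
  fixes f :: "'a \<Rightarrow> real"
  assumes P: "P \<in> E_M X act" and Q: "Q \<in> E_M X act"
    and QP: "\<And>N. N \<in> PM X \<Longrightarrow> Q (P N) = N" and PQ: "\<And>N. N \<in> PM X \<Longrightarrow> P (Q N) = N"
    and N: "N \<in> PM X" and f: "continuous_on X f" "\<And>x. x \<in> X \<Longrightarrow> 1 \<le> f x" and \<eta>: "\<eta> > 0"
  obtains k K d where "continuous_on X k" "K \<in> tests" "d > 0"
    "\<And>g. near P K d g \<Longrightarrow> integral\<^sup>L N (\<lambda>x. (f (act g x) - k x)\<^sup>2) \<le> 10 * \<eta>"
proof -
  define V where "V = P N"
  have V: "V \<in> PM X" using E_M_PM P N by (simp add: V_def)
  note iN = integrable_PM[OF compact_X N] and iV = integrable_PM[OF compact_X V]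
  define c where "c = integral\<^sup>L V f"
  have c: "c \<ge> 1"
  proof -
    interpret prob_space V using V by (simp add: PM_def)
    have "integral\<^sup>L V (\<lambda>_. 1) \<le> c" unfolding c_def
      using f iV space_PM[OF V] by (intro integral_mono) auto
    then show ?thesis by (simp add: prob_space)
  qed
  have cfc: "continuous_on X (\<lambda>x. f x / c)" using f c by (intro continuous_intros) auto
  \<comment> \<open>T is f V normalised to mass 1; f \<ge> 1 gives c \<ge> 1. With S = Q T, the
    measure c S is f V carried back by Q, and P S = T.\<close>
  define T where "T = density V (\<lambda>x. ennreal (f x / c))"
  have "0 \<le> f x / c" if "x \<in> X" for x using f(2)[OF that] c by simp
  moreover have "integral\<^sup>L V (\<lambda>x. f x / c) = 1" using c by (simp add: c_def[symmetric])
  ultimately have T: "T \<in> PM X"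
    and iT: "\<And>k. continuous_on X k \<Longrightarrow> integral\<^sup>L T k = integral\<^sup>L V (\<lambda>x. f x / c * k x)"
    unfolding T_def using density_PM[OF compact_X V cfc] by blast+
  have iT': "c * integral\<^sup>L T k = integral\<^sup>L V (\<lambda>x. f x * k x)" if "continuous_on X k" for k
    using iT[OF that] c by simp
  define S where "S = Q T"
  have S: "S \<in> PM X" using E_M_PM Q T by (simp add: S_def)
  note iS = integrable_PM[OF compact_X S]
  define A where "A = integral\<^sup>L V (\<lambda>x. (f x)\<^sup>2)"
  define \<Phi> where "\<Phi> k = 2 * c * integral\<^sup>L S k - integral\<^sup>L N (\<lambda>x. (k x)\<^sup>2)" for k
  \<comment> \<open>In effect the squared norm of G is at most A. If h approximates Q, the linear
    term is close to 2 \<integral> f (k \<circ> h) dV, hence almost at most A + \<integral> (k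
    \<circ> h)^2 dV, and the last integral is close to \<integral> k^2 dN because Q V = N.\<close>
  have \<Phi>A: "\<Phi> k \<le> A" if k: "continuous_on X k" for k
  proof (rule field_le_epsilon)
    fix e :: real assume "e > 0"
    define d where "d = e / (2 * c + 1)"
    have "(2 * c + 1) * d = e" using c by (simp add: d_def)
    then have "2 * c * d + d = e" by (simp add: distrib_right)
    moreover have "d > 0" using \<open>e > 0\<close> c by (simp add: d_def)
    ultimately have d: "d > 0" "2 * c * d + d = e" by auto
    have ck2: "continuous_on X (\<lambda>x. (k x)\<^sup>2)" by (intro continuous_intros k)
    obtain h where h: "\<And>M f. (M, f) \<in> {(T, k), (V, \<lambda>x. (k x)\<^sup>2)} \<Longrightarrow>
        \<bar>integral\<^sup>L M (\<lambda>x. f (act h x)) - integral\<^sup>L (Q M) f\<bar> < d"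
      by (rule E_M_approx[OF Q, of "{(T, k), (V, \<lambda>x. (k x)\<^sup>2)}" d]) (use T V k ck2 d in auto)
    have ckh: "continuous_on X (\<lambda>x. k (act h x))" by (rule continuous_comp_act[OF k])
    have "integral\<^sup>L S k \<le> integral\<^sup>L T (\<lambda>x. k (act h x)) + d"
      using h[of T k] by (auto simp: S_def)
    then have "2 * c * integral\<^sup>L S k \<le> 2 * c * (integral\<^sup>L T (\<lambda>x. k (act h x)) + d)"
      using c by (intro mult_left_mono) auto
    then have 1: "2 * c * integral\<^sup>L S k \<le> 2 * integral\<^sup>L V (\<lambda>x. f x * k (act h x)) + 2 * c * d"
      using iT'[OF ckh] by (simp add: algebra_simps)
    have "\<bar>integral\<^sup>L V (\<lambda>x. (k (act h x))\<^sup>2) - integral\<^sup>L N (\<lambda>x. (k x)\<^sup>2)\<bar> < d"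
      using h[of V "\<lambda>x. (k x)\<^sup>2"] QP[OF N] by (simp add: V_def)
    then have 2: "integral\<^sup>L N (\<lambda>x. (k x)\<^sup>2) \<ge> integral\<^sup>L V (\<lambda>x. (k (act h x))\<^sup>2) - d" by linarith
    have "integral\<^sup>L V (\<lambda>x. 2 * (f x * k (act h x))) \<le> integral\<^sup>L V (\<lambda>x. (f x)\<^sup>2 + (k (act h x))\<^sup>2)"
    proof (rule integral_mono)
      show "2 * (f x * k (act h x)) \<le> (f x)\<^sup>2 + (k (act h x))\<^sup>2" for x
        using sum_squares_bound[of "f x" "k (act h x)"] by (simp add: mult.assoc)
    qed (auto intro!: iV continuous_intros f ckh)
    also have "\<dots> = A + integral\<^sup>L V (\<lambda>x. (k (act h x))\<^sup>2)" unfolding A_def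
      by (intro Bochner_Integration.integral_add iV continuous_intros f ckh)
    finally have "2 * integral\<^sup>L V (\<lambda>x. f x * k (act h x)) \<le> A + integral\<^sup>L V (\<lambda>x. (k (act h x))\<^sup>2)" by simp
    with 1 2 d show "\<Phi> k \<le> A + e" unfolding \<Phi>_def by linarith
  qed
  define B where "B = Sup (\<Phi> ` {k. continuous_on X k})"
  have bdd: "bdd_above (\<Phi> ` {k. continuous_on X k})" using \<Phi>A by (auto intro!: bdd_aboveI[of _ A])
  have ne: "\<Phi> ` {k. continuous_on X k} \<noteq> {}" using f(1) by blast
  have \<Phi>B: "\<Phi> k \<le> B" if "continuous_on X k" for k
    unfolding B_def using that bdd by (intro cSup_upper) auto
  obtain k where k: "continuous_on X k" "B - \<eta> < \<Phi> k"
  proof -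
    have "\<exists>y\<in>\<Phi> ` {k. continuous_on X k}. B - \<eta> < y"
      using less_cSup_iff[OF ne bdd, of "B - \<eta>"] \<eta> unfolding B_def by simp
    then show ?thesis using that by blast
  qed
  \<comment> \<open>\<open>\<delta> l\<close> is \<langle>G - k, l\<rangle>, half the first
    variation of \<Phi> at k. Near-maximality bounds it up to a quadratic error; testing with l/2
    makes the coefficient small enough to be absorbed at the end.\<close>
  define \<delta> where "\<delta> l = c * integral\<^sup>L S l - integral\<^sup>L N (\<lambda>x. k x * l x)" for l
  have \<delta>: "2 * \<delta> l \<le> 2 * \<eta> + integral\<^sup>L N (\<lambda>x. (l x)\<^sup>2) / 2" if l: "continuous_on X l" for l
  proof -
    have "\<Phi> (\<lambda>x. k x + l x / 2) \<le> B" by (intro \<Phi>B continuous_intros k l) simp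
    moreover have "integral\<^sup>L S (\<lambda>x. k x + l x / 2) = integral\<^sup>L S k + integral\<^sup>L S l / 2"
      using iS[OF k(1)] iS[OF l] by simp
    moreover have "integral\<^sup>L N (\<lambda>x. (k x + l x / 2)\<^sup>2) =
        integral\<^sup>L N (\<lambda>x. (k x)\<^sup>2) + integral\<^sup>L N (\<lambda>x. k x * l x) + integral\<^sup>L N (\<lambda>x. (l x)\<^sup>2) / 4"
    proof -
      have "(\<lambda>x. (k x + l x / 2)\<^sup>2) = (\<lambda>x. (k x)\<^sup>2 + k x * l x + (l x)\<^sup>2 / 4)"
        by (auto simp: fun_eq_iff power2_eq_square field_simps)
      moreover have "integrable N (\<lambda>x. (k x)\<^sup>2)" "integrable N (\<lambda>x. k x * l x)" "integrable N (\<lambda>x. (l x)\<^sup>2)"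
        by (intro iN continuous_intros k l)+
      ultimately show ?thesis by simp
    qed
    ultimately have "\<Phi> k + \<delta> l - integral\<^sup>L N (\<lambda>x. (l x)\<^sup>2) / 4 \<le> B"
      unfolding \<Phi>_def \<delta>_def by (simp add: algebra_simps)
    with k(2) show ?thesis by linarith
  qed
  define d where "d = \<eta> / c"
  have d: "d > 0" "c * d = \<eta>" "d \<le> \<eta>" using c \<eta> by (auto simp: d_def field_simps)
  have cf2: "continuous_on X (\<lambda>x. (f x)\<^sup>2)" by (intro continuous_intros f)
  show ?thesis
  proof (rule that[of k "{(S, f), (N, \<lambda>x. (f x)\<^sup>2)}" d])
    show "continuous_on X k" "d > 0" using k d by auto
    show "{(S, f), (N, \<lambda>x. (f x)\<^sup>2)} \<in> tests"
      using S N f cf2 by (auto simp: tests_def)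
    fix g assume "near P {(S, f), (N, \<lambda>x. (f x)\<^sup>2)} d g"
    then have g: "\<And>M h. (M, h) \<in> {(S, f), (N, \<lambda>x. (f x)\<^sup>2)} \<Longrightarrow>
      \<bar>integral\<^sup>L M (\<lambda>x. h (act g x)) - integral\<^sup>L (P M) h\<bar> < d" by (auto simp: near_def)
    define l where "l x = f (act g x)" for x
    have l: "continuous_on X l" unfolding l_def by (rule continuous_comp_act[OF f(1)])
    define D where "D = integral\<^sup>L N (\<lambda>x. (l x - k x)\<^sup>2)"
    \<comment> \<open>Along P, both the squared norm of f \<circ> g and its inner product with G
      tend to A, the latter because P S = T. As the squared norm of G is at most A, this is the
      equality case of Cauchy-Schwarz, which forces f \<circ> g towards G.\<close>
    have 1: "integral\<^sup>L N (\<lambda>x. (l x)\<^sup>2) \<le> A + \<eta>"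
    proof -
      have "\<bar>integral\<^sup>L N (\<lambda>x. (l x)\<^sup>2) - A\<bar> < d"
        using g[of N "\<lambda>x. (f x)\<^sup>2"] by (simp add: A_def V_def l_def)
      with d show ?thesis by linarith
    qed
    have 2: "c * integral\<^sup>L S l \<ge> A - \<eta>"
    proof -
      have "\<bar>integral\<^sup>L S l - integral\<^sup>L T f\<bar> < d"
        using g[of S f] PQ[OF T] unfolding S_def l_def[abs_def] by simp
      then have "integral\<^sup>L T f - d \<le> integral\<^sup>L S l" by linarith
      then have "c * (integral\<^sup>L T f - d) \<le> c * integral\<^sup>L S l" using c by (intro mult_left_mono) auto
      moreover have "c * integral\<^sup>L T f = A" using iT'[OF f(1)] by (simp add: A_def power2_eq_square)
      ultimately show ?thesis using d by (simp add: right_diff_distrib)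
    qed
    have ints: "integrable N (\<lambda>x. (k x)\<^sup>2)" "integrable N (\<lambda>x. k x * l x)" "integrable N (\<lambda>x. (l x)\<^sup>2)"
      by (intro iN continuous_intros k l)+
    have 3: "D = integral\<^sup>L N (\<lambda>x. (l x)\<^sup>2) - 2 * integral\<^sup>L N (\<lambda>x. k x * l x) + integral\<^sup>L N (\<lambda>x. (k x)\<^sup>2)"
    proof -
      have "(\<lambda>x. (l x - k x)\<^sup>2) = (\<lambda>x. (l x)\<^sup>2 - 2 * (k x * l x) + (k x)\<^sup>2)"
        by (auto simp: fun_eq_iff power2_eq_square algebra_simps)
      then show ?thesis using ints by (simp add: D_def)
    qed
    have 4: "\<delta> (\<lambda>x. l x - k x) = c * integral\<^sup>L S l - c * integral\<^sup>L S k - integral\<^sup>L N (\<lambda>x. k x * l x)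
        + integral\<^sup>L N (\<lambda>x. (k x)\<^sup>2)"
    proof -
      have "(\<lambda>x. k x * (l x - k x)) = (\<lambda>x. k x * l x - (k x)\<^sup>2)"
        by (auto simp: fun_eq_iff power2_eq_square algebra_simps)
      then show ?thesis using ints iS[OF l] iS[OF k(1)] by (simp add: \<delta>_def right_diff_distrib)
    qed
    have 5: "2 * c * integral\<^sup>L S k - integral\<^sup>L N (\<lambda>x. (k x)\<^sup>2) \<le> A" using \<Phi>A[OF k(1)] by (simp add: \<Phi>_def)
    have 6: "2 * \<delta> (\<lambda>x. l x - k x) \<le> 2 * \<eta> + D / 2"
      unfolding D_def by (intro \<delta> continuous_intros l k)
    \<comment> \<open>Facts 1 to 5 give D \<le> 2 \<delta> + 3 \<eta> with \<delta> taken at l - k;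
      by 6 this is at most 5 \<eta> + D/2.\<close>
    have "D \<le> 10 * \<eta>" using 1 2 3 4 5 6 by linarith
    then show "integral\<^sup>L N (\<lambda>x. (f (act g x) - k x)\<^sup>2) \<le> 10 * \<eta>" by (simp add: D_def l_def)
  qed
qed

text \<open>One cluster point P serves all of F, so two different late terms are close to the same
  functions \<open>k f\<close>. Squaring the triangle inequality turns 10 \<eta> for each term into
  40 \<eta>.\<close>

lemma totally_bounded_L2:
  fixes g :: "nat \<Rightarrow> 'g" and F :: "('a \<Rightarrow> real) set"
  assumes d: "distal_system X act" and i: "injective_system X act" and N: "N \<in> PM X"
    and F: "finite F" "\<And>f. f \<in> F \<Longrightarrow> continuous_on X f" "\<And>f x. f \<in> F \<Longrightarrow> x \<in> X \<Longrightarrow> 1 \<le> f x" and \<eta>: "\<eta> > 0"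
  obtains n m where "n < m" "\<And>f. f \<in> F \<Longrightarrow> integral\<^sup>L N (\<lambda>x. (f (act (g n) x) - f (act (g m) x))\<^sup>2) \<le> 40 * \<eta>"
proof -
  obtain P where P: "P \<in> E_M X act" "\<And>K e n0. K \<in> tests \<Longrightarrow> e > 0 \<Longrightarrow> \<exists>n\<ge>n0. near P K e (g n)"
    using E_M_cluster[of g] by blast
  obtain Q where Q: "Q \<in> E_M X act" "\<And>N. N \<in> PM X \<Longrightarrow> Q (P N) = N" "\<And>N. N \<in> PM X \<Longrightarrow> P (Q N) = N"
    using E_M_inverse[OF d i P(1)] by blast
  define R where "R f k K d \<longleftrightarrow> continuous_on X k \<and> K \<in> tests \<and> d > 0 \<and>
    (\<forall>g. near P K d g \<longrightarrow> integral\<^sup>L N (\<lambda>x. (f (act g x) - k x)\<^sup>2) \<le> 10 * \<eta>)" for f k K d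
  have "\<exists>k K d. R f k K d" if f: "f \<in> F" for f
    unfolding R_def by (rule L2_approx[OF P(1) Q N F(2)[OF f] F(3)[OF f] \<eta>]) blast+
  then obtain k K d where R: "\<And>f. f \<in> F \<Longrightarrow> R f (k f) (K f) (d f)"
    by metis
  then have k: "\<And>f. f \<in> F \<Longrightarrow> continuous_on X (k f)" "\<And>f. f \<in> F \<Longrightarrow> K f \<in> tests" "\<And>f. f \<in> F \<Longrightarrow> d f > 0"
    "\<And>f g. f \<in> F \<Longrightarrow> near P (K f) (d f) g \<Longrightarrow> integral\<^sup>L N (\<lambda>x. (f (act g x) - k f x)\<^sup>2) \<le> 10 * \<eta>"
    unfolding R_def by blast+
  define e where "e = Min (insert 1 (d ` F))"
  have e: "e > 0" "\<And>f. f \<in> F \<Longrightarrow> e \<le> d f" using F k by (auto simp: e_def)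
  have K: "(\<Union>f\<in>F. K f) \<in> tests" using F(1) k(2) by (auto simp: tests_def)
  have small: "integral\<^sup>L N (\<lambda>x. (f (act (g n) x) - k f x)\<^sup>2) \<le> 10 * \<eta>"
    if n: "near P (\<Union>f\<in>F. K f) e (g n)" and f: "f \<in> F" for n f
  proof -
    have "near P (K f) (d f) (g n)"
      using n f e(2)[OF f] unfolding near_def by fastforce
    then show ?thesis using k(4) f by blast
  qed
  obtain n where n: "near P (\<Union>f\<in>F. K f) e (g n)" using P(2)[OF K e(1), of 0] by blast
  obtain m where m: "m \<ge> Suc n" "near P (\<Union>f\<in>F. K f) e (g m)" using P(2)[OF K e(1), of "Suc n"] by blast
  show ?thesis
  proof (rule that[of n m])
    show "n < m" using m by simp
    fix f assume f: "f \<in> F"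
    have ck: "continuous_on X (k f)" using k f by blast
    note c = continuous_comp_act[OF F(2)[OF f]]
    have "integral\<^sup>L N (\<lambda>x. (f (act (g n) x) - f (act (g m) x))\<^sup>2) \<le>
      integral\<^sup>L N (\<lambda>x. 2 * (f (act (g n) x) - k f x)\<^sup>2 + 2 * (f (act (g m) x) - k f x)\<^sup>2)"
    proof (rule integral_mono)
      fix x
      show "(f (act (g n) x) - f (act (g m) x))\<^sup>2 \<le> 2 * (f (act (g n) x) - k f x)\<^sup>2 + 2 * (f (act (g m) x) - k f x)\<^sup>2"
        using sum_squares_bound[of "f (act (g n) x) - k f x" "k f x - f (act (g m) x)"]
        by (simp add: power2_eq_square algebra_simps)
    qed (intro integrable_PM[OF compact_X N] continuous_intros c ck)+
    also have "\<dots> = 2 * integral\<^sup>L N (\<lambda>x. (f (act (g n) x) - k f x)\<^sup>2) + 2 * integral\<^sup>L N (\<lambda>x. (f (act (g m) x) - k f x)\<^sup>2)"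
    proof -
      have "integrable N (\<lambda>x. (f (act (g n) x) - k f x)\<^sup>2)" "integrable N (\<lambda>x. (f (act (g m) x) - k f x)\<^sup>2)"
        by (intro integrable_PM[OF compact_X N] continuous_intros c ck)+
      then show ?thesis by simp
    qed
    also have "\<dots> \<le> 40 * \<eta>" using small[OF n f] small[OF m(2) f] by linarith
    finally show "integral\<^sup>L N (\<lambda>x. (f (act (g n) x) - f (act (g m) x))\<^sup>2) \<le> 40 * \<eta>" .
  qed
qed

text \<open>Distances to the points of a finite e/8-net determine the distance of two points up to
  e/4. Adding 1 to these functions meets the lower bound required of test functions and does not
  affect differences.\<close>

lemma totally_bounded_L1:
  fixes g :: "nat \<Rightarrow> 'g"
  assumes d: "distal_system X act" and i: "injective_system X act" and N: "N \<in> PM X" and e: "e > 0"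
  obtains n m where "n < m" "integral\<^sup>L N (\<lambda>x. dist (act (g n) x) (act (g m) x)) < e"
proof -
  interpret prob_space N using N by (simp add: PM_def)
  obtain Z where Z: "finite Z" "Z \<subseteq> X" "X \<subseteq> (\<Union>z\<in>Z. ball z (e/8))"
    using compactE_image[OF compact_X, of X "\<lambda>z. ball z (e/8)"] e by force
  \<comment> \<open>Each net point will contribute \<theta> + \<theta>, so the whole net contributes
    at most e/4; the 1 in the denominator covers an empty net.\<close>
  define \<theta> where "\<theta> = e / (8 * (card Z + 1))"
  have \<theta>: "\<theta> > 0" "card Z * \<theta> \<le> e / 8" using e by (auto simp: \<theta>_def field_simps)
  obtain n m where nm: "n < m" and *: "\<And>f. f \<in> (\<lambda>z x. 1 + dist x z) ` Z \<Longrightarrow>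
      integral\<^sup>L N (\<lambda>x. (f (act (g n) x) - f (act (g m) x))\<^sup>2) \<le> 40 * (\<theta>\<^sup>2 / 40)"
  proof (rule totally_bounded_L2[OF d i N, of "(\<lambda>z x. 1 + dist x z) ` Z" "\<theta>\<^sup>2 / 40" g])
    show "finite ((\<lambda>z x. 1 + dist x z) ` Z)" using Z by simp
    show "continuous_on X f" if "f \<in> (\<lambda>z x. 1 + dist x z) ` Z" for f
      using that by (auto intro!: continuous_intros)
    show "1 \<le> f x" if "f \<in> (\<lambda>z x. 1 + dist x z) ` Z" for f and x :: 'a using that by auto
    show "\<theta>\<^sup>2 / 40 > 0" using \<theta> by simp
  qed blast
  define D where "D z x = dist (act (g n) x) z - dist (act (g m) x) z" for z x
  have cd: "continuous_on X (D z)" for z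
    unfolding D_def by (intro continuous_intros continuous_act)
  have D: "integral\<^sup>L N (\<lambda>x. (D z x)\<^sup>2) \<le> \<theta>\<^sup>2" if "z \<in> Z" for z
    using *[of "\<lambda>x. 1 + dist x z"] that by (simp add: D_def)
  have "integral\<^sup>L N (\<lambda>x. dist (act (g n) x) (act (g m) x)) \<le>
      integral\<^sup>L N (\<lambda>x. e/4 + (\<Sum>z\<in>Z. \<theta> + (D z x)\<^sup>2 / \<theta>))"
  proof (rule integral_mono)
    show "integrable N (\<lambda>x. dist (act (g n) x) (act (g m) x))"
      by (intro integrable_PM[OF compact_X N] continuous_intros continuous_act)
    show "integrable N (\<lambda>x. e/4 + (\<Sum>z\<in>Z. \<theta> + (D z x)\<^sup>2 / \<theta>))"
      using \<theta> by (intro integrable_PM[OF compact_X N] continuous_intros cd) auto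
    fix x assume "x \<in> space N"
    then have "x \<in> X" using space_PM[OF N] by simp
    then have "act (g m) x \<in> (\<Union>z\<in>Z. ball z (e/8))" using act_in Z(3) by blast
    then obtain z where z: "z \<in> Z" "dist z (act (g m) x) < e/8" by auto
    have "dist (act (g n) x) (act (g m) x) \<le> dist (act (g n) x) z + dist z (act (g m) x)" by (rule dist_triangle)
    then have "dist (act (g n) x) (act (g m) x) \<le> e/4 + \<bar>D z x\<bar>"
      using z(2) by (simp add: D_def dist_commute abs_if)
    \<comment> \<open>Passes from absolute values to squares: wherever |t| exceeds \<theta>, it is
      at most t^2/\<theta>.\<close>
    moreover have abs: "\<bar>t\<bar> \<le> \<theta> + t\<^sup>2 / \<theta>" for t
    proof (cases "\<bar>t\<bar> \<le> \<theta>")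
      case False
      then have "\<bar>t\<bar> * \<theta> \<le> t\<^sup>2" using \<theta> mult_left_mono[of \<theta> "\<bar>t\<bar>" "\<bar>t\<bar>"] by (simp add: power2_eq_square)
      then have "\<bar>t\<bar> \<le> t\<^sup>2 / \<theta>" using \<theta> by (simp add: field_simps)
      then show ?thesis using \<theta> by simp
    qed (use \<theta> in \<open>simp add: add_increasing2\<close>)
    have "\<theta> + (D z x)\<^sup>2 / \<theta> \<le> (\<Sum>z\<in>Z. \<theta> + (D z x)\<^sup>2 / \<theta>)"
      using z(1) Z(1) \<theta> by (intro member_le_sum) auto
    ultimately show "dist (act (g n) x) (act (g m) x) \<le> e/4 + (\<Sum>z\<in>Z. \<theta> + (D z x)\<^sup>2 / \<theta>)"
      using abs[of "D z x"] by linarith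
  qed
  also have "\<dots> = e/4 + (\<Sum>z\<in>Z. \<theta> + integral\<^sup>L N (\<lambda>x. (D z x)\<^sup>2) / \<theta>)"
  proof -
    have "integrable N (\<lambda>x. (D z x)\<^sup>2)" for z by (intro integrable_PM[OF compact_X N] continuous_intros cd)
    then show ?thesis by (simp add: Bochner_Integration.integral_sum prob_space)
  qed
  also have "\<dots> \<le> e/4 + (\<Sum>z\<in>Z. \<theta> + \<theta>)"
  proof -
    have "integral\<^sup>L N (\<lambda>x. (D z x)\<^sup>2) / \<theta> \<le> \<theta>" if "z \<in> Z" for z
      using D[OF that] \<theta> by (simp add: field_simps power2_eq_square)
    then show ?thesis by (intro add_left_mono sum_mono) auto
  qed
  also have "\<dots> \<le> e / 2" using \<theta>(2) by simp
  also have "\<dots> < e" using e by simp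
  finally show ?thesis using that nm by blast
qed

end

section \<open>The Cantor scheme\<close>

lemma cluster_measure_sequence:
  fixes X :: "'a::metric_space set" and Ns :: "nat \<Rightarrow> 'a measure"
  assumes X: "compact X" and Ns: "\<And>n. Ns n \<in> PM X"
  obtains N where "N \<in> PM X" "\<And>(f :: 'a \<Rightarrow> real) e n0. continuous_on X f \<Longrightarrow> e > 0 \<Longrightarrow>
      \<exists>n\<ge>n0. \<bar>integral\<^sup>L (Ns n) f - integral\<^sup>L N f\<bar> < e"
proof (rule cluster_measures[OF X, of "{()}" "\<lambda>n _. Ns n"])
  show "Ns n \<in> PM X" for n by (rule Ns)
  fix P assume P: "\<And>i. i \<in> {()} \<Longrightarrow> P i \<in> PM X"
    "\<And>K e n0. finite K \<Longrightarrow> (\<And>i f. (i, f) \<in> K \<Longrightarrow> i \<in> {()} \<and> continuous_on X f) \<Longrightarrow> e > 0 \<Longrightarrow>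
      \<exists>n\<ge>n0. \<forall>(i, f)\<in>K. \<bar>integral\<^sup>L (Ns n) f - integral\<^sup>L (P i) f\<bar> < (e::real)"
  show thesis
  proof (rule that[of "P ()"])
    show "P () \<in> PM X" using P(1) by simp
    show "\<exists>n\<ge>n0. \<bar>integral\<^sup>L (Ns n) f - integral\<^sup>L (P ()) f\<bar> < e" if "continuous_on X f" "e > 0"
      for f :: "'a \<Rightarrow> real" and e n0
      using P(2)[of "{((), f)}" e n0] that by auto
  qed
qed

context compact_system
begin

lemma average_measure:
  fixes x :: "'s \<Rightarrow> 'a"
  assumes S: "finite S" "S \<noteq> {}" and x: "\<And>s. x s \<in> X"
  obtains N where "N \<in> PM X" "\<And>f :: 'a \<Rightarrow> real. continuous_on X f \<Longrightarrow> integral\<^sup>L N f = (\<Sum>s\<in>S. f (x s)) / card S"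
proof -
  define N where "N = distr (measure_pmf (pmf_of_set S)) (borelX X) x"
  have m: "x \<in> measurable (measure_pmf (pmf_of_set S)) (borelX X)"
    using x by (auto simp: measurable_def borelX_def space_restrict_space)
  have "N \<in> PM X"
    using prob_space.prob_space_distr[OF prob_space_measure_pmf m] by (simp add: N_def PM_def)
  moreover have "integral\<^sup>L N f = (\<Sum>s\<in>S. f (x s)) / card S" if "continuous_on X f" for f :: "'a \<Rightarrow> real"
  proof -
    have "f \<in> borel_measurable (borelX X)" using that by (simp add: borelX_def borel_measurable_continuous_on_restrict)
    then show ?thesis unfolding N_def by (subst integral_distr[OF m]) (auto intro: integral_pmf_of_set[OF S(2,1)])
  qed
  ultimately show ?thesis using that by blast
qed

text \<open>The two sets are preimages of balls of radius e/8 around the images of x and y: two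
  radii bound the diameter, and e minus two radii is the separation 3e/4.\<close>

lemma separating_step:
  assumes g: "x \<in> U" "y \<in> U" "dist (act g x) (act g y) > e" and e: "e > 0" and U: "openin (top_of_set X) U"
  obtains A where "\<And>b::bool. openin (top_of_set X) (A b)" "\<And>b. A b \<noteq> {}" "\<And>b. A b \<subseteq> U"
    "\<And>b v w. v \<in> A b \<Longrightarrow> w \<in> A b \<Longrightarrow> dist (act g v) (act g w) < e/4"
    "\<And>b v w. v \<in> A b \<Longrightarrow> w \<in> A (\<not> b) \<Longrightarrow> dist (act g v) (act g w) > 3*e/4"
proof -
  have UX: "U \<subseteq> X" using openin_imp_subset[OF U] .
  define z where "z b = (if b then x else y)" for b
  define A where "A b = U \<inter> (X \<inter> act g -` ball (act g (z b)) (e/8))" for b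
  show ?thesis
  proof (rule that[of A])
    show "openin (top_of_set X) (A b)" for b
      unfolding A_def by (intro openin_Int U continuous_openin_preimage_gen[OF continuous_act open_ball])
    have "z b \<in> A b" for b using g UX e by (auto simp: A_def z_def)
    then show "A b \<noteq> {}" for b by blast
    show "A b \<subseteq> U" for b by (auto simp: A_def)
    show "dist (act g v) (act g w) < e/4" if "v \<in> A b" "w \<in> A b" for b v w
      using that dist_triangle3[of "act g v" "act g w" "act g (z b)"] by (auto simp: A_def)
    show "dist (act g v) (act g w) > 3*e/4" if "v \<in> A b" "w \<in> A (\<not> b)" for b v w
    proof -
      have "dist (act g (z b)) (act g (z (\<not> b))) > e" using g by (auto simp: z_def dist_commute)
      moreover have "dist (act g (z b)) (act g v) < e/8" "dist (act g (z (\<not> b))) (act g w) < e/8"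
        using that by (auto simp: A_def)
      moreover have "dist (act g (z b)) (act g (z (\<not> b))) \<le> dist (act g (z b)) (act g v) + dist (act g v) (act g w) + dist (act g (z (\<not> b))) (act g w)"
        using dist_triangle[of "act g (z b)" "act g (z (\<not> b))" "act g v"]
          dist_triangle[of "act g v" "act g (z (\<not> b))" "act g w"] by (simp add: dist_commute)
      ultimately show ?thesis by linarith
    qed
  qed
qed

definition cells :: "'a set \<Rightarrow> nat \<Rightarrow> (bool list \<Rightarrow> 'a set) \<Rightarrow> bool" where
  "cells V n W \<longleftrightarrow> (\<forall>s. length s = n \<longrightarrow> openin (top_of_set X) (W s) \<and> W s \<noteq> {} \<and> W s \<subseteq> V)"

text \<open>The most recently chosen bit is the head of the list, so dropping a prefix recovers an ancestor cell.\<close>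
definition splits :: "real \<Rightarrow> nat \<Rightarrow> 'g \<Rightarrow> (bool list \<Rightarrow> 'a set) \<Rightarrow> (bool list \<Rightarrow> 'a set) \<Rightarrow> bool" where
  "splits e n g W W' \<longleftrightarrow> (\<forall>s b. length s = n \<longrightarrow> W' (b # s) \<subseteq> W s \<and>
     (\<forall>v\<in>W' (b # s). \<forall>w\<in>W' (b # s). dist (act g v) (act g w) < e/4) \<and>
     (\<forall>v\<in>W' (b # s). \<forall>w\<in>W' ((\<not> b) # s). dist (act g v) (act g w) > 3*e/4))"

lemma finite_bool_lists: "finite {s :: bool list. length s = n}"
  using finite_lists_length_eq[of "UNIV :: bool set" n] by simp

text \<open>The hypothesis \<open>neg\<close> is applied to all cells of a level at once, so a
  single group element splits every one of them.\<close>

lemma splits_exists: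
  assumes neg: "\<And>\<U>. finite \<U> \<Longrightarrow> (\<And>U. U \<in> \<U> \<Longrightarrow> openin (top_of_set X) U \<and> U \<noteq> {} \<and> U \<subseteq> V) \<Longrightarrow>
      \<exists>g. \<forall>U\<in>\<U>. \<exists>x\<in>U. \<exists>y\<in>U. dist (act g x) (act g y) > e"
    and e: "e > 0" and W: "cells V n W"
  shows "\<exists>W'. cells V (Suc n) W' \<and> (\<exists>g. splits e n g W W')"
proof -
  obtain g where g: "\<And>s. length s = n \<Longrightarrow> \<exists>x\<in>W s. \<exists>y\<in>W s. dist (act g x) (act g y) > e"
    using neg[of "W ` {s. length s = n}"] W finite_bool_lists by (fastforce simp: cells_def)
  define R where "R s A \<longleftrightarrow> (\<forall>b::bool. openin (top_of_set X) (A b) \<and> A b \<noteq> {} \<and> A b \<subseteq> W s \<and>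
     (\<forall>v\<in>A b. \<forall>w\<in>A b. dist (act g v) (act g w) < e/4) \<and>
     (\<forall>v\<in>A b. \<forall>w\<in>A (\<not> b). dist (act g v) (act g w) > 3*e/4))" for s A
  have "\<exists>A. R s A" if s: "length s = n" for s
  proof -
    obtain x y where xy: "x \<in> W s" "y \<in> W s" "dist (act g x) (act g y) > e" using g[OF s] by blast
    have "openin (top_of_set X) (W s)" using W s by (auto simp: cells_def)
    from separating_step[OF xy e this] show ?thesis unfolding R_def by metis
  qed
  then obtain A where A: "\<And>s. length s = n \<Longrightarrow> R s (A s)" by metis
  define W' where "W' s = A (tl s) (hd s)" for s
  have "cells V (Suc n) W'"
    unfolding cells_def
  proof (intro allI impI)
    fix s :: "bool list" assume "length s = Suc n"
    then have s: "length (tl s) = n" by simp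
    then have "W (tl s) \<subseteq> V" using W by (simp add: cells_def)
    with A[OF s] show "openin (top_of_set X) (W' s) \<and> W' s \<noteq> {} \<and> W' s \<subseteq> V"
      unfolding R_def W'_def by blast
  qed
  moreover have "splits e n g W W'"
    using A unfolding splits_def R_def W'_def by simp
  ultimately show ?thesis by blast
qed

text \<open>Let n < m. Sibling cells of level m + 1 are moved more than 3e/4 apart by g m, but lie
  in a common cell of level n + 1, which g n maps to diameter below e/4. So the displacements
  between g n and g m at two points taken from the siblings add up to at least e/2. Giving siblings
  equal mass yields mean displacement at least e/4.\<close>

lemma separated_measure:
  assumes neg: "\<And>\<U>. finite \<U> \<Longrightarrow> (\<And>U. U \<in> \<U> \<Longrightarrow> openin (top_of_set X) U \<and> U \<noteq> {} \<and> U \<subseteq> V) \<Longrightarrow>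
      \<exists>g. \<forall>U\<in>\<U>. \<exists>x\<in>U. \<exists>y\<in>U. dist (act g x) (act g y) > e"
    and e: "e > 0" and V: "openin (top_of_set X) V" "V \<noteq> {}"
  obtains N and g :: "nat \<Rightarrow> 'g" where "N \<in> PM X"
    "\<And>n m. n < m \<Longrightarrow> integral\<^sup>L N (\<lambda>x. dist (act (g n) x) (act (g m) x)) \<ge> e/4"
proof -
  have "\<exists>W. \<forall>n. cells V n (W n) \<and> (\<exists>g. splits e n g (W n) (W (Suc n)))"
  proof (rule dependent_nat_choice)
    show "\<exists>W. cells V 0 W" using V by (auto simp: cells_def)
    show "\<exists>W'. cells V (Suc n) W' \<and> (\<exists>g. splits e n g W W')" if "cells V n W" for W n
      using splits_exists[OF neg e that] by blast
  qed
  then obtain W g where W: "\<And>n. cells V n (W n)" and g: "\<And>n. splits e n (g n) (W n) (W (Suc n))"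
    by metis
  have sub1: "W (Suc n) (b # s) \<subseteq> W n s" if "length s = n" for n b s
    using g[of n] that by (simp add: splits_def)
  have sub: "W M s \<subseteq> W n (drop (M - n) s)" if "length s = M" "n \<le> M" for M n s
    using that
  proof (induction M arbitrary: s)
    case (Suc M)
    show ?case
    proof (cases "n = Suc M")
      case False
      obtain b t where s: "s = b # t" "length t = M" using Suc.prems(1) by (cases s) auto
      have "W (Suc M) s \<subseteq> W M t" using sub1 s by simp
      also have "\<dots> \<subseteq> W n (drop (M - n) t)" using Suc s False by simp
      also have "drop (M - n) t = drop (Suc M - n) s" using s Suc.prems False by (simp add: Suc_diff_le)
      finally show ?thesis .
    qed simp
  qed simp
  obtain v0 where "v0 \<in> V" using V by blast
  have VX: "V \<subseteq> X" using openin_imp_subset[OF V(1)] .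
  \<comment> \<open>The default v0 for lists of the wrong length keeps every value in X, as
    \<open>average_measure\<close> asks of the whole function.\<close>
  define x where "x M s = (if length s = M then SOME v. v \<in> W M s else v0)" for M s
  have xW: "x M s \<in> W M s" if "length s = M" for M s
    using W[of M] that some_in_eq[of "W M s"] by (simp add: x_def cells_def)
  have xX: "x M s \<in> X" for M s
  proof (cases "length s = M")
    case True
    then show ?thesis using xW[OF True] W[of M] VX by (auto simp: cells_def)
  qed (use \<open>v0 \<in> V\<close> VX in \<open>auto simp: x_def\<close>)
  define S where "S M = {s :: bool list. length s = M}" for M
  have S: "finite (S M)" "S M \<noteq> {}" for M
    using finite_bool_lists Ex_list_of_length[of M] by (auto simp: S_def)
  have "\<exists>N. N \<in> PM X \<and> (\<forall>f :: 'a \<Rightarrow> real. continuous_on X f \<longrightarrow> integral\<^sup>L N f = (\<Sum>s\<in>S M. f (x M s)) / card (S M))" for M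
    by (rule average_measure[OF S, of "x M" M]) (use xX in blast)+
  then obtain Ns where Ns: "\<And>M. Ns M \<in> PM X"
    "\<And>M f. continuous_on X f \<Longrightarrow> integral\<^sup>L (Ns M) f = (\<Sum>s\<in>S M. f (x M s)) / card (S M)" by metis
  have lower: "integral\<^sup>L (Ns M) (\<lambda>x. dist (act (g n) x) (act (g m) x)) \<ge> e/4" if nm: "n < m" "m < M" for n m M
  proof -
    define D where "D v = dist (act (g n) v) (act (g m) v)" for v
    have cD: "continuous_on X D" unfolding D_def by (intro continuous_intros continuous_act)
    \<comment> \<open>Flips the bit chosen at step m. The newest bit comes first, so in a list of
      length M it sits at index M - Suc m and the tail after it is the ancestor t of length m. This
      involution of \<open>S M\<close> pairs points of sibling cells.\<close>
    define fl where "fl s = s[M - Suc m := \<not> s ! (M - Suc m)]" for s :: "bool list"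
    have flS: "fl s \<in> S M" if "s \<in> S M" for s using that by (simp add: fl_def S_def)
    have flfl: "fl (fl s) = s" if "s \<in> S M" for s using that nm by (simp add: fl_def S_def)
    have bij: "bij_betw fl (S M) (S M)" by (rule bij_betwI[of fl _ _ fl]) (auto simp: flS flfl)
    have pair: "D (x M s) + D (x M (fl s)) \<ge> e/2" if s: "s \<in> S M" for s
    proof -
      define b t where "b = s ! (M - Suc m)" and "t = drop (M - m) s"
      have len: "length s = M" "length (fl s) = M" using s flS[OF s] by (auto simp: S_def)
      have lt: "length t = m" using len nm by (simp add: t_def)
      have Sm: "M - m = Suc (M - Suc m)" using nm by simp
      have 1: "drop (M - Suc m) s = b # t"
        unfolding b_def t_def Sm using len nm by (intro Cons_nth_drop_Suc[symmetric]) simp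
      have 2: "drop (M - Suc m) (fl s) = (\<not> b) # t"
      proof -
        have "drop (M - Suc m) (fl s) = fl s ! (M - Suc m) # drop (Suc (M - Suc m)) (fl s)"
          using len nm by (intro Cons_nth_drop_Suc[symmetric]) simp
        then show ?thesis unfolding b_def t_def Sm using len nm by (simp add: fl_def)
      qed
      have x1: "x M s \<in> W (Suc m) (b # t)" using sub[OF len(1), of "Suc m"] xW[OF len(1)] nm 1 by auto
      have x2: "x M (fl s) \<in> W (Suc m) ((\<not> b) # t)" using sub[OF len(2), of "Suc m"] xW[OF len(2)] nm 2 by auto
      have m1: "dist (act (g m) (x M s)) (act (g m) (x M (fl s))) > 3*e/4"
        using g[of m] x1 x2 lt unfolding splits_def by blast
      have sn: "W m t \<subseteq> W (Suc n) (drop (m - Suc n) t)" using sub[OF lt, of "Suc n"] nm by auto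
      have "length (drop (m - Suc n) t) = Suc n" using lt nm by simp
      then obtain b' t' where t': "drop (m - Suc n) t = b' # t'" "length t' = n" by (metis length_Suc_conv)
      have "x M s \<in> W (Suc n) (b' # t')" "x M (fl s) \<in> W (Suc n) (b' # t')"
        using x1 x2 sub1[OF lt] sn t' by auto
      then have n1: "dist (act (g n) (x M s)) (act (g n) (x M (fl s))) < e/4"
        using g[of n] t'(2) unfolding splits_def by blast
      have "dist (act (g m) (x M s)) (act (g m) (x M (fl s))) \<le>
          dist (act (g n) (x M s)) (act (g m) (x M s)) + dist (act (g n) (x M s)) (act (g n) (x M (fl s)))
          + dist (act (g n) (x M (fl s))) (act (g m) (x M (fl s)))"
        using dist_triangle3[of "act (g m) (x M s)" "act (g m) (x M (fl s))" "act (g n) (x M s)"]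
          dist_triangle[of "act (g n) (x M s)" "act (g m) (x M (fl s))" "act (g n) (x M (fl s))"] by linarith
      with m1 n1 show ?thesis unfolding D_def by linarith
    qed
    \<comment> \<open>Summing over all s counts each displacement twice, once as s and once as its
      flip; hence e/4 for the average.\<close>
    have "card (S M) * (e/2) \<le> (\<Sum>s\<in>S M. D (x M s) + D (x M (fl s)))"
      using sum_mono[of "S M" "\<lambda>_. e/2", OF pair] by simp
    also have "\<dots> = 2 * (\<Sum>s\<in>S M. D (x M s))"
      using sum.reindex_bij_betw[OF bij, of "\<lambda>s. D (x M s)"] by (simp add: sum.distrib)
    finally have "e/4 \<le> (\<Sum>s\<in>S M. D (x M s)) / card (S M)"
      using S card_gt_0_iff[of "S M"] by (simp add: field_simps)
    then have "e/4 \<le> integral\<^sup>L (Ns M) D" using Ns(2)[OF cD] by simp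
    then show ?thesis unfolding D_def .
  qed
  show ?thesis
  \<comment> \<open>The lower bound for fixed n < m holds for every M > m, that is, along a whole
    tail, so it passes to any cluster measure.\<close>
  proof (rule cluster_measure_sequence[of X Ns, OF compact_X Ns(1)])
    fix N assume N: "N \<in> PM X" and cl: "\<And>(f :: 'a \<Rightarrow> real) e n0. continuous_on X f \<Longrightarrow> e > 0 \<Longrightarrow>
      \<exists>n\<ge>n0. \<bar>integral\<^sup>L (Ns n) f - integral\<^sup>L N f\<bar> < e"
    have "integral\<^sup>L N (\<lambda>x. dist (act (g n) x) (act (g m) x)) \<ge> e/4" if nm: "n < m" for n m
    proof (rule field_le_epsilon)
      fix d :: real assume "d > 0"
      have cD: "continuous_on X (\<lambda>x. dist (act (g n) x) (act (g m) x))" by (intro continuous_intros continuous_act)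
      obtain M where "M \<ge> Suc m" "\<bar>integral\<^sup>L (Ns M) (\<lambda>x. dist (act (g n) x) (act (g m) x)) -
          integral\<^sup>L N (\<lambda>x. dist (act (g n) x) (act (g m) x))\<bar> < d"
        using cl[OF cD \<open>d > 0\<close>, of "Suc m"] by auto
      with lower[OF nm, of M] show "e/4 \<le> integral\<^sup>L N (\<lambda>x. dist (act (g n) x) (act (g m) x)) + d" by linarith
    qed
    then show thesis by (rule that[OF N])
  qed
qed

lemma uniformly_small_family:
  assumes d: "distal_system X act" and i: "injective_system X act"
    and e: "e > 0" and V: "openin (top_of_set X) V" "V \<noteq> {}"
  obtains \<U> where "finite \<U>" "\<And>U. U \<in> \<U> \<Longrightarrow> openin (top_of_set X) U \<and> U \<noteq> {} \<and> U \<subseteq> V"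
    "\<And>g. \<exists>U\<in>\<U>. \<forall>x\<in>U. \<forall>y\<in>U. dist (act g x) (act g y) \<le> e"
proof (rule ccontr)
  note thesisI = that
  assume "\<not> thesis"
  have neg: "\<exists>g. \<forall>U\<in>\<U>. \<exists>x\<in>U. \<exists>y\<in>U. dist (act g x) (act g y) > e"
    if "finite \<U>" "\<And>U. U \<in> \<U> \<Longrightarrow> openin (top_of_set X) U \<and> U \<noteq> {} \<and> U \<subseteq> V" for \<U>
  proof (rule ccontr)
    assume "\<not> ?thesis"
    then have "\<exists>U\<in>\<U>. \<forall>x\<in>U. \<forall>y\<in>U. dist (act g x) (act g y) \<le> e" for g by (meson not_le)
    with \<open>\<not> thesis\<close> thesisI[OF that] show False by blast
  qed
  obtain N and g :: "nat \<Rightarrow> 'g" where N: "N \<in> PM X"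
    "\<And>n m. n < m \<Longrightarrow> integral\<^sup>L N (\<lambda>x. dist (act (g n) x) (act (g m) x)) \<ge> e/4"
    using separated_measure[OF neg e V] by blast
  obtain n m where "n < m" "integral\<^sup>L N (\<lambda>x. dist (act (g n) x) (act (g m) x)) < e/4"
    using totally_bounded_L1[OF d i N(1), of "e/4" g] e by auto
  with N(2) show False by force
qed

end

section \<open>Equicontinuity\<close>

context compact_system
begin

lemma act_uniform:
  assumes "e > 0"
  obtains d where "d > 0" "\<And>x y. x \<in> X \<Longrightarrow> y \<in> X \<Longrightarrow> dist x y < d \<Longrightarrow> dist (act g x) (act g y) < e"
proof -
  have "uniformly_continuous_on X (act g)"
    using compact_uniformly_continuous continuous_act compact_X by blast
  then show ?thesis using assms that unfolding uniformly_continuous_on_def by metis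
qed

section \<open>Pointwise convergence on the group and generic points of X\<close>

definition pnbhd :: "'g \<Rightarrow> 'a set \<Rightarrow> real \<Rightarrow> 'g set" where
  "pnbhd \<gamma> S d = {g. \<forall>s\<in>S. dist (act g s) (act \<gamma> s) < d}"

definition small_on :: "real \<Rightarrow> 'a set \<Rightarrow> 'g set" where
  "small_on e U = {g. \<forall>x\<in>U. \<forall>y\<in>U. dist (act g x) (act g y) \<le> e}"

text \<open>\<open>small_on e U\<close> is closed for pointwise convergence: a pair violating it
  still does so after a small perturbation at its two points. Here d1 is the slack left on S, and d2
  is half the excess over e.\<close>

lemma pnbhd_avoid:
  assumes S: "finite S" "S \<subseteq> X" "d > 0" and U: "U \<subseteq> X" and g: "g \<in> pnbhd \<gamma> S d" "g \<notin> small_on e U"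
  obtains S' d' where "finite S'" "S' \<subseteq> X" "d' > 0" "pnbhd g S' d' \<subseteq> pnbhd \<gamma> S d - small_on e U"
proof -
  obtain x y where xy: "x \<in> U" "y \<in> U" "dist (act g x) (act g y) > e" using g by (auto simp: small_on_def)
  define d1 where "d1 = Min (insert 1 ((\<lambda>s. d - dist (act g s) (act \<gamma> s)) ` S))"
  have d1: "d1 > 0" "\<And>s. s \<in> S \<Longrightarrow> d1 \<le> d - dist (act g s) (act \<gamma> s)"
    using S g(1) by (auto simp: d1_def pnbhd_def)
  define d2 where "d2 = (dist (act g x) (act g y) - e) / 2"
  have d2: "d2 > 0" "2 * d2 = dist (act g x) (act g y) - e" using xy by (auto simp: d2_def)
  show ?thesis
  proof (rule that[of "insert x (insert y S)" "min d1 d2"])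
    show "finite (insert x (insert y S))" "insert x (insert y S) \<subseteq> X" "min d1 d2 > 0"
      using S U xy d1 d2 by auto
    show "pnbhd g (insert x (insert y S)) (min d1 d2) \<subseteq> pnbhd \<gamma> S d - small_on e U"
    proof
      fix h assume h: "h \<in> pnbhd g (insert x (insert y S)) (min d1 d2)"
      have "dist (act h s) (act \<gamma> s) < d" if s: "s \<in> S" for s
      proof -
        have "dist (act h s) (act g s) < d1" using h s by (auto simp: pnbhd_def)
        then show ?thesis using d1(2)[OF s] dist_triangle[of "act h s" "act \<gamma> s" "act g s"] by linarith
      qed
      moreover have "dist (act h x) (act h y) > e"
      proof -
        have "dist (act h x) (act g x) < d2" "dist (act h y) (act g y) < d2" using h by (auto simp: pnbhd_def)
        then show ?thesis using d2(2) dist_triangle[of "act g x" "act g y" "act h x"]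
            dist_triangle[of "act h x" "act g y" "act h y"] by (simp add: dist_commute)
      qed
      ultimately show "h \<in> pnbhd \<gamma> S d - small_on e U" using xy by (force simp: pnbhd_def small_on_def)
    qed
  qed
qed

text \<open>A finite Baire argument: if the first closed set does not contain the neighbourhood, a
  smaller neighbourhood avoids it and is covered by one set fewer. The centre therefore moves, and
  the induction generalises over it.\<close>

lemma finite_cover_interior:
  assumes "finite \<U>" "\<And>U. U \<in> \<U> \<Longrightarrow> U \<subseteq> X" "finite S" "S \<subseteq> X" "d > 0" "pnbhd \<gamma> S d \<subseteq> (\<Union>U\<in>\<U>. small_on e U)"
  shows "\<exists>U\<in>\<U>. \<exists>\<gamma> S d. finite S \<and> S \<subseteq> X \<and> d > 0 \<and> pnbhd \<gamma> S d \<subseteq> small_on e U"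
  using assms
proof (induction arbitrary: \<gamma> S d rule: finite_induct)
  case empty
  have "\<gamma> \<in> pnbhd \<gamma> S d" using empty by (simp add: pnbhd_def)
  with empty show ?case by auto
next
  case (insert U \<U>)
  show ?case
  proof (cases "pnbhd \<gamma> S d \<subseteq> small_on e U")
    case True
    with insert.prems show ?thesis by blast
  next
    case False
    then obtain g where g: "g \<in> pnbhd \<gamma> S d" "g \<notin> small_on e U" by blast
    have "U \<subseteq> X" using insert.prems by blast
    then obtain S' d' where S': "finite S'" "S' \<subseteq> X" "d' > 0" "pnbhd g S' d' \<subseteq> pnbhd \<gamma> S d - small_on e U"
      using pnbhd_avoid[OF insert.prems(2-4) _ g] by blast
    then have "pnbhd g S' d' \<subseteq> (\<Union>U\<in>\<U>. small_on e U)" using insert.prems(5) by blast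
    from insert.IH[OF _ S'(1-3) this] insert.prems(1) show ?thesis by blast
  qed
qed

text \<open>
  The quantifier over \<open>h\<close> ranges over a neighbourhood of the identity for pointwise convergence. The
  translation by \<open>\<gamma>\<close> cannot be removed, but it is harmless: it turns smallness into proximality.
\<close>
definition contracted :: "real \<Rightarrow> 'a set \<Rightarrow> bool" where
  "contracted e U \<longleftrightarrow> (\<exists>\<gamma> S d. finite S \<and> S \<subseteq> X \<and> d > 0 \<and>
    (\<forall>h. (\<forall>s\<in>S. dist (act h s) s < d) \<longrightarrow> (\<forall>x\<in>U. \<forall>y\<in>U. dist (act \<gamma> (act h x)) (act \<gamma> (act h y)) \<le> e)))"

text \<open>One of the finitely many smallness conditions holds on a neighbourhood of some \<gamma>.
  If h is close to the identity on S, then \<gamma> + h is close to \<gamma> there, by uniform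
  continuity of the action of \<gamma>.\<close>

lemma contracted_exists:
  assumes "distal_system X act" "injective_system X act" "e > 0" "openin (top_of_set X) V" "V \<noteq> {}"
  obtains U where "openin (top_of_set X) U" "U \<noteq> {}" "U \<subseteq> V" "contracted e U"
proof -
  obtain \<U> where \<U>: "finite \<U>" "\<And>U. U \<in> \<U> \<Longrightarrow> openin (top_of_set X) U \<and> U \<noteq> {} \<and> U \<subseteq> V"
    "\<And>g. \<exists>U\<in>\<U>. \<forall>x\<in>U. \<forall>y\<in>U. dist (act g x) (act g y) \<le> e"
    using uniformly_small_family[OF assms] by blast
  have UX: "U \<subseteq> X" if "U \<in> \<U>" for U using \<U>(2)[OF that] openin_imp_subset by blast
  \<comment> \<open>With no points to test, this neighbourhood is the whole group.\<close>
  have "pnbhd 0 {} 1 \<subseteq> (\<Union>U\<in>\<U>. small_on e U)" using \<U>(3) by (auto simp: small_on_def)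
  then obtain U \<gamma> S d where U: "U \<in> \<U>" and S: "finite S" "S \<subseteq> X" "d > 0" "pnbhd \<gamma> S d \<subseteq> small_on e U"
    using finite_cover_interior[OF \<U>(1) UX, of "{}" 1 0 e] by auto
  obtain d' where d': "d' > 0" "\<And>x y. x \<in> X \<Longrightarrow> y \<in> X \<Longrightarrow> dist x y < d' \<Longrightarrow> dist (act \<gamma> x) (act \<gamma> y) < d"
    using act_uniform[OF S(3)] by blast
  have "dist (act \<gamma> (act h x)) (act \<gamma> (act h y)) \<le> e"
    if h: "\<forall>s\<in>S. dist (act h s) s < d'" and xy: "x \<in> U" "y \<in> U" for h x y
  proof -
    have "\<gamma> + h \<in> pnbhd \<gamma> S d"
      unfolding pnbhd_def
    proof (clarify)
      fix s assume s: "s \<in> S"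
      then have sX: "s \<in> X" using S by blast
      show "dist (act (\<gamma> + h) s) (act \<gamma> s) < d"
        using d'(2)[OF act_in[OF sX] sX, of h] h s sX by (simp add: act_add)
    qed
    then have "dist (act (\<gamma> + h) x) (act (\<gamma> + h) y) \<le> e" using S(4) xy by (auto simp: small_on_def)
    then show ?thesis using xy UX[OF U] by (simp add: act_add subset_iff)
  qed
  then have "contracted e U" unfolding contracted_def using S d'(1) by blast
  with \<U>(2)[OF U] that show ?thesis by blast
qed

text \<open>Contracted open sets occur inside every nonempty open V, so each \<open>G n\<close> is
  open and dense.\<close>

lemma generic_point:
  assumes "distal_system X act" "injective_system X act" "X \<noteq> {}"
  obtains z where "z \<in> X" "\<And>e. e > 0 \<Longrightarrow> \<exists>U. openin (top_of_set X) U \<and> z \<in> U \<and> contracted e U"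
proof -
  define G where "G n = \<Union>{U. openin (top_of_set X) U \<and> contracted (1 / real (Suc n)) U}" for n
  have "top_of_set X closure_of \<Inter>(range G) = topspace (top_of_set X)"
  proof (rule Baire_category)
    have "compact_space (top_of_set X)" using compact_X by (simp add: compact_space_subtopology)
    moreover have "Hausdorff_space (top_of_set X)" by (simp add: Hausdorff_space_subtopology)
    ultimately show "completely_metrizable_space (top_of_set X) \<or> locally_compact_space (top_of_set X) \<and> regular_space (top_of_set X)"
      using compact_imp_locally_compact_space compact_Hausdorff_imp_regular_space by blast
    show "countable (range G)" by simp
    fix T assume "T \<in> range G"
    then obtain n where T: "T = G n" by blast
    have "openin (top_of_set X) T" unfolding T G_def by (rule openin_Union) auto
    moreover have "top_of_set X closure_of T = topspace (top_of_set X)"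
      unfolding dense_intersects_open
    proof (intro allI impI)
      fix V assume "openin (top_of_set X) V \<and> V \<noteq> {}"
      then obtain U where "openin (top_of_set X) U" "U \<noteq> {}" "U \<subseteq> V" "contracted (1 / real (Suc n)) U"
        using contracted_exists[OF assms(1,2), of "1 / real (Suc n)" V] by auto
      then show "T \<inter> V \<noteq> {}" unfolding T G_def by blast
    qed
    ultimately show "openin (top_of_set X) T \<and> top_of_set X closure_of T = topspace (top_of_set X)" by blast
  qed
  then have "\<Inter>(range G) \<noteq> {}" using assms(3) by (metis closure_of_empty topspace_euclidean_subtopology)
  then obtain z where z: "\<And>n. z \<in> G n" by blast
  show ?thesis
  proof (rule that[of z])
    show "z \<in> X" using z[of 0] openin_imp_subset unfolding G_def by blast
    fix e :: real assume "e > 0"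
    then obtain n where n: "1 / real (Suc n) < e" using reals_Archimedean by (auto simp: inverse_eq_divide)
    obtain U where U: "openin (top_of_set X) U" "z \<in> U" "contracted (1 / real (Suc n)) U"
      using z[of n] unfolding G_def by blast
    have "contracted e U" using U(3) n unfolding contracted_def by (meson less_imp_le order_trans)
    with U show "\<exists>U. openin (top_of_set X) U \<and> z \<in> U \<and> contracted e U" by blast
  qed
qed

lemma equicontinuous_at_generic:
  assumes d: "distal_system X act" and z: "z \<in> X"
    and gen: "\<And>e. e > 0 \<Longrightarrow> \<exists>U. openin (top_of_set X) U \<and> z \<in> U \<and> contracted e U" and e: "e > 0"
  shows "\<exists>d>0. \<forall>y\<in>X. dist z y < d \<longrightarrow> (\<forall>g. dist (act g z) (act g y) < e)"
proof (rule ccontr)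
  assume "\<not> ?thesis"
  then have neg: "\<exists>y\<in>X. dist z y < r \<and> (\<exists>g. dist (act g z) (act g y) \<ge> e)" if "r > 0" for r
    using that by (meson not_less)
  have "\<exists>y g. y \<in> X \<and> dist z y < 1 / real (Suc n) \<and> dist (act g z) (act g y) \<ge> e" for n
    using neg[of "1 / real (Suc n)"] by auto
  then obtain y g where y: "\<And>n. y n \<in> X" "\<And>n. dist z (y n) < 1 / real (Suc n)"
    and g: "\<And>n. dist (act (g n) z) (act (g n) (y n)) \<ge> e" by metis
  \<comment> \<open>The extra index \<open>None\<close> follows the moving point, the indices
    \<open>Some x\<close> the fixed ones. One cluster point thus yields compatible limits: w for g n
    (y n), and the element p of E(X).\<close>
  define a where "a n i = (case i of None \<Rightarrow> act (g n) (y n) | Some x \<Rightarrow> act (g n) x)" for n i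
  obtain b where bX: "\<And>i. i \<in> insert None (Some ` X) \<Longrightarrow> b i \<in> X"
    and cl: "\<And>K e n0. finite K \<Longrightarrow> K \<subseteq> insert None (Some ` X) \<Longrightarrow> e > 0 \<Longrightarrow> \<exists>n\<ge>n0. \<forall>i\<in>K. dist (a n i) (b i) < e"
  proof (rule cluster_point[of "insert None (Some ` X)" "\<lambda>_. X" a])
    show "a n i \<in> X" if "i \<in> insert None (Some ` X)" for n i using that y act_in by (auto simp: a_def)
  qed (use compact_X in blast)+
  define w where "w = b None"
  define p where "p = restrict (\<lambda>x. b (Some x)) X"
  have w: "w \<in> X" using bX by (simp add: w_def)
  have cl': "\<exists>n\<ge>n0. dist (act (g n) (y n)) w < r \<and> (\<forall>s\<in>S. dist (act (g n) s) (p s) < r)"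
    if "finite S" "S \<subseteq> X" "r > 0" for S r n0
    using cl[of "insert None (Some ` S)" r n0] that by (auto simp: a_def p_def w_def subset_iff)
  have p: "p \<in> E_X X act"
    unfolding E_X_iff
  proof (intro conjI allI impI)
    show "p \<in> X \<rightarrow>\<^sub>E X" using bX by (auto simp: p_def)
    show "\<exists>g. \<forall>s\<in>S. dist (act g s) (p s) < r" if "finite S" "S \<subseteq> X" "r > 0" for S r
      using cl'[OF that, of 0] by blast
  qed
  have far: "dist (p z) w \<ge> e"
  proof (rule field_le_epsilon)
    fix r :: real assume "r > 0"
    then obtain n where n: "dist (act (g n) (y n)) w < r/2" "dist (act (g n) z) (p z) < r/2"
      using cl'[of "{z}" "r/2" 0] z by auto
    have "dist (act (g n) z) (act (g n) (y n)) \<le> dist (act (g n) z) (p z) + dist (p z) w + dist (act (g n) (y n)) w"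
      using dist_triangle[of "act (g n) z" "act (g n) (y n)" "p z"] dist_triangle2[of "p z" "act (g n) (y n)" w] by linarith
    with g[of n] n show "e \<le> dist (p z) w + r" by linarith
  qed
  \<comment> \<open>Composing with the inverse of p turns the g n into elements close to the
    identity, and moves w to q w; this differs from z because p separates the two.\<close>
  obtain q where q: "q \<in> E_X X act" "\<And>x. x \<in> X \<Longrightarrow> q (p x) = x" "\<And>x. x \<in> X \<Longrightarrow> p (q x) = x"
    using E_X_inverse[OF d p] by blast
  have qw: "q w \<in> X" using E_X_in[OF q(1) w] .
  have "z \<noteq> q w" using far e q(3)[OF w] by auto
  then obtain r where r: "r > 0" "\<And>g. dist (act g z) (act g (q w)) \<ge> r"
    using distal_no_proximal[OF d z qw] by (meson not_less)
  \<comment> \<open>The contradiction will be r \<le> r/8 + r/2 + r/8 at \<gamma>, where r bounds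
    the distance of z and q w from below under all group elements.\<close>
  obtain U where U: "openin (top_of_set X) U" "z \<in> U" "contracted (r/2) U" using gen[of "r/2"] r by auto
  obtain \<gamma> S \<delta> where S: "finite S" "S \<subseteq> X" "\<delta> > 0"
    and con: "\<And>h x y. (\<forall>s\<in>S. dist (act h s) s < \<delta>) \<Longrightarrow> x \<in> U \<Longrightarrow> y \<in> U \<Longrightarrow> dist (act \<gamma> (act h x)) (act \<gamma> (act h y)) \<le> r/2"
    using U(3) unfolding contracted_def by metis
  obtain \<kappa> where \<kappa>: "\<kappa> > 0" "\<And>x y. x \<in> X \<Longrightarrow> y \<in> X \<Longrightarrow> dist x y < \<kappa> \<Longrightarrow> dist (act \<gamma> x) (act \<gamma> y) < r/8"
    using act_uniform[of "r/8" \<gamma>] r by auto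
  define m where "m = min \<delta> \<kappa>"
  have m: "m > 0" using S \<kappa> by (simp add: m_def)
  define T where "T = insert z S"
  have T: "finite T" "T \<subseteq> X" using S z by (auto simp: T_def)
  have pX: "p s \<in> X" if "s \<in> X" for s using E_X_in[OF p that] .
  \<comment> \<open>q may be discontinuous, so h replaces it at finitely many points first; then
    \<theta> is a modulus for this h, and only afterwards is n chosen.\<close>
  obtain h where h: "\<And>t. t \<in> insert w (p ` T) \<Longrightarrow> dist (act h t) (q t) < m/2"
    using E_X_approx[OF q(1), of "insert w (p ` T)" "m/2"] T w pX m by (auto simp: subset_iff)
  obtain \<theta> where \<theta>: "\<theta> > 0" "\<And>x y. x \<in> X \<Longrightarrow> y \<in> X \<Longrightarrow> dist x y < \<theta> \<Longrightarrow> dist (act h x) (act h y) < m/2"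
    using act_uniform[of "m/2" h] m by auto
  obtain \<rho> where \<rho>: "\<rho> > 0" "\<And>x. x \<in> X \<Longrightarrow> dist x z < \<rho> \<Longrightarrow> x \<in> U"
    using U unfolding openin_euclidean_subtopology_iff by blast
  obtain n0 where n0: "1 / real (Suc n0) < \<rho>" using \<rho>(1) reals_Archimedean by (auto simp: inverse_eq_divide)
  obtain n where n: "n \<ge> n0" "dist (act (g n) (y n)) w < \<theta>" "\<And>s. s \<in> T \<Longrightarrow> dist (act (g n) s) (p s) < \<theta>"
    using cl'[OF T \<theta>(1), of n0] by blast
  have yU: "y n \<in> U"
  proof (rule \<rho>(2)[OF y(1)])
    have "1 / real (Suc n) \<le> 1 / real (Suc n0)" using n(1) by (simp add: frac_le)
    then show "dist (y n) z < \<rho>" using y(2)[of n] n0 by (simp add: dist_commute)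
  qed
  have close: "dist (act (h + g n) x) v < m" if "x \<in> X" "t \<in> X" "dist (act (g n) x) t < \<theta>" "dist (act h t) v < m/2" for x t v
    using \<theta>(2)[OF act_in[OF that(1)] that(2,3)] that(4) dist_triangle[of "act h (act (g n) x)" v "act h t"] that(1)
    by (simp add: act_add)
  have kT: "dist (act (h + g n) s) s < m" if "s \<in> T" for s
    using close[of s "p s" s] n(3)[OF that] h[of "p s"] T that pX q(2) by auto
  have ky: "dist (act (h + g n) (y n)) (q w) < m"
    using close[OF y(1) w n(2)] h[of w] by auto
  have "\<forall>s\<in>S. dist (act (h + g n) s) s < \<delta>" using kT by (auto simp: T_def m_def)
  from con[OF this U(2) yU]
  have "dist (act \<gamma> (act (h + g n) z)) (act \<gamma> (act (h + g n) (y n))) \<le> r/2" .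
  moreover have "dist (act \<gamma> (act (h + g n) z)) (act \<gamma> z) < r/8"
    using \<kappa>(2)[OF act_in[OF z] z] kT[of z] by (auto simp: T_def m_def)
  moreover have "dist (act \<gamma> (act (h + g n) (y n))) (act \<gamma> (q w)) < r/8"
    using \<kappa>(2)[OF act_in[OF y(1)] qw] ky by (auto simp: m_def)
  moreover have "dist (act \<gamma> z) (act \<gamma> (q w)) \<le> dist (act \<gamma> (act (h + g n) z)) (act \<gamma> z)
      + dist (act \<gamma> (act (h + g n) z)) (act \<gamma> (act (h + g n) (y n))) + dist (act \<gamma> (act (h + g n) (y n))) (act \<gamma> (q w))"
    using dist_triangle3[of "act \<gamma> z" "act \<gamma> (q w)" "act \<gamma> (act (h + g n) z)"]
      dist_triangle[of "act \<gamma> (act (h + g n) z)" "act \<gamma> (q w)" "act \<gamma> (act (h + g n) (y n))"] by linarith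
  ultimately show False using r(1) r(2)[of \<gamma>] by linarith
qed

text \<open>Some \<gamma> brings x close to z and, by continuity, a neighbourhood of x close to z.
  Writing g = (g - \<gamma>) + \<gamma> then transfers the uniform bound from z to x.\<close>

lemma minimal_equicontinuous:
  assumes min: "minimal_system X act" and z: "z \<in> X"
    and eq: "\<And>e. e > 0 \<Longrightarrow> \<exists>d>0. \<forall>y\<in>X. dist z y < d \<longrightarrow> (\<forall>g. dist (act g z) (act g y) < e)"
  shows "equicontinuous_system X act"
  unfolding equicontinuous_system_def
proof (intro ballI allI impI)
  fix x and e :: real assume x: "x \<in> X" and e: "e > 0"
  obtain d where d: "d > 0" "\<And>y g. y \<in> X \<Longrightarrow> dist z y < d \<Longrightarrow> dist (act g z) (act g y) < e/2"
    using eq[of "e/2"] e by auto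
  have "z \<in> closure (range (\<lambda>g. act g x))" using min x z by (auto simp: minimal_system_def)
  then obtain \<gamma> where \<gamma>: "dist (act \<gamma> x) z < d/2" using d(1) by (force simp: closure_approachable dest: spec[of _ "d/2"])
  obtain c where c: "c > 0" "\<And>u v. u \<in> X \<Longrightarrow> v \<in> X \<Longrightarrow> dist u v < c \<Longrightarrow> dist (act \<gamma> u) (act \<gamma> v) < d/2"
    using act_uniform[of "d/2" \<gamma>] d by auto
  have "dist (act g x) (act g y) < e" if y: "y \<in> X" "dist x y < c" for y g
  proof -
    have "dist z (act \<gamma> x) < d" using \<gamma> d(1) by (simp add: dist_commute)
    moreover have "dist z (act \<gamma> y) < d"
      using c(2)[OF x y] \<gamma> dist_triangle[of z "act \<gamma> y" "act \<gamma> x"] by (simp add: dist_commute)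
    ultimately have "dist (act (g - \<gamma>) z) (act (g - \<gamma>) (act \<gamma> x)) < e/2" "dist (act (g - \<gamma>) z) (act (g - \<gamma>) (act \<gamma> y)) < e/2"
      using d(2) act_in x y by auto
    then have "dist (act (g - \<gamma> + \<gamma>) x) (act (g - \<gamma> + \<gamma>) y) < e"
      using dist_triangle3[of "act (g - \<gamma>) (act \<gamma> x)" "act (g - \<gamma>) (act \<gamma> y)" "act (g - \<gamma>) z"]
      by (simp only: act_add[OF x] act_add[OF y(1)])
    then show ?thesis by simp
  qed
  with c(1) show "\<exists>d>0. \<forall>y\<in>X. dist x y < d \<longrightarrow> (\<forall>g. dist (act g x) (act g y) < e)" by blast
qed

lemma injective_imp_equicontinuous:
  assumes "minimal_system X act" "distal_system X act" "injective_system X act"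
  shows "equicontinuous_system X act"
proof (cases "X = {}")
  case False
  obtain z where z: "z \<in> X" "\<And>e. e > 0 \<Longrightarrow> \<exists>U. openin (top_of_set X) U \<and> z \<in> U \<and> contracted e U"
    using generic_point[OF assms(2,3) False] by blast
  show ?thesis
    using minimal_equicontinuous[OF assms(1) z(1) equicontinuous_at_generic[OF assms(2) z]] by blast
qed (simp add: equicontinuous_system_def)

end

section \<open>Equicontinuous systems are injective\<close>

context compact_system
begin

text \<open>A Lebesgue number for the balls of pointwise equicontinuity makes the modulus uniform;
  two points of one ball are compared through its centre, hence c/2.\<close>

lemma uniformly_equicontinuous:
  assumes eq: "equicontinuous_system X act" and f: "continuous_on X (f :: 'a \<Rightarrow> 'b::metric_space)" and e: "e > 0"
  obtains d where "d > 0" "\<And>x y g. x \<in> X \<Longrightarrow> y \<in> X \<Longrightarrow> dist x y < d \<Longrightarrow> dist (f (act g x)) (f (act g y)) < e"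
proof -
  obtain c where c: "c > 0" "\<And>x y. x \<in> X \<Longrightarrow> y \<in> X \<Longrightarrow> dist x y < c \<Longrightarrow> dist (f x) (f y) < e"
    using compact_uniformly_continuous[OF f compact_X] e unfolding uniformly_continuous_on_def by metis
  have "\<exists>d>0. \<forall>y\<in>X. dist x y < d \<longrightarrow> (\<forall>g. dist (act g x) (act g y) < c/2)" if "x \<in> X" for x
    using eq c(1) that unfolding equicontinuous_system_def by (meson half_gt_zero)
  then obtain d where d: "\<And>x. x \<in> X \<Longrightarrow> d x > 0"
    "\<And>x y g. x \<in> X \<Longrightarrow> y \<in> X \<Longrightarrow> dist x y < d x \<Longrightarrow> dist (act g x) (act g y) < c/2" by metis
  obtain \<delta> where \<delta>: "\<delta> > 0" "\<And>x. x \<in> X \<Longrightarrow> \<exists>G\<in>(\<lambda>x. ball x (d x)) ` X. ball x \<delta> \<subseteq> G"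
  proof (rule Heine_Borel_lemma[OF compact_X, of "(\<lambda>x. ball x (d x)) ` X"])
    show "X \<subseteq> \<Union>((\<lambda>x. ball x (d x)) ` X)" using d(1) by fastforce
  qed auto
  have "dist (f (act g x)) (f (act g y)) < e" if xy: "x \<in> X" "y \<in> X" "dist x y < \<delta>" for x y g
  proof -
    obtain u where u: "u \<in> X" "ball x \<delta> \<subseteq> ball u (d u)" using \<delta>(2)[OF xy(1)] by blast
    have "x \<in> ball x \<delta>" "y \<in> ball x \<delta>" using \<delta>(1) xy by auto
    then have "dist u x < d u" "dist u y < d u" using u(2) by (auto simp: subset_iff)
    then have "dist (act g u) (act g x) < c/2" "dist (act g u) (act g y) < c/2" using d(2) u xy by auto
    then have "dist (act g x) (act g y) < c"
      using dist_triangle3[of "act g x" "act g y" "act g u"] by linarith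
    then show ?thesis using c(2) act_in xy by blast
  qed
  with \<delta>(1) that show ?thesis by blast
qed

lemma E_X_continuous:
  assumes eq: "equicontinuous_system X act" and p: "p \<in> E_X X act"
  shows "continuous_on X p"
  unfolding continuous_on_iff
proof (intro ballI allI impI)
  fix x and e :: real assume x: "x \<in> X" and e: "e > 0"
  obtain d where d: "d > 0" "\<And>x y g. x \<in> X \<Longrightarrow> y \<in> X \<Longrightarrow> dist x y < d \<Longrightarrow> dist (act g x) (act g y) < e/3"
    using uniformly_equicontinuous[OF eq continuous_on_id, of "e/3"] e by auto
  have "dist (p y) (p x) < e" if y: "y \<in> X" "dist y x < d" for y
  proof -
    obtain g where g: "\<And>s. s \<in> {x, y} \<Longrightarrow> dist (act g s) (p s) < e/3"
      using E_X_approx[OF p, of "{x, y}" "e/3"] x y e by auto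
    have "dist (p y) (p x) \<le> dist (act g y) (p y) + dist (act g y) (act g x) + dist (act g x) (p x)"
      using dist_triangle3[of "p y" "p x" "act g y"] dist_triangle[of "act g y" "p x" "act g x"] by linarith
    with g[of x] g[of y] d(2)[OF y(1) x y(2), of g] show ?thesis by auto
  qed
  with d(1) show "\<exists>d>0. \<forall>y\<in>X. dist y x < d \<longrightarrow> dist (p y) (p x) < e" by blast
qed

text \<open>A net fine enough for the common modulus of all f \<circ> g and for that of f \<circ> p
  controls the whole space; the three errors are one at the net point and one for each
  modulus.\<close>

lemma uniform_approx:
  fixes f :: "'a \<Rightarrow> real"
  assumes eq: "equicontinuous_system X act" and p: "p \<in> E_X X act" and f: "continuous_on X f" and e: "e > 0"
  obtains S where "finite S" "S \<subseteq> X"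
    "\<And>g. \<forall>s\<in>S. \<bar>f (act g s) - f (p s)\<bar> < e \<Longrightarrow> \<forall>x\<in>X. \<bar>f (act g x) - f (p x)\<bar> \<le> 3 * e"
proof -
  obtain d where d: "d > 0" "\<And>x y g. x \<in> X \<Longrightarrow> y \<in> X \<Longrightarrow> dist x y < d \<Longrightarrow> dist (f (act g x)) (f (act g y)) < e"
    using uniformly_equicontinuous[OF eq f e] by blast
  have cp: "continuous_on X (\<lambda>x. f (p x))"
    by (rule continuous_on_compose2[OF f E_X_continuous[OF eq p]]) (auto simp: E_X_in[OF p])
  obtain d' where d': "d' > 0" "\<And>x y. x \<in> X \<Longrightarrow> y \<in> X \<Longrightarrow> dist x y < d' \<Longrightarrow> dist (f (p x)) (f (p y)) < e"
    using compact_uniformly_continuous[OF cp compact_X] e unfolding uniformly_continuous_on_def by metis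
  obtain S where S: "finite S" "S \<subseteq> X" "X \<subseteq> (\<Union>s\<in>S. ball s (min d d'))"
    using compactE_image[OF compact_X, of X "\<lambda>s. ball s (min d d')"] d(1) d'(1) by force
  show ?thesis
  proof (rule that[OF S(1,2)], rule ballI)
    fix g x assume g: "\<forall>s\<in>S. \<bar>f (act g s) - f (p s)\<bar> < e" and x: "x \<in> X"
    obtain s where s: "s \<in> S" "dist s x < min d d'" using S(3) x by auto
    then have sX: "s \<in> X" using S(2) by blast
    have "\<bar>f (act g s) - f (act g x)\<bar> < e" "\<bar>f (p s) - f (p x)\<bar> < e"
      using d(2)[OF sX x, of g] d'(2)[OF sX x] s(2) by (auto simp: dist_real_def)
    moreover have "\<bar>f (act g s) - f (p s)\<bar> < e" using g s(1) by blast
    ultimately show "\<bar>f (act g x) - f (p x)\<bar> \<le> 3 * e" by linarith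
  qed
qed

lemma integral_close:
  fixes f h :: "'a \<Rightarrow> real"
  assumes N: "N \<in> PM X" and f: "continuous_on X f" and h: "continuous_on X h" and le: "\<And>x. x \<in> X \<Longrightarrow> \<bar>f x - h x\<bar> \<le> c"
  shows "\<bar>integral\<^sup>L N f - integral\<^sup>L N h\<bar> \<le> c"
proof -
  interpret prob_space N using N by (simp add: PM_def)
  note i = integrable_PM[OF compact_X N]
  have "\<bar>integral\<^sup>L N f - integral\<^sup>L N h\<bar> = \<bar>integral\<^sup>L N (\<lambda>x. f x - h x)\<bar>" using i f h by simp
  also have "\<dots> \<le> integral\<^sup>L N (\<lambda>x. \<bar>f x - h x\<bar>)" by (rule integral_abs_bound)
  also have "\<dots> \<le> integral\<^sup>L N (\<lambda>_. c)"
    using le space_PM[OF N] by (intro integral_mono i continuous_intros f h) auto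
  finally show ?thesis by (simp add: prob_space)
qed

lemma E_M_push:
  assumes eq: "equicontinuous_system X act" and P: "P \<in> E_M X act" and N: "N \<in> PM X"
  shows "P N = distr N (borelX X) (natural_map X P)"
proof -
  let ?p = "natural_map X P"
  have p: "?p \<in> E_X X act" by (rule natural_map_E_X[OF P])
  have cp: "continuous_on X ?p" by (rule E_X_continuous[OF eq p])
  have pX: "?p \<in> X \<rightarrow> X" using E_X_in[OF p] by auto
  show ?thesis
  proof (rule PM_eqI[OF compact_X E_M_PM[OF P N] distr_PM(1)[OF cp pX N]])
    fix f :: "'a \<Rightarrow> real" assume f: "continuous_on X f"
    have cfp: "continuous_on X (\<lambda>x. f (?p x))"
      by (rule continuous_on_compose2[OF f cp]) (use pX in auto)
    have "\<bar>integral\<^sup>L (P N) f - integral\<^sup>L N (\<lambda>x. f (?p x))\<bar> \<le> 0"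
    proof (rule field_le_epsilon)
      fix r :: real assume "r > 0"
      then have r: "r/4 > 0" by simp
      obtain S where S: "finite S" "S \<subseteq> X"
        "\<And>g. \<forall>s\<in>S. \<bar>f (act g s) - f (?p s)\<bar> < r/4 \<Longrightarrow> \<forall>x\<in>X. \<bar>f (act g x) - f (?p x)\<bar> \<le> 3 * (r/4)"
        using uniform_approx[OF eq p f r] by blast
      \<comment> \<open>Including the Dirac measures of the net among the tests forces this g to be
        close to the restriction of P there, so the same g approximates both sides of the
        claim.\<close>
      obtain g where g: "\<And>M h. (M, h) \<in> insert (N, f) ((\<lambda>s. (dirac X s, f)) ` S) \<Longrightarrow>
          \<bar>integral\<^sup>L M (\<lambda>x. h (act g x)) - integral\<^sup>L (P M) h\<bar> < r/4"
        by (rule E_M_approx[OF P, of "insert (N, f) ((\<lambda>s. (dirac X s, f)) ` S)" "r/4"])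
           (use S(1,2) N f r in \<open>auto intro!: dirac_PM(1)\<close>)
      have "\<bar>f (act g s) - f (?p s)\<bar> < r/4" if s: "s \<in> S" for s
      proof -
        have sX: "s \<in> X" using s S by blast
        have "integral\<^sup>L (dirac X s) (\<lambda>x. f (act g x)) = f (act g s)"
          by (rule dirac_PM(2)[OF sX continuous_comp_act[OF f]])
        moreover have "integral\<^sup>L (P (dirac X s)) f = f (?p s)"
          using natural_map[OF P sX] dirac_PM(2)[OF natural_map(1)[OF P sX] f] by simp
        ultimately show ?thesis using g[of "dirac X s" f] s by auto
      qed
      then have "\<bar>integral\<^sup>L N (\<lambda>x. f (act g x)) - integral\<^sup>L N (\<lambda>x. f (?p x))\<bar> \<le> 3 * (r/4)"
        using S(3)[of g] by (intro integral_close[OF N continuous_comp_act[OF f] cfp]) blast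
      moreover have "\<bar>integral\<^sup>L N (\<lambda>x. f (act g x)) - integral\<^sup>L (P N) f\<bar> < r/4" using g[of N f] by auto
      ultimately show "\<bar>integral\<^sup>L (P N) f - integral\<^sup>L N (\<lambda>x. f (?p x))\<bar> \<le> 0 + r" by linarith
    qed
    then show "integral\<^sup>L (P N) f = integral\<^sup>L (distr N (borelX X) ?p) f"
      using distr_PM(2)[OF cp pX N f] by simp
  qed
qed

text \<open>Supplies the preimage needed for surjectivity of the natural map: a g close to q on
  finitely many nets is uniformly close for all test functions involved, so push-forwards along g
  approximate the one along q.\<close>

lemma push_E_M:
  assumes eq: "equicontinuous_system X act" and q: "q \<in> E_X X act"
  shows "restrict (\<lambda>N. distr N (borelX X) q) (PM X) \<in> E_M X act" (is "?P \<in> _")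
    and "natural_map X (restrict (\<lambda>N. distr N (borelX X) q) (PM X)) = q"
proof -
  have cq: "continuous_on X q" by (rule E_X_continuous[OF eq q])
  have qX: "q \<in> X \<rightarrow> X" using E_X_in[OF q] by auto
  show P: "?P \<in> E_M X act"
    unfolding E_M_iff
  proof (intro conjI allI impI)
    show "?P \<in> PM X \<rightarrow>\<^sub>E PM X" using distr_PM(1)[OF cq qX] by auto
    fix K :: "('a measure \<times> ('a \<Rightarrow> real)) set" and e :: real
    assume K: "finite K" "\<forall>(N, f)\<in>K. N \<in> PM X \<and> continuous_on X f" "e > 0"
    have Kc: "N \<in> PM X" "continuous_on X f" if "(N, f) \<in> K" for N f using K(2) that by auto
    define c where "c = e/4"
    have c: "c > 0" "3 * c < e" using K by (auto simp: c_def)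
    define R where "R f S \<longleftrightarrow> finite S \<and> S \<subseteq> X \<and>
      (\<forall>g. (\<forall>s\<in>S. \<bar>f (act g s) - f (q s)\<bar> < c) \<longrightarrow> (\<forall>x\<in>X. \<bar>f (act g x) - f (q x)\<bar> \<le> 3 * c))" for f :: "'a \<Rightarrow> real" and S
    have "\<exists>S. R f S" if "f \<in> snd ` K" for f
    proof -
      have "continuous_on X f" using that Kc by auto
      from uniform_approx[OF eq q this c(1)] show ?thesis unfolding R_def by metis
    qed
    then obtain S where S: "\<And>f. f \<in> snd ` K \<Longrightarrow> R f (S f)" by metis
    have "\<forall>f\<in>snd ` K. \<exists>d>0. \<forall>x\<in>X. \<forall>y\<in>X. dist x y < d \<longrightarrow> \<bar>f x - f y\<bar> < c"
    proof
      fix f assume "f \<in> snd ` K"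
      then have "continuous_on X f" using Kc by auto
      then show "\<exists>d>0. \<forall>x\<in>X. \<forall>y\<in>X. dist x y < d \<longrightarrow> \<bar>f x - f y\<bar> < c"
        using compact_uniformly_continuous[OF _ compact_X, of f] c(1)
        unfolding uniformly_continuous_on_def dist_real_def by (metis abs_minus_commute dist_commute)
    qed
    then obtain d where d: "\<And>f. f \<in> snd ` K \<Longrightarrow> d f > 0"
      "\<And>f x y. f \<in> snd ` K \<Longrightarrow> x \<in> X \<Longrightarrow> y \<in> X \<Longrightarrow> dist x y < d f \<Longrightarrow> \<bar>f x - f y\<bar> < c" by metis
    define m where "m = Min (insert 1 (d ` snd ` K))"
    have m: "m > 0" "\<And>f. f \<in> snd ` K \<Longrightarrow> m \<le> d f" using K(1) d(1) by (auto simp: m_def)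
    have "finite (\<Union>f\<in>snd ` K. S f)" "(\<Union>f\<in>snd ` K. S f) \<subseteq> X" using K(1) S by (auto simp: R_def)
    then obtain g where g: "\<And>s. s \<in> (\<Union>f\<in>snd ` K. S f) \<Longrightarrow> dist (act g s) (q s) < m"
      using E_X_approx[OF q _ _ m(1)] by metis
    show "\<exists>g. \<forall>(N, f)\<in>K. \<bar>integral\<^sup>L N (\<lambda>x. f (act g x)) - integral\<^sup>L (?P N) f\<bar> < e"
    proof (rule exI[of _ g], clarify)
      fix N f assume Nf: "(N, f) \<in> K"
      then have fK: "f \<in> snd ` K" by force
      have cfq: "continuous_on X (\<lambda>x. f (q x))"
        by (rule continuous_on_compose2[OF Kc(2)[OF Nf] cq]) (use qX in auto)
      have "\<bar>f (act g s) - f (q s)\<bar> < c" if s: "s \<in> S f" for s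
      proof -
        have sX: "s \<in> X" using S[OF fK] s by (auto simp: R_def)
        have "dist (act g s) (q s) < d f" using g[of s] s fK m(2)[OF fK] by fastforce
        then show ?thesis using d(2)[OF fK act_in[OF sX] E_X_in[OF q sX]] by blast
      qed
      then have "\<And>x. x \<in> X \<Longrightarrow> \<bar>f (act g x) - f (q x)\<bar> \<le> 3 * c" using S[OF fK] unfolding R_def by blast
      then have "\<bar>integral\<^sup>L N (\<lambda>x. f (act g x)) - integral\<^sup>L N (\<lambda>x. f (q x))\<bar> \<le> 3 * c"
        by (intro integral_close Kc[OF Nf] continuous_comp_act cfq)
      then show "\<bar>integral\<^sup>L N (\<lambda>x. f (act g x)) - integral\<^sup>L (?P N) f\<bar> < e"
        using distr_PM(2)[OF cq qX Kc(1)[OF Nf] Kc(2)[OF Nf]] Kc(1)[OF Nf] c(2) by simp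
    qed
  qed
  show "natural_map X ?P = q"
  proof
    fix x
    show "natural_map X ?P x = q x"
    proof (cases "x \<in> X")
      case True
      show ?thesis
      proof (rule natural_map_eqI[OF P True E_X_in[OF q True]])
        have "distr (dirac X x) (borelX X) q = dirac X (q x)"
          unfolding dirac_def
        proof (rule distr_return)
          show "q \<in> borelX X \<rightarrow>\<^sub>M borelX X"
            using measurable_continuous_PM[OF cq qX dirac_PM(1)[OF True]] by (simp add: dirac_def)
          show "x \<in> space (borelX X)" using True by (simp add: borelX_def space_restrict_space)
        qed
        then show "?P (dirac X x) = dirac X (q x)" using dirac_PM(1)[OF True] by simp
      qed
    next
      case False
      then show ?thesis using q unfolding E_X_iff by (auto simp: natural_map_def PiE_def extensional_def)
    qed
  qed
qed

lemma equicontinuous_imp_injective: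
  assumes eq: "equicontinuous_system X act"
  shows "injective_system X act"
  unfolding injective_system_def bij_betw_def
proof
  show "inj_on (natural_map X) (E_M X act)"
  proof (rule inj_onI)
    fix P Q assume PQ: "P \<in> E_M X act" "Q \<in> E_M X act" "natural_map X P = natural_map X Q"
    show "P = Q"
    proof (rule extensionalityI[where A="PM X"])
      show "P \<in> extensional (PM X)" "Q \<in> extensional (PM X)" using PQ by (auto simp: E_M_iff PiE_def)
      show "P N = Q N" if "N \<in> PM X" for N using E_M_push[OF eq PQ(1) that] E_M_push[OF eq PQ(2) that] PQ(3) by simp
    qed
  qed
  show "natural_map X ` E_M X act = E_X X act"
  proof
    show "natural_map X ` E_M X act \<subseteq> E_X X act" using natural_map_E_X by blast
    show "E_X X act \<subseteq> natural_map X ` E_M X act" using push_E_M[OF eq] by (metis image_eqI subsetI)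
  qed
qed

end

theorem mainTheorem3:
  fixes X :: "'a::metric_space set" and act :: "'g::topological_group_add \<Rightarrow> 'a \<Rightarrow> 'a"
  assumes "dyn_system X act" and "minimal_system X act" and "distal_system X act"
  shows "injective_system X act \<longleftrightarrow> equicontinuous_system X act"
proof -
  interpret compact_system X act by unfold_locales (rule assms(1))
  show ?thesis
    using injective_imp_equicontinuous[OF assms(2,3)] equicontinuous_imp_injective by blast
qed

end
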